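(* Let $(P,A,\lambda)$ be a marked poset with $\lambda$ integer-valued, and let $H$ be a bounded strongly planar embedding of $(P,A,\lambda)$ with associated flow network $G=G_{(P,A,\lambda)}$. Define $\Gamma$ on $\mathcal{O}(P,A)_\lambda$ by $\Gamma(x)=f\in\mathbb{R}^{E(G)}$, where for the edge $e$ of $G$ crossing the covering relation $p\lessdot q$ of $\widehat P$ we set $f(e)=x_q-x_p$ (with the convention $x_{\hat0}=\lambda(\hat0)$, $x_{\hat1}=\lambda(\hat1)$). Then $\Gamma$ is an integral equivalence from the marked order polytope $\mathcal{O}(P,A)_\lambda$ onto the flow polytope $\mathcal{F}_{G}$.
   Context: A marked poset $(P,A,\lambda)$ consists of a finite poset $P$, a subposet $A\subseteq P$ containing all minimal and all maximal elements of $P$, and an order-preserving map $\lambda:A\to\mathbb{R}$; its marked order polytope is $\mathcal{O}(P,A)_\lambda=\{x\in\mathbb{R}^P: x_p\le x_q\text{ for }p<q,\ x_a=\lambda(a)\text{ for }a\in A\}$. Let $\widehat P=P\sqcup\{\hat0,\hat1\}$ with $\hat0<p<\hat1$ for all $p\in P$, $\widehat A=A\cup\{\hat0,\hat1\}$, and extend $\lambda$ by $\lambda(\hat0)=\min_{a\in A}\lambda(a)$, $\lambda(\hat1)=\max_{a\in A}\lambda(a)$; elements of $\widehat A$ are called marked. $P$ is strongly planar if the Hasse diagram of $\widehat P$ has a planar drawing in which $y$-coordinates strictly increase along every covering relation from the smaller to the larger element. A bounded embedding $H$ is such a drawing together with two additional edges joining $\hat0$ and $\hat1$, one drawn to the left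 of everything else and one to the right, regarded as a plane graph. For a bounded face $F$ of $H$, $\min F$ and $\max F$ are the least and greatest elements of $\widehat P$ on its boundary; removing them splits the boundary into two paths, and the left (resp. right) boundary of $F$ is the left (resp. right) path together with $\min F$ and $\max F$. $H$ is a bounded strongly planar embedding of $(P,A,\lambda)$ if for every bounded face $F$ whose left boundary contains an element of $\widehat A$, both $\min F$ and $\max F$ lie in $\widehat A$. Let $F_L$ (resp. $F_R$) be the bounded face whose left (resp. right) boundary is the additional left (resp. right) edge. Each Hasse edge $p\lessdot q$ of $\widehat P$ lies on the left boundary of exactly one bounded face $R(e)$ and on the right boundary of exactly one bounded face $L(e)$. The flow network $G_{(P,A,\lambda)}$: (i) for each bounded face $F\ne F_R$ a vertex $v_F$, with netflow $0$ if the left boundary of $F$ contains no element of $\widehat A$ and netflow $-(\lambda(\max F)-\lambda(\min F))$ otherwise; (ii) for each bounded face $F\ne F_L$ whose left boundary contains elements of $\widehat A$, say $r_1>r_2>\cdots>r_g$ (so $r_1=\max F$, $r_g=\min F$), vertices $s^F_m$, $m\in[g-1]$, with netflow $\lambda(r_m)-\lambda(r_{m+1})$; (iii) for each Hasse edge $e=(p\lessdot q)$ of $\widehat P$ one directed edge, said to cross $p\lessdot q$, with head $v_{L(e)}$ and tail $v_{R(e)}$ if the left boundary of $R(e)$ contains no element of $\widehat A$, and otherwise tail $s^{R(e)}_m$ where $e$ lies on the left boundary of $R(e)$ between $r_{m+1}$ and $r_m$. For a directed graph $G$ with netflow $a:V(G)\to\mathbb{R}$, the flow polytope is $\mathcal{F}_G=\{f\in\mathbb{R}_{\ge0}^{E(G)}:\sum_{e\text{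 out of }v}f(e)-\sum_{e\text{ into }v}f(e)=a(v)\ \forall v\}$. Two integral polytopes $\mathcal P\subseteq\mathbb{R}^d$, $\mathcal Q\subseteq\mathbb{R}^m$ are integrally equivalent via an affine map $\varphi:\mathbb{R}^d\to\mathbb{R}^m$ if $\varphi$ restricts to a bijection $\mathcal P\to\mathcal Q$ and to a bijection $\mathbb{Z}^d\cap\mathrm{aff}(\mathcal P)\to\mathbb{Z}^m\cap\mathrm{aff}(\mathcal Q)$. *)

theory Defs
  imports "HOL-Complex_Analysis.Winding_Numbers"
begin

datatype 'p ext = Bot | Elem 'p | Top

text \<open>Edges of the bounded embedding H: Hasse edges of P-hat (HE p q for p covered by q),
  and the two additional edges joining Bot and Top.\<close>
datatype 'p hedge = HE "'p ext" "'p ext" | LeftE | RightE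

datatype 'f fvert = VF 'f | SF 'f nat

fun leh :: "('p \<times> 'p) set \<Rightarrow> 'p ext \<Rightarrow> 'p ext \<Rightarrow> bool" where
  "leh R Bot _ = True"
| "leh R (Elem a) Bot = False"
| "leh R (Elem a) (Elem b) = ((a, b) \<in> R)"
| "leh R (Elem a) Top = True"
| "leh R Top Top = True"
| "leh R Top _ = False"

definition lth :: "('p \<times> 'p) set \<Rightarrow> 'p ext \<Rightarrow> 'p ext \<Rightarrow> bool" where
  "lth R p q \<longleftrightarrow> leh R p q \<and> p \<noteq> q"

definition Vhat :: "'p set \<Rightarrow> 'p ext set" where
  "Vhat P = {Bot, Top} \<union> Elem ` P"

definition covers :: "'p set \<Rightarrow> ('p \<times> 'p) set \<Rightarrow> 'p ext \<Rightarrow> 'p ext \<Rightarrow> bool" where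
  "covers P R p q \<longleftrightarrow> p \<in> Vhat P \<and> q \<in> Vhat P \<and> lth R p q \<and>
      \<not> (\<exists>r\<in>Vhat P. lth R p r \<and> lth R r q)"

text \<open>Covering relations (Hasse edges) of P-hat; these index the edges of the flow network.\<close>
definition Ecov :: "'p set \<Rightarrow> ('p \<times> 'p) set \<Rightarrow> ('p ext \<times> 'p ext) set" where
  "Ecov P R = {(p, q). covers P R p q}"

definition Marked :: "'p set \<Rightarrow> 'p ext set" where
  "Marked A = {Bot, Top} \<union> Elem ` A"

fun lamh :: "'p set \<Rightarrow> ('p \<Rightarrow> real) \<Rightarrow> 'p ext \<Rightarrow> real" where
  "lamh A lam Bot = Min (lam ` A)"
| "lamh A lam (Elem a) = lam a"
| "lamh A lam Top = Max (lam ` A)"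

definition marked_poset :: "'p set \<Rightarrow> ('p \<times> 'p) set \<Rightarrow> 'p set \<Rightarrow> ('p \<Rightarrow> real) \<Rightarrow> bool" where
  "marked_poset P R A lam \<longleftrightarrow>
     finite P \<and> R \<subseteq> P \<times> P \<and> partial_order_on P R \<and> A \<subseteq> P \<and>
     (\<forall>p\<in>P. (\<forall>q\<in>P. (q, p) \<in> R \<longrightarrow> q = p) \<longrightarrow> p \<in> A) \<and>
     (\<forall>p\<in>P. (\<forall>q\<in>P. (p, q) \<in> R \<longrightarrow> q = p) \<longrightarrow> p \<in> A) \<and>
     (\<forall>a\<in>A. \<forall>b\<in>A. (a, b) \<in> R \<longrightarrow> lam a \<le> lam b)"

text \<open>Marked order polytope, as a subset of R^P (functions vanishing outside P).\<close>
definition order_polytope :: "'p set \<Rightarrow> ('p \<times> 'p) set \<Rightarrow> 'p set \<Rightarrow> ('p \<Rightarrow> real) \<Rightarrow> ('p \<Rightarrow> real) set" where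
  "order_polytope P R A lam =
     {x. (\<forall>p. p \<notin> P \<longrightarrow> x p = 0) \<and>
         (\<forall>p\<in>P. \<forall>q\<in>P. (p, q) \<in> R \<and> p \<noteq> q \<longrightarrow> x p \<le> x q) \<and>
         (\<forall>a\<in>A. x a = lam a)}"

definition EH :: "'p set \<Rightarrow> ('p \<times> 'p) set \<Rightarrow> 'p hedge set" where
  "EH P R = {HE p q | p q. covers P R p q} \<union> {LeftE, RightE}"

fun esrc :: "'p hedge \<Rightarrow> 'p ext" where
  "esrc (HE p q) = p" | "esrc LeftE = Bot" | "esrc RightE = Bot"

fun etgt :: "'p hedge \<Rightarrow> 'p ext" where
  "etgt (HE p q) = q" | "etgt LeftE = Top" | "etgt RightE = Top"

text \<open>H is a planar drawing of the Hasse diagram of P-hat plus the two extra edges: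
  vertices at distinct points, every edge an arc between its endpoints, Hasse edges
  with strictly increasing y-coordinate, edges meeting only in common endpoints,
  no edge passing through a non-endpoint vertex; the closed curve formed by the left
  edge (upwards) and the right edge (downwards) winds -1 (clockwise) around every other
  point of the drawing, i.e. everything else lies inside it, the left edge on the left.\<close>
definition bounded_strongly_planar ::
  "'p set \<Rightarrow> ('p \<times> 'p) set \<Rightarrow> ('p ext \<Rightarrow> complex) \<Rightarrow> ('p hedge \<Rightarrow> real \<Rightarrow> complex) \<Rightarrow> bool" where
  "bounded_strongly_planar P R pos crv \<longleftrightarrow>
     inj_on pos (Vhat P) \<and>
     (\<forall>e\<in>EH P R. arc (crv e) \<and> pathstart (crv e) = pos (esrc e) \<and> pathfinish (crv e) = pos (etgt e)) \<and>
     (\<forall>e\<in>EH P R - {LeftE, RightE}. strict_mono_on {0..1} (\<lambda>t. Im (crv e t))) \<and>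
     (\<forall>e1\<in>EH P R. \<forall>e2\<in>EH P R. e1 \<noteq> e2 \<longrightarrow>
        path_image (crv e1) \<inter> path_image (crv e2) \<subseteq> pos ` ({esrc e1, etgt e1} \<inter> {esrc e2, etgt e2})) \<and>
     (\<forall>e\<in>EH P R. \<forall>v\<in>Vhat P. pos v \<in> path_image (crv e) \<longrightarrow> v \<in> {esrc e, etgt e}) \<and>
     (\<forall>e\<in>EH P R - {LeftE, RightE}. \<forall>z\<in>path_image (crv e) - {pos Bot, pos Top}.
        winding_number (crv LeftE +++ reversepath (crv RightE)) z = -1) \<and>
     (\<forall>v\<in>Elem ` P. winding_number (crv LeftE +++ reversepath (crv RightE)) (pos v) = -1)"

definition drawing :: "'p set \<Rightarrow> ('p \<times> 'p) set \<Rightarrow> ('p ext \<Rightarrow> complex) \<Rightarrow> ('p hedge \<Rightarrow> real \<Rightarrow> complex) \<Rightarrow> complex set" where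
  "drawing P R pos crv = (\<Union>e\<in>EH P R. path_image (crv e)) \<union> pos ` Vhat P"

definition bfaces :: "'p set \<Rightarrow> ('p \<times> 'p) set \<Rightarrow> ('p ext \<Rightarrow> complex) \<Rightarrow> ('p hedge \<Rightarrow> real \<Rightarrow> complex) \<Rightarrow> complex set set" where
  "bfaces P R pos crv = {C \<in> components (- drawing P R pos crv). bounded C}"

definition FL :: "'p set \<Rightarrow> ('p \<times> 'p) set \<Rightarrow> ('p ext \<Rightarrow> complex) \<Rightarrow> ('p hedge \<Rightarrow> real \<Rightarrow> complex) \<Rightarrow> complex set" where
  "FL P R pos crv = (THE F. F \<in> bfaces P R pos crv \<and> crv LeftE (1/2) \<in> frontier F)"

definition FR :: "'p set \<Rightarrow> ('p \<times> 'p) set \<Rightarrow> ('p ext \<Rightarrow> complex) \<Rightarrow> ('p hedge \<Rightarrow> real \<Rightarrow> complex) \<Rightarrow> complex set" where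
  "FR P R pos crv = (THE F. F \<in> bfaces P R pos crv \<and> crv RightE (1/2) \<in> frontier F)"

text \<open>Edge e lies on the left boundary of face F: F lies immediately to the right of e.\<close>
fun onL :: "'p set \<Rightarrow> ('p \<times> 'p) set \<Rightarrow> ('p ext \<Rightarrow> complex) \<Rightarrow> ('p hedge \<Rightarrow> real \<Rightarrow> complex) \<Rightarrow> complex set \<Rightarrow> 'p hedge \<Rightarrow> bool" where
  "onL P R pos crv F LeftE = (F = FL P R pos crv)"
| "onL P R pos crv F RightE = False"
| "onL P R pos crv F (HE p q) = (\<exists>t\<in>{0<..<1}. \<exists>\<epsilon>>0. \<forall>\<delta>. 0 < \<delta> \<and> \<delta> < \<epsilon> \<longrightarrow>
        crv (HE p q) t + complex_of_real \<delta> \<in> F)"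

text \<open>Edge e lies on the right boundary of face F: F lies immediately to the left of e.\<close>
fun onR :: "'p set \<Rightarrow> ('p \<times> 'p) set \<Rightarrow> ('p ext \<Rightarrow> complex) \<Rightarrow> ('p hedge \<Rightarrow> real \<Rightarrow> complex) \<Rightarrow> complex set \<Rightarrow> 'p hedge \<Rightarrow> bool" where
  "onR P R pos crv F RightE = (F = FR P R pos crv)"
| "onR P R pos crv F LeftE = False"
| "onR P R pos crv F (HE p q) = (\<exists>t\<in>{0<..<1}. \<exists>\<epsilon>>0. \<forall>\<delta>. 0 < \<delta> \<and> \<delta> < \<epsilon> \<longrightarrow>
        crv (HE p q) t - complex_of_real \<delta> \<in> F)"

definition LBv :: "'p set \<Rightarrow> ('p \<times> 'p) set \<Rightarrow> ('p ext \<Rightarrow> complex) \<Rightarrow> ('p hedge \<Rightarrow> real \<Rightarrow> complex) \<Rightarrow> complex set \<Rightarrow> 'p ext set" where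
  "LBv P R pos crv F = {v. \<exists>e\<in>EH P R. onL P R pos crv F e \<and> (v = esrc e \<or> v = etgt e)}"

definition BV :: "'p set \<Rightarrow> ('p \<times> 'p) set \<Rightarrow> ('p ext \<Rightarrow> complex) \<Rightarrow> complex set \<Rightarrow> 'p ext set" where
  "BV P R pos F = {v \<in> Vhat P. pos v \<in> frontier F}"

definition minF :: "'p set \<Rightarrow> ('p \<times> 'p) set \<Rightarrow> ('p ext \<Rightarrow> complex) \<Rightarrow> complex set \<Rightarrow> 'p ext" where
  "minF P R pos F = (THE v. v \<in> BV P R pos F \<and> (\<forall>w\<in>BV P R pos F. leh R v w))"

definition maxF :: "'p set \<Rightarrow> ('p \<times> 'p) set \<Rightarrow> ('p ext \<Rightarrow> complex) \<Rightarrow> complex set \<Rightarrow> 'p ext" where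
  "maxF P R pos F = (THE v. v \<in> BV P R pos F \<and> (\<forall>w\<in>BV P R pos F. leh R w v))"

definition hasMarked :: "'p set \<Rightarrow> ('p \<times> 'p) set \<Rightarrow> 'p set \<Rightarrow> ('p ext \<Rightarrow> complex) \<Rightarrow> ('p hedge \<Rightarrow> real \<Rightarrow> complex) \<Rightarrow> complex set \<Rightarrow> bool" where
  "hasMarked P R A pos crv F \<longleftrightarrow> LBv P R pos crv F \<inter> Marked A \<noteq> {}"

text \<open>The marked elements r_1 > r_2 > ... > r_g on the left boundary of F (r_m = rlist ! (m-1)).\<close>
definition rlist :: "'p set \<Rightarrow> ('p \<times> 'p) set \<Rightarrow> 'p set \<Rightarrow> ('p ext \<Rightarrow> complex) \<Rightarrow> ('p hedge \<Rightarrow> real \<Rightarrow> complex) \<Rightarrow> complex set \<Rightarrow> 'p ext list" where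
  "rlist P R A pos crv F = (THE xs. set xs = LBv P R pos crv F \<inter> Marked A \<and> sorted_wrt (\<lambda>a b. lth R b a) xs)"

definition bsp_embedding_of :: "'p set \<Rightarrow> ('p \<times> 'p) set \<Rightarrow> 'p set \<Rightarrow> ('p ext \<Rightarrow> complex) \<Rightarrow> ('p hedge \<Rightarrow> real \<Rightarrow> complex) \<Rightarrow> bool" where
  "bsp_embedding_of P R A pos crv \<longleftrightarrow>
     bounded_strongly_planar P R pos crv \<and>
     (\<forall>F\<in>bfaces P R pos crv. hasMarked P R A pos crv F \<longrightarrow>
        minF P R pos F \<in> Marked A \<and> maxF P R pos F \<in> Marked A)"

definition Rface :: "'p set \<Rightarrow> ('p \<times> 'p) set \<Rightarrow> ('p ext \<Rightarrow> complex) \<Rightarrow> ('p hedge \<Rightarrow> real \<Rightarrow> complex) \<Rightarrow> 'p hedge \<Rightarrow> complex set" where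
  "Rface P R pos crv e = (THE F. F \<in> bfaces P R pos crv \<and> onL P R pos crv F e)"

definition Lface :: "'p set \<Rightarrow> ('p \<times> 'p) set \<Rightarrow> ('p ext \<Rightarrow> complex) \<Rightarrow> ('p hedge \<Rightarrow> real \<Rightarrow> complex) \<Rightarrow> 'p hedge \<Rightarrow> complex set" where
  "Lface P R pos crv e = (THE F. F \<in> bfaces P R pos crv \<and> onR P R pos crv F e)"

definition GV :: "'p set \<Rightarrow> ('p \<times> 'p) set \<Rightarrow> 'p set \<Rightarrow> ('p ext \<Rightarrow> complex) \<Rightarrow> ('p hedge \<Rightarrow> real \<Rightarrow> complex) \<Rightarrow> complex set fvert set" where
  "GV P R A pos crv =
     {VF F | F. F \<in> bfaces P R pos crv \<and> F \<noteq> FR P R pos crv} \<union>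
     {SF F m | F m. F \<in> bfaces P R pos crv \<and> F \<noteq> FL P R pos crv \<and> hasMarked P R A pos crv F \<and>
                    1 \<le> m \<and> m < length (rlist P R A pos crv F)}"

fun netflow :: "'p set \<Rightarrow> ('p \<times> 'p) set \<Rightarrow> 'p set \<Rightarrow> ('p \<Rightarrow> real) \<Rightarrow> ('p ext \<Rightarrow> complex) \<Rightarrow> ('p hedge \<Rightarrow> real \<Rightarrow> complex) \<Rightarrow> complex set fvert \<Rightarrow> real" where
  "netflow P R A lam pos crv (VF F) =
     (if hasMarked P R A pos crv F then - (lamh A lam (maxF P R pos F) - lamh A lam (minF P R pos F)) else 0)"
| "netflow P R A lam pos crv (SF F m) =
     lamh A lam (rlist P R A pos crv F ! (m - 1)) - lamh A lam (rlist P R A pos crv F ! m)"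

definition headG :: "'p set \<Rightarrow> ('p \<times> 'p) set \<Rightarrow> ('p ext \<Rightarrow> complex) \<Rightarrow> ('p hedge \<Rightarrow> real \<Rightarrow> complex) \<Rightarrow> 'p ext \<times> 'p ext \<Rightarrow> complex set fvert" where
  "headG P R pos crv e = VF (Lface P R pos crv (HE (fst e) (snd e)))"

definition tailG :: "'p set \<Rightarrow> ('p \<times> 'p) set \<Rightarrow> 'p set \<Rightarrow> ('p ext \<Rightarrow> complex) \<Rightarrow> ('p hedge \<Rightarrow> real \<Rightarrow> complex) \<Rightarrow> 'p ext \<times> 'p ext \<Rightarrow> complex set fvert" where
  "tailG P R A pos crv e =
     (let F = Rface P R pos crv (HE (fst e) (snd e)); rs = rlist P R A pos crv F in
      if hasMarked P R A pos crv F
      then SF F (THE m. 1 \<le> m \<and> m < length rs \<and> leh R (rs ! m) (fst e) \<and> leh R (snd e) (rs ! (m - 1)))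
      else VF F)"

text \<open>Flow polytope of G, in R^E(G) where E(G) is identified with the Hasse edges of P-hat
  (functions vanishing outside them).\<close>
definition flow_polytope :: "'p set \<Rightarrow> ('p \<times> 'p) set \<Rightarrow> 'p set \<Rightarrow> ('p \<Rightarrow> real) \<Rightarrow> ('p ext \<Rightarrow> complex) \<Rightarrow> ('p hedge \<Rightarrow> real \<Rightarrow> complex) \<Rightarrow> ('p ext \<times> 'p ext \<Rightarrow> real) set" where
  "flow_polytope P R A lam pos crv =
     {f. (\<forall>e. e \<notin> Ecov P R \<longrightarrow> f e = 0) \<and> (\<forall>e\<in>Ecov P R. 0 \<le> f e) \<and>
         (\<forall>v\<in>GV P R A pos crv.
            (\<Sum>e\<in>{e \<in> Ecov P R. tailG P R A pos crv e = v}. f e)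
          - (\<Sum>e\<in>{e \<in> Ecov P R. headG P R pos crv e = v}. f e) = netflow P R A lam pos crv v)}"

fun xh :: "'p set \<Rightarrow> ('p \<Rightarrow> real) \<Rightarrow> ('p \<Rightarrow> real) \<Rightarrow> 'p ext \<Rightarrow> real" where
  "xh A lam x Bot = lamh A lam Bot"
| "xh A lam x (Elem p) = x p"
| "xh A lam x Top = lamh A lam Top"

definition Gamma_map :: "'p set \<Rightarrow> ('p \<times> 'p) set \<Rightarrow> 'p set \<Rightarrow> ('p \<Rightarrow> real) \<Rightarrow> ('p \<Rightarrow> real) \<Rightarrow> ('p ext \<times> 'p ext \<Rightarrow> real)" where
  "Gamma_map P R A lam x = (\<lambda>e. if e \<in> Ecov P R then xh A lam x (snd e) - xh A lam x (fst e) else 0)"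

definition fun_affine_hull :: "('i \<Rightarrow> real) set \<Rightarrow> ('i \<Rightarrow> real) set" where
  "fun_affine_hull S = {y. \<exists>T u. finite T \<and> T \<subseteq> S \<and> T \<noteq> {} \<and> sum u T = 1 \<and>
                              y = (\<lambda>i. \<Sum>t\<in>T. u t * t i)}"

definition int_points :: "('i \<Rightarrow> real) set" where
  "int_points = {x. \<forall>i. x i \<in> \<int>}"

definition integral_equivalence :: "(('i \<Rightarrow> real) \<Rightarrow> ('j \<Rightarrow> real)) \<Rightarrow> ('i \<Rightarrow> real) set \<Rightarrow> ('j \<Rightarrow> real) set \<Rightarrow> bool" where
  "integral_equivalence \<phi> Pp Qq \<longleftrightarrow>
     bij_betw \<phi> Pp Qq \<and>
     bij_betw \<phi> (int_points \<inter> fun_affine_hull Pp) (int_points \<inter> fun_affine_hull Qq)"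

end

(*
  Write y for the height. A maximal chain of the extended poset is drawn as the graph of a continuous
  function of the height, and pointwise maxima and minima of such functions are again chains. Closing a
  chain up with the left or the right outer edge gives a simple closed curve, whose winding number jumps
  by one across the chain; since the two winding numbers add up to -1, this decides which side of the
  chain is the left one. The leftmost and the rightmost chain therefore bound the two outer faces, and
  every other bounded face is the region between the greatest chain to the left of one of its points and
  the least chain to the right of it, cut off at the vertices where these two chains meet. So the left
  and the right boundary of a face are saturated chains from its minimum to its maximum, and differences
  along covering relations telescope: this is flow conservation.

  Conversely, summing conservation over the faces to the left of a maximal chain shows that a flow has the
  same total along every maximal chain. Hence it is the difference of a potential, which takes the
  prescribed values at the marked elements by induction on their height.
*)
theory Submission
  imports Defs "HOL-Complex_Analysis.Riemann_Mapping"
begin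

section \<open>Heights and edges\<close>

text \<open>The two outer edges are arbitrary arcs: they need not be graphs over the height and may
  leave the strip between \<open>Bot\<close> and \<open>Top\<close>. Hence left and right in the
  large are known only through the winding number hypothesis, while Hasse edges are graphs over the
  height. Plane topology is therefore confined to comparing chains with the outer edges. There
  principal logarithms give the winding number of a chain about a point on its left, or on its
  right, by a formula in the two endpoints alone, the same for every chain. What happens between two
  chains is then real analysis in one variable. The converse hinges on the marking condition. If a
  marked \<open>v\<close> other than \<open>Bot\<close> is the upper end of an edge, the face to the
  right of that edge has \<open>v\<close> on its left boundary, so the minimum of this face is a
  lower marked element. Conservation at the split vertices of the face fixes the difference of the
  two values.\<close>

locale planar_poset =
  fixes P :: "'p set" and R :: "('p \<times> 'p) set"
    and pos :: "'p ext \<Rightarrow> complex" and crv :: "'p hedge \<Rightarrow> real \<Rightarrow> complex"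
  assumes finP: "finite P" and RP: "R \<subseteq> P \<times> P" and po: "partial_order_on P R" and neP: "P \<noteq> {}"
    and planar: "bounded_strongly_planar P R pos crv"
begin

abbreviation "V \<equiv> Vhat P"
abbreviation "E \<equiv> Ecov P R"
abbreviation "Y v \<equiv> Im (pos v)"
abbreviation "y0 \<equiv> Y Bot"
abbreviation "y1 \<equiv> Y Top"

lemma Bot_V [simp]: "Bot \<in> V" and Top_V [simp]: "Top \<in> V"
  and Elem_V [simp]: "Elem p \<in> V \<longleftrightarrow> p \<in> P"
  by (auto simp: Vhat_def)

lemma finite_V [simp]: "finite V"
  using finP by (simp add: Vhat_def)

lemma E_iff: "(p, q) \<in> E \<longleftrightarrow> covers P R p q"
  by (simp add: Ecov_def)

lemma E_V: assumes "(p, q) \<in> E" shows "p \<in> V" "q \<in> V"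
  using assms by (auto simp: E_iff covers_def)

lemma finite_E [simp]: "finite E"
  by (rule finite_subset[of _ "V \<times> V"]) (auto dest: E_V)

lemma leh_refl: "v \<in> V \<Longrightarrow> leh R v v"
  using po by (cases v) (auto simp: partial_order_on_def preorder_on_def refl_on_def)

lemma leh_antisym: "leh R v w \<Longrightarrow> leh R w v \<Longrightarrow> v = w"
  using po by (cases v; cases w) (auto simp: partial_order_on_def antisym_def)

lemma leh_trans: assumes "leh R u v" "leh R v w" shows "leh R u w"
proof -
  have "trans R" using po by (simp add: partial_order_on_def preorder_on_def)
  then have tr: "(a, c) \<in> R" if "(a, b) \<in> R" "(b, c) \<in> R" for a b c
    using that by (meson transD)
  show ?thesis using assms by (cases u; cases v; cases w; simp) (rule tr)
qed

lemma leh_Top [simp]: "leh R v Top"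
  by (cases v) auto

lemma lth_trans: "lth R u v \<Longrightarrow> lth R v w \<Longrightarrow> lth R u w"
  unfolding lth_def by (metis leh_antisym leh_trans)

lemma lth_irrefl [simp]: "\<not> lth R u u"
  by (simp add: lth_def)

text \<open>Induction on the number of elements strictly between \<open>p\<close> and
  \<open>q\<close>: an intermediate \<open>r\<close> splits the interval in two, and
  \<open>r\<close> lies in the interior of neither half.\<close>

lemma lth_E_trancl:
  assumes "p \<in> V" "q \<in> V" "lth R p q" shows "(p, q) \<in> E\<^sup>+"
  using assms
proof (induction "card {r \<in> V. lth R p r \<and> lth R r q}" arbitrary: p q rule: less_induct)
  case less
  show ?case
  proof (cases "(p, q) \<in> E")
    case False
    then obtain r where r: "r \<in> V" "lth R p r" "lth R r q"
      using less.prems by (auto simp: E_iff covers_def)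
    have 1: "card {s \<in> V. lth R p s \<and> lth R s r} < card {s \<in> V. lth R p s \<and> lth R s q}"
      proof (rule psubset_card_mono)
      show "{s \<in> V. lth R p s \<and> lth R s r} \<subset> {s \<in> V. lth R p s \<and> lth R s q}"
        using r lth_trans lth_irrefl by blast
    qed simp
    have 2: "card {s \<in> V. lth R r s \<and> lth R s q} < card {s \<in> V. lth R p s \<and> lth R s q}"
      proof (rule psubset_card_mono)
      show "{s \<in> V. lth R r s \<and> lth R s q} \<subset> {s \<in> V. lth R p s \<and> lth R s q}"
        using r lth_trans lth_irrefl by blast
    qed simp
    show ?thesis
      using less.hyps[OF 1] less.hyps[OF 2] less.prems r by (meson trancl_trans)
  qed auto
qed

lemma leh_E_rtrancl:
  assumes "p \<in> V" "q \<in> V" "leh R p q" shows "(p, q) \<in> E\<^sup>*"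
  using assms lth_E_trancl by (cases "p = q") (auto simp: lth_def trancl_into_rtrancl)

lemma Bot_E_rtrancl: "v \<in> V \<Longrightarrow> (Bot, v) \<in> E\<^sup>*" and E_rtrancl_Top: "v \<in> V \<Longrightarrow> (v, Top) \<in> E\<^sup>*"
  by (auto intro: leh_E_rtrancl)

lemma E_lth: "(p, q) \<in> E \<Longrightarrow> lth R p q"
  by (simp add: E_iff covers_def)

section \<open>The Hasse diagram as a subset of the plane\<close>

definition img :: "'p ext \<times> 'p ext \<Rightarrow> complex set" where
  "img e = path_image (crv (HE (fst e) (snd e)))"

definition hasse :: "complex set" where "hasse = (\<Union>e\<in>E. img e)"

lemma HE_EH [simp]: "HE p q \<in> EH P R \<longleftrightarrow> (p, q) \<in> E"
  and LeftE_EH [simp]: "LeftE \<in> EH P R" and RightE_EH [simp]: "RightE \<in> EH P R"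
  by (auto simp: EH_def E_iff)

lemma pos_inj: "v \<in> V \<Longrightarrow> w \<in> V \<Longrightarrow> pos v = pos w \<Longrightarrow> v = w"
  using planar by (auto simp: bounded_strongly_planar_def inj_on_def)

lemma arc_HE: assumes "(p, q) \<in> E" shows "arc (crv (HE p q))"
  and "crv (HE p q) 0 = pos p" "crv (HE p q) 1 = pos q"
  using planar assms HE_EH[of p q]
  by (auto simp: bounded_strongly_planar_def pathstart_def pathfinish_def simp del: HE_EH)

lemma Im_HE_mono:
  assumes "(p, q) \<in> E" shows "strict_mono_on {0..1} (\<lambda>t. Im (crv (HE p q) t))"
proof -
  have "\<forall>e\<in>EH P R - {LeftE, RightE}. strict_mono_on {0..1} (\<lambda>t. Im (crv e t))"
    using planar unfolding bounded_strongly_planar_def by blast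
  then show ?thesis using assms by force
qed

lemma edges_meet:
  assumes "e1 \<in> EH P R" "e2 \<in> EH P R" "e1 \<noteq> e2" "z \<in> path_image (crv e1)" "z \<in> path_image (crv e2)"
  shows "z \<in> pos ` ({esrc e1, etgt e1} \<inter> {esrc e2, etgt e2})"
proof -
  have "\<forall>e1\<in>EH P R. \<forall>e2\<in>EH P R. e1 \<noteq> e2 \<longrightarrow>
        path_image (crv e1) \<inter> path_image (crv e2) \<subseteq> pos ` ({esrc e1, etgt e1} \<inter> {esrc e2, etgt e2})"
    using planar unfolding bounded_strongly_planar_def by blast
  then show ?thesis using assms by blast
qed

lemma vertex_on_edge:
  assumes "(p, q) \<in> E" "v \<in> V" "pos v \<in> img (p, q)" shows "v = p \<or> v = q"
proof -
  have "\<forall>e\<in>EH P R. \<forall>v\<in>Vhat P. pos v \<in> path_image (crv e) \<longrightarrow> v \<in> {esrc e, etgt e}"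
    using planar unfolding bounded_strongly_planar_def by blast
  then show ?thesis using assms by (fastforce simp: img_def)
qed

lemma Y_E: assumes "(p, q) \<in> E" shows "Y p < Y q"
  using strict_mono_onD[OF Im_HE_mono[OF assms], of 0 1] arc_HE[OF assms] by auto

lemma Y_trancl: "(p, q) \<in> E\<^sup>+ \<Longrightarrow> Y p < Y q"
  by (induction rule: trancl_induct) (auto dest: Y_E)

lemma Y_lth: "p \<in> V \<Longrightarrow> q \<in> V \<Longrightarrow> lth R p q \<Longrightarrow> Y p < Y q"
  by (simp add: Y_trancl lth_E_trancl)

lemma Y_leh: "p \<in> V \<Longrightarrow> q \<in> V \<Longrightarrow> leh R p q \<Longrightarrow> Y p \<le> Y q"
  using Y_lth by (fastforce simp: lth_def)

lemma Y_bounds: assumes "v \<in> V" shows "y0 \<le> Y v" "Y v \<le> y1"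
  by (auto intro: Y_leh assms)

lemma Y_eq_y0: "v \<in> V \<Longrightarrow> Y v = y0 \<Longrightarrow> v = Bot"
  and Y_eq_y1: "v \<in> V \<Longrightarrow> Y v = y1 \<Longrightarrow> v = Top"
  using Y_lth[of Bot v] Y_lth[of v Top] by (auto simp: lth_def)

lemma y01: "y0 < y1"
  by (rule Y_lth) (auto simp: lth_def)

text \<open>The Hasse edge \<open>e\<close> is the graph of a function \<open>edge_x e\<close> of the height.\<close>

definition edge_x :: "'p ext \<times> 'p ext \<Rightarrow> real \<Rightarrow> real" where
  "edge_x e y = Re (crv (HE (fst e) (snd e)) (the_inv_into {0..1} (\<lambda>t. Im (crv (HE (fst e) (snd e)) t)) y))"

context
  fixes p q assumes pq: "(p, q) \<in> E"
begin

private abbreviation "ht \<equiv> \<lambda>t. Im (crv (HE p q) t)"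

private lemma inj_ht: "inj_on ht {0..1}"
  using Im_HE_mono[OF pq] by (rule strict_mono_on_imp_inj_on)

private lemma cont_crv: "continuous_on {0..1} (crv (HE p q))"
  using arc_HE(1)[OF pq] by (simp add: arc_def path_def)

private lemma ht_image: "ht ` {0..1} = {Y p..Y q}"
proof
  show "ht ` {0..1} \<subseteq> {Y p..Y q}"
  proof clarify
    fix t :: real assume t: "t \<in> {0..1}"
    show "ht t \<in> {Y p..Y q}"
      using strict_mono_on_leD[OF Im_HE_mono[OF pq], of 0 t] strict_mono_on_leD[OF Im_HE_mono[OF pq], of t 1] t
        arc_HE[OF pq] by auto
  qed
  show "{Y p..Y q} \<subseteq> ht ` {0..1}"
  proof
    fix y assume "y \<in> {Y p..Y q}"
    then have "\<exists>t\<ge>0. t \<le> 1 \<and> ht t = y"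
      using arc_HE[OF pq] by (intro IVT') (auto intro!: continuous_intros cont_crv)
    then show "y \<in> ht ` {0..1}" by force
  qed
qed

lemma edge_x_crv: assumes "t \<in> {0..1}" shows "edge_x (p, q) (Im (crv (HE p q) t)) = Re (crv (HE p q) t)"
  using the_inv_into_f_f[OF inj_ht assms] by (simp add: edge_x_def)

lemma Im_crv_bounds: "t \<in> {0..1} \<Longrightarrow> Im (crv (HE p q) t) \<in> {Y p..Y q}"
  using ht_image by auto

lemma Im_crv_strict: assumes "t \<in> {0<..<1}" shows "Im (crv (HE p q) t) \<in> {Y p<..<Y q}"
  using strict_mono_onD[OF Im_HE_mono[OF pq], of 0 t] strict_mono_onD[OF Im_HE_mono[OF pq], of t 1] assms
        arc_HE[OF pq] by auto

lemma crv_height: assumes "y \<in> {Y p..Y q}" obtains t where "t \<in> {0..1}" "crv (HE p q) t = Complex (edge_x (p, q) y) y"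
proof -
  obtain t where "t \<in> {0..1}" "ht t = y" using assms ht_image by force
  then show ?thesis using that edge_x_crv by (metis complex_surj)
qed

lemma img_eq: "img (p, q) = {Complex (edge_x (p, q) y) y | y. y \<in> {Y p..Y q}}"
proof -
  have "z \<in> {Complex (edge_x (p, q) y) y | y. y \<in> {Y p..Y q}}" if z: "z \<in> img (p, q)" for z
  proof -
    obtain t where t: "t \<in> {0..1}" "z = crv (HE p q) t" using z by (auto simp: img_def path_image_def)
    then have "z = Complex (edge_x (p, q) (Im z)) (Im z)" using edge_x_crv by simp
    then show ?thesis using Im_crv_bounds t by blast
  qed
  moreover have "z \<in> img (p, q)" if z: "z = Complex (edge_x (p, q) y) y" "y \<in> {Y p..Y q}" for z y
    using crv_height[OF z(2)] z(1) by (metis fst_conv image_eqI img_def path_image_def snd_conv)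
  ultimately show ?thesis by blast
qed

lemma edge_x_ends: "edge_x (p, q) (Y p) = Re (pos p)" "edge_x (p, q) (Y q) = Re (pos q)"
  using edge_x_crv[of 0] edge_x_crv[of 1] arc_HE[OF pq] by auto

text \<open>The height is a continuous injection on the compact parameter interval, so its inverse
  is continuous.\<close>

lemma continuous_on_edge_x: "continuous_on {Y p..Y q} (edge_x (p, q))"
proof -
  have "continuous_on (ht ` {0..1}) (the_inv_into {0..1} ht)"
    by (rule continuous_on_inv) (auto intro!: continuous_intros cont_crv the_inv_into_f_f[OF inj_ht])
  moreover have "the_inv_into {0..1} ht ` (ht ` {0..1}) \<subseteq> {0..1}"
    using the_inv_into_f_f[OF inj_ht] by force
  ultimately have "continuous_on (ht ` {0..1}) (\<lambda>y. crv (HE p q) (the_inv_into {0..1} ht y))"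
    using continuous_on_compose2[OF cont_crv] by blast
  then show ?thesis
    unfolding ht_image edge_x_def by (auto intro!: continuous_intros)
qed

lemma compact_img: "compact (img (p, q))"
  using arc_HE(1)[OF pq] by (simp add: img_def compact_path_image arc_imp_path)

text \<open>Distinct edges share only common endpoints, and the endpoints of \<open>(p, q)\<close>
  sit at the extreme heights \<open>Y p\<close> and \<open>Y q\<close>.\<close>

lemma edge_interior_unique:
  assumes "y \<in> {Y p<..<Y q}" "e \<in> E" "Complex (edge_x (p, q) y) y \<in> img e" shows "e = (p, q)"
proof (rule ccontr)
  assume ne: "e \<noteq> (p, q)"
  obtain a b where e: "e = (a, b)" by (cases e)
  have "Complex (edge_x (p, q) y) y \<in> pos ` ({esrc (HE p q), etgt (HE p q)} \<inter> {esrc (HE a b), etgt (HE a b)})"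
  proof (rule edges_meet)
    show "Complex (edge_x (p, q) y) y \<in> path_image (crv (HE p q))"
      using assms(1) img_eq by (force simp: img_def)
  qed (use assms ne e pq in \<open>auto simp: img_def\<close>)
  then obtain v where v: "v \<in> {p, q}" "Complex (edge_x (p, q) y) y = pos v" by auto
  have "y = Y v" using v(2) by (metis complex.sel(2))
  then show False using assms(1) v(1) by auto
qed

end

lemma img_hasse: "e \<in> E \<Longrightarrow> img e \<subseteq> hasse"
  by (auto simp: hasse_def)

lemma compact_hasse: "compact hasse"
  unfolding hasse_def by (rule compact_UN) (auto simp: compact_img)

lemma pos_E_img: assumes "(p, q) \<in> E" shows "pos p \<in> img (p, q) \<and> pos q \<in> img (p, q)"
proof -
  have "crv (HE p q) 0 \<in> img (p, q)" "crv (HE p q) 1 \<in> img (p, q)"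
    by (simp_all add: img_def path_image_def)
  then show ?thesis using arc_HE[OF assms] by simp
qed

lemma pos_hasse: assumes "v \<in> V" shows "pos v \<in> hasse"
proof (cases "v = Top")
  case True
  have "(Bot, Top) \<in> E\<^sup>+" by (rule lth_E_trancl) (auto simp: lth_def)
  then obtain w where "(w, Top) \<in> E" by (meson tranclD2)
  then show ?thesis using pos_E_img img_hasse True by blast
next
  case False
  then have "(v, Top) \<in> E\<^sup>+" using assms by (intro lth_E_trancl) (auto simp: lth_def)
  then obtain w where "(v, w) \<in> E" by (meson tranclD)
  then show ?thesis using pos_E_img img_hasse by blast
qed

lemma hasse_cases:
  assumes "z \<in> hasse"
  obtains v where "v \<in> V" "z = pos v"
  | p q where "(p, q) \<in> E" "Im z \<in> {Y p<..<Y q}" "z = Complex (edge_x (p, q) (Im z)) (Im z)"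
proof -
  obtain p q where pq: "(p, q) \<in> E" "z \<in> img (p, q)" using assms by (auto simp: hasse_def)
  then obtain y where y: "z = Complex (edge_x (p, q) y) y" "y \<in> {Y p..Y q}" using img_eq[OF pq(1)] by blast
  consider "y = Y p" | "y = Y q" | "y \<in> {Y p<..<Y q}" using y(2) by force
  then show ?thesis
  proof cases
    case 1
    then show ?thesis using that(1)[of p] y edge_x_ends[OF pq(1)] E_V[OF pq(1)] by (simp add: complex_eq_iff)
  next
    case 2
    then show ?thesis using that(1)[of q] y edge_x_ends[OF pq(1)] E_V[OF pq(1)] by (simp add: complex_eq_iff)
  next
    case 3
    then show ?thesis using that(2)[of p q] y pq by simp
  qed
qed

lemma hasse_height: assumes "z \<in> hasse" shows "y0 \<le> Im z \<and> Im z \<le> y1"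
  using assms
proof (cases rule: hasse_cases)
  case (1 v)
  then show ?thesis using Y_bounds by simp
next
  case (2 p q)
  then show ?thesis using Y_bounds(1)[OF E_V(1)[OF 2(1)]] Y_bounds(2)[OF E_V(2)[OF 2(1)]] by auto
qed

lemma hasse_y0: assumes "z \<in> hasse" "Im z = y0" shows "z = pos Bot"
  using assms(1)
proof (cases rule: hasse_cases)
  case (2 p q)
  then show ?thesis using Y_bounds[OF E_V(1)[OF 2(1)]] assms(2) by auto
qed (use Y_eq_y0 assms in auto)

lemma hasse_y1: assumes "z \<in> hasse" "Im z = y1" shows "z = pos Top"
  using assms(1)
proof (cases rule: hasse_cases)
  case (2 p q)
  then show ?thesis using Y_bounds[OF E_V(2)[OF 2(1)]] assms(2) by auto
qed (use Y_eq_y1 assms in auto)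

end

section \<open>Maximal chains as functions of the height\<close>

context planar_poset
begin

text \<open>A stretch of a chain is a continuous selection of one point of the Hasse diagram at each
  height. Vertices and edges are deliberately absent: glueing, maxima and minima become immediate,
  and that such a selection follows whole edges is recovered in
  \<open>chain_follows_edge\<close>.\<close>

definition seg :: "real \<Rightarrow> real \<Rightarrow> (real \<Rightarrow> real) \<Rightarrow> bool" where
  "seg a b g \<longleftrightarrow> continuous_on {a..b} g \<and> (\<forall>y\<in>{a..b}. Complex (g y) y \<in> hasse)"

text \<open>A maximal chain from \<open>Bot\<close> to \<open>Top\<close> is encoded by the horizontal coordinate of its drawing as a
  function of the height, normalised to \<open>0\<close> outside the strip, so that equality of chains is equality of functions.\<close>

definition chains :: "(real \<Rightarrow> real) set" where
  "chains = {g. seg y0 y1 g \<and> (\<forall>y. y \<notin> {y0..y1} \<longrightarrow> g y = 0)}"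

definition edges :: "(real \<Rightarrow> real) \<Rightarrow> ('p ext \<times> 'p ext) set" where
  "edges g = {e \<in> E. \<forall>y\<in>{Y (fst e)..Y (snd e)}. g y = edge_x e y}"

definition verts :: "(real \<Rightarrow> real) \<Rightarrow> 'p ext set" where
  "verts g = {v \<in> V. g (Y v) = Re (pos v)}"

definition between :: "(real \<Rightarrow> real) \<Rightarrow> 'p ext \<Rightarrow> 'p ext \<Rightarrow> ('p ext \<times> 'p ext) set" where
  "between g v w = {e \<in> edges g. Y v \<le> Y (fst e) \<and> Y (snd e) \<le> Y w}"

lemma seg_cong:
  assumes "seg a b f" "\<And>y. y \<in> {a..b} \<Longrightarrow> g y = f y" shows "seg a b g"
  using assms continuous_on_cong[of "{a..b}" "{a..b}" g f] unfolding seg_def by (simp del: atLeastAtMost_iff)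

lemma seg_glue:
  assumes "seg a b f" "seg b c g" "f b = g b" "a \<le> b" "b \<le> c"
  shows "seg a c (\<lambda>y. if y \<le> b then f y else g y)"
proof -
  have "continuous_on ({a..b} \<union> {b..c}) (\<lambda>y. if y \<le> b then f y else g y)"
    by (rule continuous_on_If) (use assms in \<open>auto simp: seg_def\<close>)
  moreover have "{a..b} \<union> {b..c} = {a..c}" using assms(4,5) by auto
  ultimately show ?thesis using assms by (auto simp: seg_def)
qed

lemma seg_edge: "(p, q) \<in> E \<Longrightarrow> seg (Y p) (Y q) (edge_x (p, q))"
  using img_hasse[of "(p, q)"] by (auto simp: seg_def continuous_on_edge_x img_eq)

lemma seg_up:
  assumes "v \<in> V" shows "\<exists>g. seg (Y v) y1 g \<and> g (Y v) = Re (pos v)"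
  using E_rtrancl_Top[OF assms]
proof (induction rule: converse_rtrancl_induct)
  case base
  \<comment> \<open>The interval consists of the single height \<open>y1\<close>, so a constant
    function serves.\<close>
  show ?case
    by (rule exI[of _ "\<lambda>_. Re (pos Top)"]) (use pos_hasse[of Top] in \<open>auto simp: seg_def\<close>)
next
  case (step p q)
  then obtain g where g: "seg (Y q) y1 g" "g (Y q) = Re (pos q)" by blast
  have "seg (Y p) y1 (\<lambda>y. if y \<le> Y q then edge_x (p, q) y else g y)"
    by (rule seg_glue[OF seg_edge[OF step(1)] g(1)])
      (use Y_E[OF step(1)] Y_bounds[OF E_V(2)[OF step(1)]] in \<open>simp_all add: g edge_x_ends step\<close>)
  then show ?case
    by (intro exI[of _ "\<lambda>y. if y \<le> Y q then edge_x (p, q) y else g y"]) (use Y_E[OF step(1)] edge_x_ends[OF step(1)] in auto)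
qed

lemma seg_down:
  assumes "v \<in> V" shows "\<exists>g. seg y0 (Y v) g \<and> g (Y v) = Re (pos v)"
  using Bot_E_rtrancl[OF assms]
proof (induction rule: rtrancl_induct)
  case base
  show ?case
    by (rule exI[of _ "\<lambda>_. Re (pos Bot)"]) (use pos_hasse[of Bot] in \<open>auto simp: seg_def\<close>)
next
  case (step p q)
  then obtain g where g: "seg y0 (Y p) g" "g (Y p) = Re (pos p)" by blast
  have "seg y0 (Y q) (\<lambda>y. if y \<le> Y p then g y else edge_x (p, q) y)"
    by (rule seg_glue[OF g(1) seg_edge[OF step(2)]])
      (use Y_E[OF step(2)] Y_bounds[OF E_V(1)[OF step(2)]] in \<open>simp_all add: g edge_x_ends step\<close>)
  then show ?case
    by (intro exI[of _ "\<lambda>y. if y \<le> Y p then g y else edge_x (p, q) y"]) (use Y_E[OF step(2)] edge_x_ends[OF step(2)] in auto)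
qed

lemma seg_chain:
  assumes "seg y0 y1 g" shows "(\<lambda>y. if y \<in> {y0..y1} then g y else 0) \<in> chains"
  using assms by (auto simp: chains_def intro: seg_cong)

text \<open>The edge is continued downward from \<open>p\<close> to \<open>Bot\<close> and upward
  from \<open>q\<close> to \<open>Top\<close>, and the three stretches are glued.\<close>

lemma chain_through_edge:
  assumes e: "e \<in> E" obtains g where "g \<in> chains" "e \<in> edges g"
proof -
  obtain p q where pq: "e = (p, q)" by (cases e)
  then have E: "(p, q) \<in> E" using e by simp
  obtain f where f: "seg y0 (Y p) f" "f (Y p) = Re (pos p)" using seg_down E_V[OF E] by blast
  obtain h where h: "seg (Y q) y1 h" "h (Y q) = Re (pos q)" using seg_up E_V[OF E] by blast
  let ?k = "\<lambda>y. if y \<le> Y q then edge_x (p, q) y else h y"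
  let ?g = "\<lambda>y. if y \<le> Y p then f y else ?k y"
  have 1: "seg (Y p) y1 ?k"
    by (rule seg_glue[OF seg_edge[OF E] h(1)])
      (use Y_E[OF E] Y_bounds[OF E_V(2)[OF E]] in \<open>simp_all add: h edge_x_ends E\<close>)
  have 2: "seg y0 y1 ?g"
    by (rule seg_glue[OF f(1) 1]) (use Y_E[OF E] Y_bounds[OF E_V(1)[OF E]] Y_bounds[OF E_V(2)[OF E]] in \<open>simp_all add: f edge_x_ends E\<close>)
  have "(if y \<in> {y0..y1} then ?g y else 0) = edge_x (p, q) y" if "y \<in> {Y p..Y q}" for y
    using that Y_E[OF E] edge_x_ends[OF E] Y_bounds[OF E_V(1)[OF E]] Y_bounds[OF E_V(2)[OF E]] f(2)
    by (cases "y = Y p") auto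
  then have "e \<in> edges (\<lambda>y. if y \<in> {y0..y1} then ?g y else 0)"
    unfolding edges_def using e pq by simp
  then show ?thesis using that seg_chain[OF 2] by blast
qed

lemma chain_point:
  assumes "z \<in> hasse" obtains g where "g \<in> chains" "g (Im z) = Re z"
proof -
  obtain p q where pq: "(p, q) \<in> E" "z \<in> img (p, q)" using assms by (auto simp: hasse_def)
  obtain g where "g \<in> chains" "(p, q) \<in> edges g" using chain_through_edge pq by blast
  then show ?thesis using that pq img_eq[OF pq(1)] by (auto simp: edges_def)
qed

lemma chain_hasse: "g \<in> chains \<Longrightarrow> y \<in> {y0..y1} \<Longrightarrow> Complex (g y) y \<in> hasse"
  and chain_cont: "g \<in> chains \<Longrightarrow> continuous_on {y0..y1} g"
  by (auto simp: chains_def seg_def)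

lemma chain_y0: "g \<in> chains \<Longrightarrow> g y0 = Re (pos Bot)"
  and chain_y1: "g \<in> chains \<Longrightarrow> g y1 = Re (pos Top)"
  using hasse_y0[of "Complex (g y0) y0"] hasse_y1[of "Complex (g y1) y1"] chain_hasse[of g y0] chain_hasse[of g y1] y01
  by (auto simp: complex_eq_iff)

lemma Bot_verts: "g \<in> chains \<Longrightarrow> Bot \<in> verts g" and Top_verts: "g \<in> chains \<Longrightarrow> Top \<in> verts g"
  by (auto simp: verts_def chain_y0 chain_y1)

lemma edges_E: "edges g \<subseteq> E"
  by (auto simp: edges_def)

lemma finite_edges [simp]: "finite (edges g)"
  by (rule finite_subset[OF edges_E]) simp

lemma edges_verts: "(p, q) \<in> edges g \<Longrightarrow> p \<in> verts g \<and> q \<in> verts g"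
  using Y_E[of p q] E_V[of p q] edge_x_ends[of p q] by (auto simp: edges_def verts_def)

text \<open>Connectedness: the heights strictly between \<open>Y p\<close> and \<open>Y q\<close>
  split into those where \<open>g\<close> lies on \<open>(p, q)\<close> and those where it lies on
  some other edge. Both sets are relatively closed, they are disjoint because edge interiors are
  disjoint from other edges, and the first contains \<open>y\<close>. Continuity adds the two end
  heights.\<close>

lemma chain_follows_edge:
  assumes g: "g \<in> chains" and e: "(p, q) \<in> E" and y: "Y p < y" "y < Y q" and eq: "g y = edge_x (p, q) y"
  shows "(p, q) \<in> edges g"
proof -
  let ?I = "{Y p<..<Y q}"
  have sub: "{Y p..Y q} \<subseteq> {y0..y1}"
    using Y_bounds[OF E_V(1)[OF e]] Y_bounds[OF E_V(2)[OF e]] by auto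
  have cont: "continuous_on {Y p..Y q} (\<lambda>y. Complex (g y) y)"
    using continuous_on_subset[OF chain_cont[OF g] sub]
    by (auto intro!: continuous_intros simp: complex_eq)
  then have contI: "continuous_on ?I (\<lambda>y. Complex (g y) y)"
    by (rule continuous_on_subset) auto
  define A B where "A = {y \<in> ?I. Complex (g y) y \<in> img (p, q)}"
    and "B = {y \<in> ?I. Complex (g y) y \<in> (\<Union>e\<in>E - {(p, q)}. img e)}"
  have comp: "compact (\<Union>e\<in>E - {(p, q)}. img e)"
    by (rule compact_UN) (auto simp: compact_img)
  have "A = ?I \<inter> (\<lambda>y. Complex (g y) y) -` img (p, q)" by (auto simp: A_def)
  then have clA: "closedin (top_of_set ?I) A"
    using continuous_closedin_preimage[OF contI compact_imp_closed[OF compact_img[OF e]]] by metis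
  have "B = ?I \<inter> (\<lambda>y. Complex (g y) y) -` (\<Union>e\<in>E - {(p, q)}. img e)" unfolding B_def by blast
  then have clB: "closedin (top_of_set ?I) B"
    using continuous_closedin_preimage[OF contI compact_imp_closed[OF comp]] by metis
  have "?I \<subseteq> A \<union> B"
  proof
    fix x assume x: "x \<in> ?I"
    then have "x \<in> {y0..y1}" using sub by auto
    then obtain e' where "e' \<in> E" "Complex (g x) x \<in> img e'" using chain_hasse[OF g, of x] unfolding hasse_def by blast
    then show "x \<in> A \<union> B" using x unfolding A_def B_def by blast
  qed
  moreover have "A \<inter> B = {}"
  proof -
    have False if xAB: "x \<in> A" "x \<in> B" for x
    proof -
      have x: "x \<in> ?I" "Complex (g x) x = Complex (edge_x (p, q) x) x"
        using that by (auto simp: A_def img_eq[OF e])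
      obtain e' where "e' \<in> E" "e' \<noteq> (p, q)" "Complex (g x) x \<in> img e'" using xAB by (auto simp: B_def)
      then show False using edge_interior_unique[OF e x(1)] x(2) by auto
    qed
    then show ?thesis by blast
  qed
  moreover have "y \<in> A" using y eq by (auto simp: A_def img_eq[OF e])
  ultimately have "B = {}"
    using connected_closedin[of ?I] clA clB by (metis connected_Ioo empty_iff)
  then have AI: "A = ?I" using \<open>?I \<subseteq> A \<union> B\<close> by (auto simp: A_def)
  have "\<forall>y\<in>?I. g y = edge_x (p, q) y"
    using AI by (force simp: A_def img_eq[OF e])
  moreover have "closure ?I = {Y p..Y q}" using Y_E[OF e] by simp
  moreover have "continuous_on {Y p..Y q} (\<lambda>y. g y - edge_x (p, q) y)"
    by (intro continuous_intros continuous_on_edge_x[OF e] continuous_on_subset[OF chain_cont[OF g] sub])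
  ultimately have "g y - edge_x (p, q) y = 0" if "y \<in> {Y p..Y q}" for y
    using continuous_constant_on_closure[of ?I "\<lambda>y. g y - edge_x (p, q) y" 0 y] that by auto
  then show ?thesis using e by (simp add: edges_def)
qed

lemma chain_cases:
  assumes g: "g \<in> chains" and y: "y \<in> {y0..y1}"
  obtains v where "v \<in> verts g" "y = Y v"
  | p q where "(p, q) \<in> edges g" "Y p < y" "y < Y q"
  using chain_hasse[OF assms]
proof (cases rule: hasse_cases)
  case (1 v)
  then have "y = Y v" "g y = Re (pos v)" by (auto simp: complex_eq_iff)
  then show ?thesis using that(1)[of v] 1 by (simp add: verts_def)
next
  case (2 p q)
  then show ?thesis using that(2) chain_follows_edge[OF g 2(1)] by auto
qed

lemma verts_Y_inj: "v \<in> verts g \<Longrightarrow> w \<in> verts g \<Longrightarrow> Y v = Y w \<Longrightarrow> v = w"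
  by (rule pos_inj) (auto simp: verts_def complex_eq_iff)

text \<open>A chain has one point per height, so a vertex at an intermediate height would lie in the
  interior of the edge.\<close>

lemma no_vert_inside_edge:
  assumes "(p, q) \<in> edges g" "v \<in> verts g" shows "Y v \<le> Y p \<or> Y q \<le> Y v"
proof (rule ccontr)
  assume n: "\<not> ?thesis"
  have E: "(p, q) \<in> E" using assms edges_E by blast
  have "Complex (g (Y v)) (Y v) \<in> img (p, q)" using assms(1) n unfolding img_eq[OF E] edges_def by fastforce
  then have "pos v \<in> img (p, q)" using assms(2) by (simp add: verts_def)
  then have "v = p \<or> v = q" using vertex_on_edge[OF E] assms(2) by (simp add: verts_def)
  then show False using n by auto
qed

text \<open>At a height strictly between two consecutive vertices the chain runs inside an edge,
  whose endpoints are vertices of the chain and can only be \<open>v\<close> and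
  \<open>w\<close>.\<close>

lemma between_step:
  assumes g: "g \<in> chains" and v: "v \<in> verts g" and w: "w \<in> verts g" and lt: "Y v < Y w"
    and no: "\<And>u. u \<in> verts g \<Longrightarrow> Y v < Y u \<Longrightarrow> Y u < Y w \<Longrightarrow> False"
  shows "between g v w = {(v, w)}"
proof -
  have vV: "v \<in> V" "w \<in> V" using v w by (auto simp: verts_def)
  define y where "y = (Y v + Y w) / 2"
  have y: "Y v < y" "y < Y w" using lt by (auto simp: y_def)
  have "y \<in> {y0..y1}" using Y_bounds[OF vV(1)] Y_bounds[OF vV(2)] y by auto
  with g obtain p q where pq: "(p, q) \<in> edges g" "Y p < y" "y < Y q"
    by (cases rule: chain_cases) (use no y in auto)
  have "Y p = Y v" using no_vert_inside_edge[OF pq(1) v] no[of p] edges_verts[OF pq(1)] pq y by fastforce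
  then have p: "p = v" using verts_Y_inj edges_verts[OF pq(1)] v by blast
  have "Y q = Y w" using no_vert_inside_edge[OF pq(1) w] no[of q] edges_verts[OF pq(1)] pq y by fastforce
  then have q: "q = w" using verts_Y_inj edges_verts[OF pq(1)] w by blast
  have "p' = v \<and> q' = w" if a: "(p', q') \<in> edges g" "Y v \<le> Y p'" "Y q' \<le> Y w" for p' q'
  proof -
    have "Y p' < Y q'" using a(1) edges_E Y_E by blast
    then have "Y p' = Y v" "Y q' = Y w" using no[of p'] no[of q'] edges_verts[OF a(1)] a by fastforce+
    then show ?thesis using verts_Y_inj edges_verts[OF a(1)] v w by blast
  qed
  then show ?thesis using pq p q by (auto simp: between_def)
qed

lemma between_split:
  assumes "u \<in> verts g" "Y v \<le> Y u" "Y u \<le> Y w"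
  shows "between g v w = between g v u \<union> between g u w" "between g v u \<inter> between g u w = {}"
proof -
  have "Y (fst e) < Y (snd e) \<and> (Y u \<le> Y (fst e) \<or> Y (snd e) \<le> Y u)" if "e \<in> edges g" for e
    using no_vert_inside_edge[of "fst e" "snd e" g u] assms(1) that edges_E[of g] Y_E[of "fst e" "snd e"] by auto
  then show "between g v w = between g v u \<union> between g u w" "between g v u \<inter> between g u w = {}"
    using assms by (fastforce simp: between_def)+
qed

lemma finite_between [simp]: "finite (between g v w)"
  by (simp add: between_def)

lemma between_self: "between g v v = {}"
  using edges_E[of g] Y_E by (fastforce simp: between_def)

text \<open>Induction on the number of vertices of the chain strictly between \<open>v\<close> and
  \<open>w\<close>. It replaces lists of vertices: telescoping sums and comparability need only
  single edges and concatenation.\<close>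

lemma chain_induct [consumes 4, case_names refl step trans]:
  assumes g: "g \<in> chains" and "v \<in> verts g" "w \<in> verts g" "Y v \<le> Y w"
    and refl: "\<And>v. v \<in> verts g \<Longrightarrow> Q v v"
    and step: "\<And>v w. (v, w) \<in> edges g \<Longrightarrow> between g v w = {(v, w)} \<Longrightarrow> Q v w"
    and trans: "\<And>u v w. v \<in> verts g \<Longrightarrow> Y u \<le> Y v \<Longrightarrow> Y v \<le> Y w \<Longrightarrow> Q u v \<Longrightarrow> Q v w \<Longrightarrow> Q u w"
  shows "Q v w"
  using assms(2-4)
proof (induction "card {u \<in> verts g. Y v < Y u \<and> Y u < Y w}" arbitrary: v w rule: less_induct)
  case less
  have fin: "finite (verts g)" by (simp add: verts_def)
  show ?case
  proof (cases "Y v = Y w")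
    case True
    then show ?thesis using verts_Y_inj refl less.prems by metis
  next
    case lt: False
    show ?thesis
    proof (cases "\<exists>u \<in> verts g. Y v < Y u \<and> Y u < Y w")
      case True
      then obtain u where u: "u \<in> verts g" "Y v < Y u" "Y u < Y w" by blast
      have "card {x \<in> verts g. Y v < Y x \<and> Y x < Y u} < card {x \<in> verts g. Y v < Y x \<and> Y x < Y w}"
        by (rule psubset_card_mono) (use u fin in \<open>auto simp: set_eq_iff intro!: psubsetI\<close>)
      moreover have "card {x \<in> verts g. Y u < Y x \<and> Y x < Y w} < card {x \<in> verts g. Y v < Y x \<and> Y x < Y w}"
        by (rule psubset_card_mono) (use u fin in \<open>auto simp: set_eq_iff intro!: psubsetI\<close>)
      ultimately show ?thesis using less.hyps less.prems u trans[of u v w] by force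
    next
      case False
      have "between g v w = {(v, w)}"
        by (rule between_step[OF g]) (use False less.prems lt in auto)
      then show ?thesis using step[of v w] by (auto simp: between_def)
    qed
  qed
qed

lemma sum_between:
  assumes "g \<in> chains" "v \<in> verts g" "w \<in> verts g" "Y v \<le> Y w"
  shows "(\<Sum>e\<in>between g v w. x (snd e) - x (fst e)) = (x w - x v :: real)"
  using assms
proof (induction rule: chain_induct)
  case (trans u v w)
  then show ?case using between_split[of v g u w] by (simp add: sum.union_disjoint)
qed (auto simp: between_self)

lemma verts_comparable:
  assumes "g \<in> chains" "v \<in> verts g" "w \<in> verts g" "Y v \<le> Y w"
  shows "leh R v w"
  using assms
proof (induction rule: chain_induct)
  case (refl v) then show ?case by (simp add: leh_refl verts_def)
next
  case (step v w) then show ?case using edges_E E_lth lth_def by blast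
next
  case (trans u v w) then show ?case using leh_trans by blast
qed

lemma verts_leh_iff: "g \<in> chains \<Longrightarrow> v \<in> verts g \<Longrightarrow> w \<in> verts g \<Longrightarrow> leh R v w \<longleftrightarrow> Y v \<le> Y w"
  using verts_comparable Y_leh by (auto simp: verts_def)

text \<open>Telescoping the indicator function of \<open>u\<close>: if no edge of the stretch
  touches \<open>u\<close>, its differences vanish on both sides of \<open>u\<close>, so the
  indicator agrees at \<open>v\<close>, \<open>u\<close> and \<open>w\<close>, which would force
  \<open>v = u = w\<close>.\<close>

lemma vert_in_between:
  assumes "g \<in> chains" "v \<in> verts g" "w \<in> verts g" "Y v < Y w" "u \<in> verts g" "Y v \<le> Y u" "Y u \<le> Y w"
  shows "\<exists>e\<in>between g v w. fst e = u \<or> snd e = u"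
proof (rule ccontr)
  assume n: "\<not> ?thesis"
  let ?x = "\<lambda>s. if s = u then 1 else 0 :: real"
  have le: "between g v u \<subseteq> between g v w" "between g u w \<subseteq> between g v w"
    using assms by (auto simp: between_def)
  have "(\<Sum>e\<in>between g v u. ?x (snd e) - ?x (fst e)) = 0"
    by (rule sum.neutral) (use n le in auto)
  moreover have "(\<Sum>e\<in>between g u w. ?x (snd e) - ?x (fst e)) = 0"
    by (rule sum.neutral) (use n le in auto)
  ultimately have "?x u - ?x v = 0" "?x w - ?x u = 0"
    using sum_between[of g v u ?x] sum_between[of g u w ?x] assms by auto
  then show False using assms(4) by (auto split: if_splits)
qed

lemma chains_eqI:
  assumes "g \<in> chains" "h \<in> chains" "edges g = edges h" shows "g = h"
proof
  fix y
  show "g y = h y"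
  proof (cases "y \<in> {y0..y1}")
    case True
    with assms(1) show ?thesis
    proof (cases rule: chain_cases)
      case (1 v)
      have "v \<in> V" using 1 by (simp add: verts_def)
      then have "\<exists>e\<in>between g Bot Top. fst e = v \<or> snd e = v"
        by (intro vert_in_between assms Bot_verts Top_verts y01 1 Y_bounds)
      then have "v \<in> verts h" using assms(3) edges_verts by (force simp: between_def)
      then show ?thesis using 1 by (simp add: verts_def)
    next
      case (2 p q)
      moreover have "(p, q) \<in> edges h" using 2 assms(3) by simp
      ultimately show ?thesis by (auto simp: edges_def)
    qed
  qed (use assms in \<open>auto simp: chains_def\<close>)
qed

lemma finite_chains: "finite chains"
proof (rule finite_imageD)
  show "finite (edges ` chains)" by (rule finite_subset[of _ "Pow E"]) (use edges_E in auto)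
  show "inj_on edges chains" using chains_eqI by (auto simp: inj_on_def)
qed

section \<open>The lattice of chains\<close>

lemma chains_max: "g \<in> chains \<Longrightarrow> h \<in> chains \<Longrightarrow> (\<lambda>y. max (g y) (h y)) \<in> chains"
  and chains_min: "g \<in> chains \<Longrightarrow> h \<in> chains \<Longrightarrow> (\<lambda>y. min (g y) (h y)) \<in> chains"
  by (auto simp: chains_def seg_def max_def min_def intro: continuous_on_max[unfolded max_def] continuous_on_min[unfolded min_def])

lemma chains_glue:
  assumes "g \<in> chains" "h \<in> chains" "v \<in> verts g" "v \<in> verts h"
  shows "(\<lambda>y. if y \<le> Y v then g y else h y) \<in> chains"
proof -
  have v: "v \<in> V" using assms by (simp add: verts_def)
  have "seg y0 y1 (\<lambda>y. if y \<le> Y v then g y else h y)"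
    by (rule seg_glue) (use assms Y_bounds[OF v] in \<open>auto simp: chains_def seg_def verts_def intro: continuous_on_subset\<close>)
  then show ?thesis using assms by (auto simp: chains_def)
qed

text \<open>There are finitely many chains, so a maximal one with property \<open>K\<close> exists;
  closure of \<open>K\<close> under pointwise maxima makes it the greatest.\<close>

lemma greatest_chain:
  assumes "g0 \<in> chains" "K g0"
    and "\<And>g h. g \<in> chains \<Longrightarrow> h \<in> chains \<Longrightarrow> K g \<Longrightarrow> K h \<Longrightarrow> K (\<lambda>y. max (g y) (h y))"
  obtains m where "m \<in> chains" "K m" "\<And>g y. g \<in> chains \<Longrightarrow> K g \<Longrightarrow> g y \<le> m y"
proof -
  have "finite {g \<in> chains. K g}" "{g \<in> chains. K g} \<noteq> {}" using finite_chains assms by auto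
  then obtain m where m: "m \<in> chains" "K m" "\<And>g. g \<in> chains \<Longrightarrow> K g \<Longrightarrow> m \<le> g \<Longrightarrow> m = g"
    using finite_has_maximal[of "{g \<in> chains. K g}"] by auto
  have "g y \<le> m y" if "g \<in> chains" "K g" for g y
    using m(3)[of "\<lambda>y. max (m y) (g y)"] chains_max[OF m(1) that(1)] assms(3)[OF m(1) that(1) m(2) that(2)]
    by (metis (no_types, lifting) le_funI max.cobounded1 max.cobounded2)
  then show ?thesis using that m by blast
qed

lemma least_chain:
  assumes "g0 \<in> chains" "K g0"
    and "\<And>g h. g \<in> chains \<Longrightarrow> h \<in> chains \<Longrightarrow> K g \<Longrightarrow> K h \<Longrightarrow> K (\<lambda>y. min (g y) (h y))"
  obtains m where "m \<in> chains" "K m" "\<And>g y. g \<in> chains \<Longrightarrow> K g \<Longrightarrow> m y \<le> g y"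
proof -
  have "finite {g \<in> chains. K g}" "{g \<in> chains. K g} \<noteq> {}" using finite_chains assms by auto
  then obtain m where m: "m \<in> chains" "K m" "\<And>g. g \<in> chains \<Longrightarrow> K g \<Longrightarrow> g \<le> m \<Longrightarrow> m = g"
    using finite_has_minimal[of "{g \<in> chains. K g}"] by auto
  have "m y \<le> g y" if "g \<in> chains" "K g" for g y
    using m(3)[of "\<lambda>y. min (m y) (g y)"] chains_min[OF m(1) that(1)] assms(3)[OF m(1) that(1) m(2) that(2)]
    by (metis (no_types, lifting) le_funI min.cobounded1 min.cobounded2)
  then show ?thesis using that m by blast
qed

lemma chains_nonempty: "\<exists>g. g \<in> chains"
  using chain_point[OF pos_hasse[OF Bot_V]] by blast

end

section \<open>Winding numbers and chains\<close>

text \<open>Multiplication by \<open>c\<close> rotates the slit of the principal logarithm away from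
  the path. The difference \<open>d\<close> between a continuous logarithm along the path and the
  principal one has constant exponential \<open>1 / c\<close>, hence takes values in a discrete set
  and is constant.\<close>

lemma winding_number_Ln:
  fixes c z :: complex
  assumes p: "path p" and c: "c \<noteq> 0" and av: "\<And>t. t \<in> {0..1} \<Longrightarrow> c * (p t - z) \<notin> \<real>\<^sub>\<le>\<^sub>0"
  shows "winding_number p z = (Ln (c * (pathfinish p - z)) - Ln (c * (pathstart p - z))) / (2 * pi * \<i>)"
proof -
  have z: "z \<notin> path_image p" using av by (force simp: path_image_def)
  obtain q where q: "path q" "pathfinish q - pathstart q = 2 * of_real pi * \<i> * winding_number p z"
    "\<And>t. t \<in> {0..1} \<Longrightarrow> p t = z + exp (q t)"
    using winding_number_as_continuous_log[OF p z] by metis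
  define d where "d t = q t - Ln (c * (p t - z))" for t
  have cont: "continuous_on {0..1} d"
    unfolding d_def using p q(1) av by (auto simp: path_def intro!: continuous_intros)
  have exp_d: "exp (d t) = 1 / c" if "t \<in> {0..1}" for t
  proof -
    have "c * (p t - z) \<noteq> 0" using av[OF that] by auto
    then show ?thesis using q(3)[OF that] by (simp add: d_def exp_diff)
  qed
  have "d constant_on {0..1}"
  proof (rule continuous_discrete_range_constant[OF _ cont])
    fix s :: real assume s: "s \<in> {0..1}"
    \<comment> \<open>Distinct values with equal exponential differ by a nonzero integer multiple of
      \<open>2 * pi * \<i>\<close>.\<close>
    have "2 * pi \<le> norm (d t - d s)" if t: "t \<in> {0..1}" "d t \<noteq> d s" for t
    proof -
      have "exp (d t) = exp (d s)" using exp_d s t by simp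
      then obtain n :: int where n: "d t = d s + (2 * n * pi) * \<i>" using exp_eq by auto
      then have "n \<noteq> 0" using t by auto
      then have "1 \<le> \<bar>real_of_int n\<bar>" by linarith
      moreover have "norm (d t - d s) = 2 * \<bar>real_of_int n\<bar> * pi" using n by (simp add: norm_mult)
      ultimately show ?thesis by simp
    qed
    then show "\<exists>e>0. \<forall>t. t \<in> {0..1} \<and> d t \<noteq> d s \<longrightarrow> e \<le> norm (d t - d s)"
      by (intro exI[of _ "2 * pi"]) auto
  qed simp
  then have "d 0 = d 1" by (force simp: constant_on_def)
  then have "2 * of_real pi * \<i> * winding_number p z = Ln (c * (pathfinish p - z)) - Ln (c * (pathstart p - z))"
    using q(2) by (simp add: d_def pathstart_def pathfinish_def algebra_simps)
  then show ?thesis by (simp add: field_simps)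
qed

lemma discrete_limit:
  fixes f :: "'a \<Rightarrow> 'b::t1_space"
  assumes "(f \<longlongrightarrow> l) F" "\<forall>\<^sub>F x in F. f x \<in> S" "finite S" "F \<noteq> bot"
  shows "l \<in> S" "\<forall>\<^sub>F x in F. f x = l"
proof -
  have "open (- (S - {l}))" using assms(3) by (intro open_Compl finite_imp_closed) auto
  then have "\<forall>\<^sub>F x in F. f x \<in> - (S - {l})" using assms(1) by (auto simp: tendsto_def)
  then have *: "\<forall>\<^sub>F x in F. f x = l \<and> f x \<in> S" using assms(2) by eventually_elim auto
  then show "\<forall>\<^sub>F x in F. f x = l" by eventually_elim auto
  show "l \<in> S" using eventually_happens[OF *] assms(4) by auto
qed

context planar_poset
begin

abbreviation "L \<equiv> crv LeftE"
abbreviation "Rt \<equiv> crv RightE"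

lemma arc_LR: "arc L" "pathstart L = pos Bot" "pathfinish L = pos Top"
  "arc Rt" "pathstart Rt = pos Bot" "pathfinish Rt = pos Top"
proof -
  have *: "\<forall>e\<in>EH P R. arc (crv e) \<and> pathstart (crv e) = pos (esrc e) \<and> pathfinish (crv e) = pos (etgt e)"
    using planar unfolding bounded_strongly_planar_def by blast
  show "arc L" "pathstart L = pos Bot" "pathfinish L = pos Top"
    "arc Rt" "pathstart Rt = pos Bot" "pathfinish Rt = pos Top"
    using bspec[OF * LeftE_EH] bspec[OF * RightE_EH] by auto
qed

lemma path_LR: "path L" "path Rt"
  using arc_LR arc_imp_path by auto

lemma pos_BT: "pos Bot \<noteq> pos Top"
  using pos_inj[of Bot Top] by auto

lemma L_Rt: "path_image L \<inter> path_image Rt = {pos Bot, pos Top}"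
proof -
  have "path_image L \<inter> path_image Rt \<subseteq> {pos Bot, pos Top}"
    using edges_meet[of LeftE RightE] by auto
  then show ?thesis using arc_LR by (metis Int_iff empty_subsetI insert_subset pathfinish_in_path_image pathstart_in_path_image subset_antisym)
qed

lemma hasse_L: assumes "z \<in> hasse" "z \<in> path_image L" shows "z = pos Bot \<or> z = pos Top"
proof -
  obtain p q where pq: "(p, q) \<in> E" "z \<in> path_image (crv (HE p q))" using assms(1) by (auto simp: hasse_def img_def)
  then show ?thesis using edges_meet[of "HE p q" LeftE z] assms(2) by auto
qed

lemma hasse_Rt: assumes "z \<in> hasse" "z \<in> path_image Rt" shows "z = pos Bot \<or> z = pos Top"
proof -
  obtain p q where pq: "(p, q) \<in> E" "z \<in> path_image (crv (HE p q))" using assms(1) by (auto simp: hasse_def img_def)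
  then show ?thesis using edges_meet[of "HE p q" RightE z] assms(2) by auto
qed

lemma hasse_wind:
  assumes "z \<in> hasse" "z \<noteq> pos Bot" "z \<noteq> pos Top"
  shows "winding_number (L +++ reversepath Rt) z = -1"
proof -
  obtain p q where pq: "(p, q) \<in> E" "z \<in> img (p, q)" using assms(1) by (auto simp: hasse_def)
  have "\<forall>e\<in>EH P R - {LeftE, RightE}. \<forall>z\<in>path_image (crv e) - {pos Bot, pos Top}.
        winding_number (crv LeftE +++ reversepath (crv RightE)) z = -1"
    using planar unfolding bounded_strongly_planar_def by blast
  then show ?thesis using pq assms by (fastforce simp: img_def)
qed

section \<open>Winding numbers of a chain about points on either side\<close>

definition chain_path :: "(real \<Rightarrow> real) \<Rightarrow> real \<Rightarrow> complex" where
  "chain_path g t = Complex (g (y0 + t * (y1 - y0))) (y0 + t * (y1 - y0))"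

definition graph :: "(real \<Rightarrow> real) \<Rightarrow> complex set" where
  "graph g = {z. Im z \<in> {y0..y1} \<and> Re z = g (Im z)}"

lemma Im_chain_path: assumes "t \<in> {0..1}" shows "Im (chain_path g t) \<in> {y0..y1}"
proof -
  have "t * (y1 - y0) \<le> 1 * (y1 - y0)" by (rule mult_right_mono) (use assms y01 in auto)
  moreover have "0 \<le> t * (y1 - y0)" using assms y01 by auto
  ultimately show ?thesis by (simp add: chain_path_def)
qed

lemma path_image_chain_path: "path_image (chain_path g) = graph g"
proof -
  have "z \<in> path_image (chain_path g)" if "z \<in> graph g" for z
  proof -
    let ?t = "(Im z - y0) / (y1 - y0)"
    have "?t \<in> {0..1}" using that y01 by (auto simp: graph_def field_simps)
    moreover have "z = chain_path g ?t" using that y01 by (simp add: graph_def chain_path_def complex_eq_iff)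
    ultimately show ?thesis unfolding path_image_def by blast
  qed
  moreover have "chain_path g t \<in> graph g" if "t \<in> {0..1}" for t
    using Im_chain_path[OF that, of g] by (simp add: graph_def chain_path_def)
  ultimately show ?thesis by (auto simp: path_image_def)
qed

lemma chain_path_ends: "g \<in> chains \<Longrightarrow> pathstart (chain_path g) = pos Bot" "g \<in> chains \<Longrightarrow> pathfinish (chain_path g) = pos Top"
  using chain_y0 chain_y1 by (auto simp: pathstart_def pathfinish_def chain_path_def complex_eq_iff)

lemma arc_chain_path: assumes "g \<in> chains" shows "arc (chain_path g)"
proof -
  have sub: "(\<lambda>t. y0 + t * (y1 - y0)) ` {0..1} \<subseteq> {y0..y1}"
    using Im_chain_path by (force simp: chain_path_def)
  have "continuous_on {0..1} (\<lambda>t. g (y0 + t * (y1 - y0)))"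
    by (rule continuous_on_compose2[OF chain_cont[OF assms] _ sub]) (intro continuous_intros)
  then have "path (chain_path g)"
    unfolding path_def chain_path_def complex_eq by (intro continuous_intros) auto
  moreover have "inj_on (chain_path g) {0..1}"
    using y01 by (auto simp: inj_on_def chain_path_def)
  ultimately show ?thesis by (simp add: arc_def)
qed

lemma path_chain_path: "g \<in> chains \<Longrightarrow> path (chain_path g)"
  by (simp add: arc_chain_path arc_imp_path)

lemma graph_hasse: assumes "g \<in> chains" shows "graph g \<subseteq> hasse"
proof
  fix z assume "z \<in> graph g"
  then have "z = Complex (g (Im z)) (Im z)" "Im z \<in> {y0..y1}" by (auto simp: graph_def complex_eq_iff)
  then show "z \<in> hasse" using chain_hasse[OF assms] by metis
qed

lemma graph_ends: assumes "g \<in> chains" shows "pos Bot \<in> graph g" "pos Top \<in> graph g"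
  using chain_path_ends[OF assms] path_image_chain_path by (metis pathstart_in_path_image pathfinish_in_path_image)+

text \<open>The condition says that the horizontal ray going left from \<open>z\<close> misses the
  chain, so it holds for every \<open>z\<close> outside the strip; \<open>rightof\<close> is the
  same for the ray going right. These rays are the slits of the logarithms below.\<close>

definition leftof :: "(real \<Rightarrow> real) \<Rightarrow> complex \<Rightarrow> bool" where
  "leftof g z \<longleftrightarrow> (Im z \<in> {y0..y1} \<longrightarrow> Re z < g (Im z))"

definition rightof :: "(real \<Rightarrow> real) \<Rightarrow> complex \<Rightarrow> bool" where
  "rightof g z \<longleftrightarrow> (Im z \<in> {y0..y1} \<longrightarrow> g (Im z) < Re z)"

text \<open>The winding number of any chain about a point to its left. Only the endpoints enter, and
  all chains share them; this is what makes different chains comparable.\<close>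

definition wn_left :: "complex \<Rightarrow> complex" where
  "wn_left z = (Ln (pos Top - z) - Ln (pos Bot - z)) / (2 * pi * \<i>)"

definition wn_right :: "complex \<Rightarrow> complex" where
  "wn_right z = (Ln (- (pos Top - z)) - Ln (- (pos Bot - z))) / (2 * pi * \<i>)"

lemma winding_leftof: assumes "g \<in> chains" "leftof g z" shows "winding_number (chain_path g) z = wn_left z"
proof -
  have "1 * (chain_path g t - z) \<notin> \<real>\<^sub>\<le>\<^sub>0" if "t \<in> {0..1}" for t
  proof
    assume a: "1 * (chain_path g t - z) \<in> \<real>\<^sub>\<le>\<^sub>0"
    have "chain_path g t \<in> graph g" using that path_image_chain_path[of g] unfolding path_image_def by blast
    then show False using a assms(2) by (auto simp: graph_def leftof_def complex_nonpos_Reals_iff)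
  qed
  from winding_number_Ln[OF path_chain_path[OF assms(1)] _ this] show ?thesis
    by (simp add: wn_left_def chain_path_ends assms)
qed

lemma winding_rightof: assumes "g \<in> chains" "rightof g z" shows "winding_number (chain_path g) z = wn_right z"
proof -
  have "(- 1) * (chain_path g t - z) \<notin> \<real>\<^sub>\<le>\<^sub>0" if "t \<in> {0..1}" for t
  proof
    assume a: "(- 1) * (chain_path g t - z) \<in> \<real>\<^sub>\<le>\<^sub>0"
    have "chain_path g t \<in> graph g" using that path_image_chain_path[of g] unfolding path_image_def by blast
    then show False using a assms(2) by (auto simp: graph_def rightof_def complex_nonpos_Reals_iff)
  qed
  from winding_number_Ln[OF path_chain_path[OF assms(1)] _ this] show ?thesis
    by (simp add: wn_right_def chain_path_ends assms)
qed

text \<open>Inside the strip \<open>pos Top - z\<close> lies in the upper and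
  \<open>pos Bot - z\<close> in the lower half-plane, so turning the slit by a half-turn changes the
  two logarithms by \<open>- \<i> * pi\<close> and \<open>\<i> * pi\<close>; the difference changes
  by \<open>- 2 * pi * \<i>\<close>.\<close>

lemma wn_right_left: assumes "y0 < Im z" "Im z < y1" shows "wn_right z = wn_left z - 1"
proof -
  have "Ln (- (pos Top - z)) = Ln (pos Top - z) - \<i> * pi"
    using assms by (subst Ln_minus) (auto simp: complex_eq_iff)
  moreover have "Ln (- (pos Bot - z)) = Ln (pos Bot - z) + \<i> * pi"
    using assms by (subst Ln_minus) (auto simp: complex_eq_iff)
  ultimately show ?thesis by (simp add: wn_right_def wn_left_def field_simps)
qed

text \<open>This loop runs down the chain and that of \<open>WR\<close> runs up it, so in the sum
  the chain cancels and the winding number of the outer curve remains.\<close>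

definition WL :: "(real \<Rightarrow> real) \<Rightarrow> complex \<Rightarrow> complex" where
  "WL g = winding_number (L +++ reversepath (chain_path g))"

definition WR :: "(real \<Rightarrow> real) \<Rightarrow> complex \<Rightarrow> complex" where
  "WR g = winding_number (chain_path g +++ reversepath Rt)"

lemma simple_paths:
  assumes "g \<in> chains"
  shows "simple_path (L +++ reversepath Rt)" "simple_path (L +++ reversepath (chain_path g))" "simple_path (chain_path g +++ reversepath Rt)"
proof -
  have "path_image L \<inter> graph g \<subseteq> {pos Bot, pos Top}" "path_image Rt \<inter> graph g \<subseteq> {pos Bot, pos Top}"
    using graph_hasse[OF assms] hasse_L hasse_Rt by blast+
  then show "simple_path (L +++ reversepath Rt)" "simple_path (L +++ reversepath (chain_path g))" "simple_path (chain_path g +++ reversepath Rt)"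
    using L_Rt assms
    by (auto intro!: simple_path_join_loop simp: arc_LR arc_chain_path chain_path_ends path_image_chain_path arc_reversepath)
qed

lemma images:
  assumes "g \<in> chains"
  shows "path_image (L +++ reversepath Rt) = path_image L \<union> path_image Rt"
    "path_image (L +++ reversepath (chain_path g)) = path_image L \<union> graph g"
    "path_image (chain_path g +++ reversepath Rt) = graph g \<union> path_image Rt"
  using assms by (simp_all add: path_image_join arc_LR chain_path_ends path_image_chain_path)

lemma loops:
  assumes "g \<in> chains"
  shows "pathfinish (L +++ reversepath Rt) = pathstart (L +++ reversepath Rt)"
    "pathfinish (L +++ reversepath (chain_path g)) = pathstart (L +++ reversepath (chain_path g))"
    "pathfinish (chain_path g +++ reversepath Rt) = pathstart (chain_path g +++ reversepath Rt)"
  using assms by (simp_all add: arc_LR chain_path_ends)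

lemma WL_eq: "g \<in> chains \<Longrightarrow> z \<notin> path_image L \<Longrightarrow> z \<notin> graph g \<Longrightarrow> WL g z = winding_number L z - winding_number (chain_path g) z"
  and WR_eq: "g \<in> chains \<Longrightarrow> z \<notin> path_image Rt \<Longrightarrow> z \<notin> graph g \<Longrightarrow> WR g z = winding_number (chain_path g) z - winding_number Rt z"
  and total_eq: "z \<notin> path_image L \<Longrightarrow> z \<notin> path_image Rt \<Longrightarrow>
    winding_number (L +++ reversepath Rt) z = winding_number L z - winding_number Rt z"
  unfolding WL_def WR_def
  by (simp_all add: winding_number_join winding_number_reversepath path_LR path_chain_path arc_LR chain_path_ends path_image_chain_path)

lemma WL_values: "g \<in> chains \<Longrightarrow> z \<notin> path_image L \<Longrightarrow> z \<notin> graph g \<Longrightarrow> WL g z \<in> {-1, 0, 1}"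
  and WR_values: "g \<in> chains \<Longrightarrow> z \<notin> path_image Rt \<Longrightarrow> z \<notin> graph g \<Longrightarrow> WR g z \<in> {-1, 0, 1}"
  using simple_closed_path_winding_number_cases[OF simple_paths(2) loops(2), of g z]
    simple_closed_path_winding_number_cases[OF simple_paths(3) loops(3), of g z]
  by (simp_all add: images WL_def WR_def del: insert_iff)

text \<open>The winding numbers of a chain closed up by the left resp. right edge, continued from the
  left side of the chain across it.\<close>

definition HL :: "complex \<Rightarrow> complex" where "HL z = winding_number L z - wn_left z"
definition HR :: "complex \<Rightarrow> complex" where "HR z = wn_left z - winding_number Rt z"

lemma leftof_notin: "leftof g z \<Longrightarrow> z \<notin> graph g" and rightof_notin: "rightof g z \<Longrightarrow> z \<notin> graph g"
  by (auto simp: leftof_def rightof_def graph_def)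

lemma WL_left: "g \<in> chains \<Longrightarrow> leftof g z \<Longrightarrow> z \<notin> path_image L \<Longrightarrow> WL g z = HL z"
  and WR_left: "g \<in> chains \<Longrightarrow> leftof g z \<Longrightarrow> z \<notin> path_image Rt \<Longrightarrow> WR g z = HR z"
  by (simp_all add: WL_eq WR_eq HL_def HR_def winding_leftof leftof_notin)

lemma WL_right: "g \<in> chains \<Longrightarrow> rightof g z \<Longrightarrow> z \<notin> path_image L \<Longrightarrow> y0 < Im z \<Longrightarrow> Im z < y1 \<Longrightarrow> WL g z = HL z + 1"
  and WR_right: "g \<in> chains \<Longrightarrow> rightof g z \<Longrightarrow> z \<notin> path_image Rt \<Longrightarrow> y0 < Im z \<Longrightarrow> Im z < y1 \<Longrightarrow> WR g z = HR z - 1"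
  by (simp_all add: WL_eq WR_eq HL_def HR_def winding_rightof rightof_notin wn_right_left)

lemma hasse_interior:
  assumes "d \<in> hasse" "y0 < Im d" "Im d < y1"
  shows "d \<notin> path_image L" "d \<notin> path_image Rt" "winding_number (L +++ reversepath Rt) d = -1"
  using assms hasse_L[of d] hasse_Rt[of d] hasse_wind[of d] by auto

lemma isCont_H:
  assumes "d \<notin> path_image L" "d \<notin> path_image Rt" "y0 < Im d" "Im d < y1"
  shows "isCont HL d" "isCont HR d"
proof -
  have "isCont wn_left d" unfolding wn_left_def
    by (intro continuous_intros) (use assms in \<open>auto simp: complex_nonpos_Reals_iff\<close>)
  then show "isCont HL d" "isCont HR d"
    unfolding HL_def HR_def using continuous_at_winding_number path_LR assms by (auto intro!: continuous_intros)
qed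

lemma shift_tendsto:
  fixes f :: "complex \<Rightarrow> complex"
  assumes "isCont f d"
  shows "((\<lambda>\<delta>::real. f (d - of_real \<delta>)) \<longlongrightarrow> f d) (at_right 0)"
    and "((\<lambda>\<delta>::real. f (d + of_real \<delta>)) \<longlongrightarrow> f d) (at_right 0)"
proof -
  have "((\<lambda>\<delta>::real. d - of_real \<delta>) \<longlongrightarrow> d - of_real 0) (at_right 0)"
    "((\<lambda>\<delta>::real. d + of_real \<delta>) \<longlongrightarrow> d + of_real 0) (at_right 0)"
    by (intro tendsto_intros)+
  then show "((\<lambda>\<delta>::real. f (d - of_real \<delta>)) \<longlongrightarrow> f d) (at_right 0)"
    "((\<lambda>\<delta>::real. f (d + of_real \<delta>)) \<longlongrightarrow> f d) (at_right 0)"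
    using assms by (auto intro: isCont_tendsto_compose)
qed

lemma shift_eventually:
  assumes "open S" "d \<in> (S :: complex set)"
  shows "\<forall>\<^sub>F \<delta> :: real in at_right 0. d - of_real \<delta> \<in> S" "\<forall>\<^sub>F \<delta> :: real in at_right 0. d + of_real \<delta> \<in> S"
proof -
  have "isCont (\<lambda>z::complex. z) d" by simp
  from shift_tendsto[OF this] show "\<forall>\<^sub>F \<delta> :: real in at_right 0. d - of_real \<delta> \<in> S" "\<forall>\<^sub>F \<delta> :: real in at_right 0. d + of_real \<delta> \<in> S"
    using assms by (auto simp: tendsto_def)
qed

text \<open>All four one-sided limits lie in \<open>{-1, 0, 1}\<close>, crossing a chain changes them by one, and
  \<open>HL d + HR d = -1\<close>; this leaves only one possibility.\<close>

lemma H_near: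
  assumes d: "d \<in> hasse" "y0 < Im d" "Im d < y1"
  shows "HL d = -1" "\<forall>\<^sub>F \<delta> in at_right 0. HL (d - of_real \<delta>) = -1" "\<forall>\<^sub>F \<delta> in at_right 0. HL (d + of_real \<delta>) = -1"
    and "HR d = 0" "\<forall>\<^sub>F \<delta> in at_right 0. HR (d - of_real \<delta>) = 0" "\<forall>\<^sub>F \<delta> in at_right 0. HR (d + of_real \<delta>) = 0"
proof -
  obtain g where g: "g \<in> chains" "g (Im d) = Re d" using chain_point[OF d(1)] by blast
  note dn = hasse_interior[OF d]
  have cl: "open (- path_image L \<inter> - path_image Rt)"
    using path_LR by (intro open_Int open_Compl closed_path_image)
  have ev: "\<forall>\<^sub>F \<delta> in at_right 0. d - of_real \<delta> \<in> - path_image L \<inter> - path_image Rt \<and> 0 < \<delta>"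
     "\<forall>\<^sub>F \<delta> in at_right 0. d + of_real \<delta> \<in> - path_image L \<inter> - path_image Rt \<and> 0 < \<delta>"
    using shift_eventually[OF cl, of d] dn(1,2) by (auto intro!: eventually_conj eventually_at_right_less simp del: Compl_iff Int_iff)
  have lft: "leftof g (d - of_real \<delta>)" if "0 < \<delta>" for \<delta> using that g by (simp add: leftof_def)
  have rgt: "rightof g (d + of_real \<delta>)" if "0 < \<delta>" for \<delta> using that g by (simp add: rightof_def)
  have 1: "\<forall>\<^sub>F \<delta> in at_right 0. HL (d - of_real \<delta>) \<in> {-1, 0, 1}"
    using ev(1) by eventually_elim
      (use WL_values[OF g(1)] WL_left[OF g(1)] lft leftof_notin in \<open>metis ComplD IntD1\<close>)
  have 2: "\<forall>\<^sub>F \<delta> in at_right 0. HR (d - of_real \<delta>) \<in> {-1, 0, 1}"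
    using ev(1) by eventually_elim
      (use WR_values[OF g(1)] WR_left[OF g(1)] lft leftof_notin in \<open>metis ComplD IntD2\<close>)
  have 3: "\<forall>\<^sub>F \<delta> in at_right 0. HL (d + of_real \<delta>) + 1 \<in> {-1, 0, 1}"
    using ev(2)
  proof eventually_elim
    case (elim \<delta>)
    then show ?case using WL_values[OF g(1), of "d + of_real \<delta>"] WL_right[OF g(1), of "d + of_real \<delta>"]
       rgt[of \<delta>] rightof_notin[of g "d + of_real \<delta>"] d by (simp del: insert_iff)
  qed
  have 4: "\<forall>\<^sub>F \<delta> in at_right 0. HR (d + of_real \<delta>) - 1 \<in> {-1, 0, 1}"
    using ev(2)
  proof eventually_elim
    case (elim \<delta>)
    then show ?case using WR_values[OF g(1), of "d + of_real \<delta>"] WR_right[OF g(1), of "d + of_real \<delta>"]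
       rgt[of \<delta>] rightof_notin[of g "d + of_real \<delta>"] d by (simp del: insert_iff)
  qed
  note cH = isCont_H[OF dn(1,2) d(2,3)]
  have cH1: "isCont (\<lambda>z. HL z + 1) d" "isCont (\<lambda>z. HR z - 1) d" by (intro continuous_intros cH)+
  have fin: "finite {-1, 0, 1 :: complex}" and nb: "at_right (0::real) \<noteq> bot" by simp_all
  note l1 = discrete_limit[OF shift_tendsto(1)[OF cH(1)] 1 fin nb]
  note l2 = discrete_limit[OF shift_tendsto(1)[OF cH(2)] 2 fin nb]
  note l3 = discrete_limit[OF shift_tendsto(2)[OF cH1(1)] 3 fin nb]
  note l4 = discrete_limit[OF shift_tendsto(2)[OF cH1(2)] 4 fin nb]
  have "HL d + HR d = -1"
    using dn(3) total_eq[OF dn(1,2)] by (simp add: HL_def HR_def)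
  then have "HR d = - 1 - HL d" by (simp add: algebra_simps)
  \<comment> \<open>The limits from the left put \<open>HL d\<close> and \<open>HR d\<close> in
    \<open>{-1, 0, 1}\<close>; those from the right, shifted by one, leave \<open>{-1, 0}\<close>
    for \<open>HL d\<close> and \<open>{0, 1}\<close> for \<open>HR d\<close>. The sum -1 then
    selects one pair.\<close>
  then have *: "HL d = -1 \<and> HR d = 0" using l1(1) l2(1) l3(1) l4(1) by auto
  then show "HL d = -1" "HR d = 0" by auto
  show "\<forall>\<^sub>F \<delta> in at_right 0. HL (d - of_real \<delta>) = -1" "\<forall>\<^sub>F \<delta> in at_right 0. HR (d - of_real \<delta>) = 0"
    using l1(2) l2(2) * by auto
  show "\<forall>\<^sub>F \<delta> in at_right 0. HL (d + of_real \<delta>) = -1" 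
    using l3(2) by eventually_elim (use * in \<open>simp add: eq_neg_iff_add_eq_0\<close>)
  show "\<forall>\<^sub>F \<delta> in at_right 0. HR (d + of_real \<delta>) = 0"
    using l4(2) by eventually_elim (use * in auto)
qed

end

section \<open>Faces and the two sides of an edge\<close>

text \<open>A strictly larger connected set would meet the frontier of \<open>F\<close>, which lies
  in the removed set \<open>K\<close>.\<close>

lemma component_of_open:
  fixes F :: "'a::real_normed_vector set"
  assumes "connected F" "F \<noteq> {}" "F \<inter> K = {}" "frontier F \<subseteq> K"
  shows "F \<in> components (- K)"
  unfolding in_components_maximal
proof (intro conjI allI impI)
  fix T assume T: "T \<noteq> {} \<and> F \<subseteq> T \<and> T \<subseteq> - K \<and> connected T"
  show "T = F"
  proof (rule ccontr)
    assume "T \<noteq> F"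
    then have "T \<inter> frontier F \<noteq> {}" using T assms(2) by (intro connected_Int_frontier) auto
    then show False using T assms(4) by auto
  qed
qed (use assms in auto)

context planar_poset
begin

abbreviation "drwg \<equiv> drawing P R pos crv"
abbreviation "faces \<equiv> bfaces P R pos crv"

lemma drwg_eq: "drwg = hasse \<union> path_image L \<union> path_image Rt"
proof -
  have "EH P R = (\<lambda>e. HE (fst e) (snd e)) ` E \<union> {LeftE, RightE}"
    by (auto simp: EH_def Ecov_def image_iff)
  then show ?thesis using pos_hasse by (auto simp: drawing_def hasse_def img_def)
qed

lemma compact_drwg: "compact drwg"
  unfolding drwg_eq using compact_hasse path_LR by (intro compact_Un compact_path_image)

lemma faces_props:
  assumes "F \<in> faces"
  shows "open F" "connected F" "F \<inter> drwg = {}" "F \<noteq> {}" "bounded F" "F \<in> components (- drwg)"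
proof -
  show F: "F \<in> components (- drwg)" "bounded F" using assms by (auto simp: bfaces_def)
  have "open (- drwg)" using compact_drwg compact_imp_closed by blast
  then show "open F" using F open_components by blast
  show "connected F" "F \<inter> drwg = {}" "F \<noteq> {}"
    using F in_components_connected in_components_subset in_components_nonempty by blast+
qed

lemma faces_disjoint: "F \<in> faces \<Longrightarrow> F' \<in> faces \<Longrightarrow> F \<inter> F' \<noteq> {} \<Longrightarrow> F = F'"
  using faces_props(6) components_nonoverlap by blast

lemma faces_absorb: "F \<in> faces \<Longrightarrow> connected T \<Longrightarrow> T \<inter> drwg = {} \<Longrightarrow> F \<inter> T \<noteq> {} \<Longrightarrow> T \<subseteq> F"
  using components_maximal[OF faces_props(6)] by blast

section \<open>Insides of the outer curve and of the loops through a chain\<close>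

abbreviation "inJ \<equiv> inside (path_image L \<union> path_image Rt)"
abbreviation "outJ \<equiv> outside (path_image L \<union> path_image Rt)"
abbreviation "inL g \<equiv> inside (path_image L \<union> graph g)"
abbreviation "inR g \<equiv> inside (path_image Rt \<union> graph g)"

lemma J_props:
  shows "connected inJ" "open inJ" "bounded inJ" "connected outJ" "open outJ" "\<not> bounded outJ"
    "inJ \<inter> outJ = {}" "inJ \<union> outJ = - (path_image L \<union> path_image Rt)"
    "frontier outJ = path_image L \<union> path_image Rt"
proof -
  obtain g where g: "g \<in> chains" using chains_nonempty by blast
  show "connected inJ" "open inJ" "bounded inJ" "connected outJ" "open outJ" "\<not> bounded outJ"
    "inJ \<inter> outJ = {}" "inJ \<union> outJ = - (path_image L \<union> path_image Rt)"
    "frontier outJ = path_image L \<union> path_image Rt"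
    using Jordan_inside_outside[OF simple_paths(1)[OF g] loops(1)[OF g]] images(1)[OF g] by metis+
qed

lemma inL_props:
  assumes g: "g \<in> chains"
  shows "connected (inL g)" "open (inL g)" "bounded (inL g)" "inL g \<noteq> {}"
    "inL g \<inter> (path_image L \<union> graph g) = {}" "frontier (inL g) = path_image L \<union> graph g"
  using Jordan_inside_outside[OF simple_paths(2)[OF g] loops(2)[OF g]] images(2)[OF g]
    inside_no_overlap[of "path_image L \<union> graph g"] by metis+

lemma inR_props:
  assumes g: "g \<in> chains"
  shows "connected (inR g)" "open (inR g)" "bounded (inR g)" "inR g \<noteq> {}"
    "inR g \<inter> (path_image Rt \<union> graph g) = {}" "frontier (inR g) = path_image Rt \<union> graph g"
  using Jordan_inside_outside[OF simple_paths(3)[OF g] loops(3)[OF g]] images(3)[OF g]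
    inside_no_overlap[of "path_image Rt \<union> graph g"] Un_commute by metis+

lemma inside_iff_winding:
  assumes "simple_path c" "pathfinish c = pathstart c" "z \<notin> path_image c"
  shows "z \<in> inside (path_image c) \<longleftrightarrow> winding_number c z \<noteq> 0"
proof
  assume "z \<in> inside (path_image c)"
  then show "winding_number c z \<noteq> 0"
    using simple_closed_path_winding_number_inside[OF assms(1)] by (metis zero_neq_neg_one zero_neq_one)
next
  assume "winding_number c z \<noteq> 0"
  then have "z \<notin> outside (path_image c)"
    using winding_number_zero_in_outside assms simple_path_imp_path by blast
  then show "z \<in> inside (path_image c)"
    using assms(3) inside_Un_outside[of "path_image c"] by blast
qed

lemma inL_iff: "g \<in> chains \<Longrightarrow> z \<notin> path_image L \<Longrightarrow> z \<notin> graph g \<Longrightarrow> z \<in> inL g \<longleftrightarrow> WL g z \<noteq> 0"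
  using inside_iff_winding[OF simple_paths(2) loops(2), of g z] by (simp add: images WL_def)

lemma inR_iff: "g \<in> chains \<Longrightarrow> z \<notin> path_image Rt \<Longrightarrow> z \<notin> graph g \<Longrightarrow> z \<in> inR g \<longleftrightarrow> WR g z \<noteq> 0"
  using inside_iff_winding[OF simple_paths(3) loops(3), of g z] by (simp add: images WR_def Un_commute)

lemma hasse_inJ: assumes "d \<in> hasse" "y0 < Im d" "Im d < y1" shows "d \<in> inJ"
proof -
  obtain g where g: "g \<in> chains" using chains_nonempty by blast
  show ?thesis using inside_iff_winding[OF simple_paths(1)[OF g] loops(1)[OF g], of d] hasse_interior[OF assms]
    by (simp add: images[OF g])
qed

lemma hasse_strict: "d \<in> hasse \<Longrightarrow> d \<noteq> pos Bot \<Longrightarrow> d \<noteq> pos Top \<Longrightarrow> y0 < Im d \<and> Im d < y1"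
  using hasse_height[of d] hasse_y0[of d] hasse_y1[of d] by (metis order_le_less)

text \<open>The winding number is constant on the connected inside, so its value can be read off at
  one point of the Hasse diagram, where it is -1 by hypothesis. A point of a chain at middle height
  differs from both \<open>pos Bot\<close> and \<open>pos Top\<close>.\<close>

lemma total_inJ: assumes "z \<in> inJ" shows "winding_number (L +++ reversepath Rt) z = -1"
proof -
  obtain g where g: "g \<in> chains" using chains_nonempty by blast
  define d where "d = Complex (g ((y0 + y1) / 2)) ((y0 + y1) / 2)"
  have d: "d \<in> hasse" "y0 < Im d" "Im d < y1"
    using chain_hasse[OF g, of "(y0 + y1) / 2"] y01 by (auto simp: d_def)
  have "winding_number (L +++ reversepath Rt) constant_on inJ"
    by (rule winding_number_constant)
      (use simple_paths(1)[OF g] loops(1)[OF g] J_props images(1)[OF g] in \<open>auto simp: simple_path_imp_path\<close>)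
  then show ?thesis using hasse_inJ[OF d] hasse_interior(3)[OF d] assms unfolding constant_on_def by metis
qed

lemma outJ_drwg: "outJ \<inter> drwg = {}"
proof -
  have "d \<notin> outJ" if "d \<in> hasse" for d
  proof (cases "d = pos Bot \<or> d = pos Top")
    case True
    then show ?thesis using L_Rt J_props(8) by blast
  next
    case False
    then show ?thesis using hasse_inJ[OF that] hasse_strict[OF that] J_props(7) by blast
  qed
  then show ?thesis using J_props(8) unfolding drwg_eq by blast
qed

text \<open>The outside of the outer curve is connected, unbounded and free of the drawing; a face
  meeting it would contain it.\<close>

lemma faces_inJ: assumes "F \<in> faces" shows "F \<subseteq> inJ"
proof -
  note F = faces_props[OF assms]
  have "F \<inter> outJ = {}"
  proof (rule ccontr)
    assume "F \<inter> outJ \<noteq> {}"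
    then have "outJ \<subseteq> F" using faces_absorb[OF assms J_props(4) outJ_drwg] by blast
    then show False using F(5) J_props(6) bounded_subset by blast
  qed
  moreover have "F \<subseteq> inJ \<union> outJ" using F(3) unfolding J_props(8) drwg_eq by blast
  ultimately show ?thesis by blast
qed

text \<open>The three arcs \<open>L\<close>, \<open>Rt\<close> and the chain form a theta curve with
  common endpoints. The point of the chain at middle height shows that the chain runs through the
  inside of the outer curve.\<close>

lemma chain_split:
  assumes g: "g \<in> chains"
  shows "inL g \<inter> inR g = {}" "inL g \<union> inR g \<union> (graph g - {pos Bot, pos Top}) = inJ"
proof -
  have "path_image L \<inter> graph g \<subseteq> {pos Bot, pos Top}" "path_image Rt \<inter> graph g \<subseteq> {pos Bot, pos Top}"
    using graph_hasse[OF g] hasse_L hasse_Rt by blast+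
  moreover have "{pos Bot, pos Top} \<subseteq> path_image L \<inter> path_image Rt" using L_Rt by blast
  ultimately have int: "path_image L \<inter> path_image (chain_path g) = {pos Bot, pos Top}"
    "path_image Rt \<inter> path_image (chain_path g) = {pos Bot, pos Top}"
    unfolding path_image_chain_path using graph_ends[OF g] by blast+
  define d where "d = Complex (g ((y0 + y1) / 2)) ((y0 + y1) / 2)"
  have d: "d \<in> hasse" "y0 < Im d" "Im d < y1" "d \<in> graph g"
    using chain_hasse[OF g, of "(y0 + y1) / 2"] y01 by (auto simp: d_def graph_def)
  then have "path_image (chain_path g) \<inter> inJ \<noteq> {}" unfolding path_image_chain_path using hasse_inJ[OF d(1-3)] by blast
  from split_inside_simple_closed_curve[OF _ arc_LR(2,3) _ arc_LR(5,6) _ chain_path_ends[OF g] pos_BT L_Rt int this]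
  show "inL g \<inter> inR g = {}" "inL g \<union> inR g \<union> (graph g - {pos Bot, pos Top}) = inJ"
    using arc_LR arc_chain_path[OF g] unfolding path_image_chain_path by (auto simp: arc_imp_simple_path)
qed

lemma inL_inJ: "g \<in> chains \<Longrightarrow> inL g \<subseteq> inJ" and inR_inJ: "g \<in> chains \<Longrightarrow> inR g \<subseteq> inJ"
  using chain_split by blast+

lemma WL_WR:
  assumes g: "g \<in> chains" and z: "z \<in> inJ" "z \<notin> graph g"
  shows "WR g z = -1 - WL g z"
proof -
  have "z \<notin> path_image L" "z \<notin> path_image Rt" using z J_props(8) by blast+
  then have "winding_number L z - winding_number Rt z = -1" "WL g z = winding_number L z - winding_number (chain_path g) z"
    "WR g z = winding_number (chain_path g) z - winding_number Rt z"
    using total_inJ[OF z(1)] total_eq WL_eq[OF g] WR_eq[OF g] z(2) by auto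
  then show ?thesis by algebra
qed

section \<open>The extreme chains and the two outer faces\<close>

definition leftmost :: "real \<Rightarrow> real" where "leftmost = (SOME m. m \<in> chains \<and> (\<forall>g\<in>chains. \<forall>y. m y \<le> g y))"
definition rightmost :: "real \<Rightarrow> real" where "rightmost = (SOME m. m \<in> chains \<and> (\<forall>g\<in>chains. \<forall>y. g y \<le> m y))"

lemma leftmost: "leftmost \<in> chains" "g \<in> chains \<Longrightarrow> leftmost y \<le> g y"
proof -
  have "\<exists>m. m \<in> chains \<and> (\<forall>g\<in>chains. \<forall>y. m y \<le> g y)"
    using chains_nonempty least_chain[of _ "\<lambda>_. True"] by metis
  then have "leftmost \<in> chains \<and> (\<forall>g\<in>chains. \<forall>y. leftmost y \<le> g y)" unfolding leftmost_def by (rule someI_ex)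
  then show "leftmost \<in> chains" "g \<in> chains \<Longrightarrow> leftmost y \<le> g y" by auto
qed

lemma rightmost: "rightmost \<in> chains" "g \<in> chains \<Longrightarrow> g y \<le> rightmost y"
proof -
  have "\<exists>m. m \<in> chains \<and> (\<forall>g\<in>chains. \<forall>y. g y \<le> m y)"
    using chains_nonempty greatest_chain[of _ "\<lambda>_. True"] by metis
  then have "rightmost \<in> chains \<and> (\<forall>g\<in>chains. \<forall>y. g y \<le> rightmost y)" unfolding rightmost_def by (rule someI_ex)
  then show "rightmost \<in> chains" "g \<in> chains \<Longrightarrow> g y \<le> rightmost y" by auto
qed

lemma hasse_leftmost: assumes "d \<in> hasse" "d \<notin> graph leftmost" shows "rightof leftmost d" "y0 < Im d" "Im d < y1"
proof -
  obtain g where g: "g \<in> chains" "g (Im d) = Re d" using chain_point[OF assms(1)] by blast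
  then show "rightof leftmost d" using leftmost(2)[OF g(1), of "Im d"] assms(2) hasse_height[OF assms(1)]
    by (auto simp: rightof_def graph_def)
  show "y0 < Im d" "Im d < y1" using hasse_strict[OF assms(1)] assms graph_ends[OF leftmost(1)] by auto
qed

lemma hasse_rightmost: assumes "d \<in> hasse" "d \<notin> graph rightmost" shows "leftof rightmost d" "y0 < Im d" "Im d < y1"
proof -
  obtain g where g: "g \<in> chains" "g (Im d) = Re d" using chain_point[OF assms(1)] by blast
  then show "leftof rightmost d" using rightmost(2)[OF g(1), of "Im d"] assms(2) hasse_height[OF assms(1)]
    by (auto simp: leftof_def graph_def)
  show "y0 < Im d" "Im d < y1" using hasse_strict[OF assms(1)] assms graph_ends[OF rightmost(1)] by auto
qed

text \<open>A Hasse point \<open>d\<close> off the leftmost chain lies to its right, where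
  \<open>WL leftmost d = HL d + 1 = 0\<close>; so it is not enclosed. Thus the inside contains no
  part of the drawing while its frontier belongs to the drawing.\<close>

lemma inL_leftmost_faces: "inL leftmost \<in> faces"
proof -
  have "d \<notin> inL leftmost" if d: "d \<in> hasse" for d
  proof (cases "d \<in> graph leftmost")
    case False
    note r = hasse_leftmost[OF d False]
    have "WL leftmost d = 0" using WL_right[OF leftmost(1) r(1) hasse_interior(1)[OF d r(2,3)] r(2,3)] H_near(1)[OF d r(2,3)] by simp
    then show ?thesis using inL_iff[OF leftmost(1) hasse_interior(1)[OF d r(2,3)] False] by simp
  qed (use inL_props(5)[OF leftmost(1)] in blast)
  moreover have "inL leftmost \<inter> path_image Rt = {}" using inL_inJ[OF leftmost(1)] J_props(8) by blast
  ultimately have "inL leftmost \<inter> drwg = {}" unfolding drwg_eq using inL_props(5)[OF leftmost(1)] by blast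
  moreover have "frontier (inL leftmost) \<subseteq> drwg" unfolding inL_props(6)[OF leftmost(1)] drwg_eq using graph_hasse[OF leftmost(1)] by blast
  ultimately show ?thesis unfolding bfaces_def using component_of_open inL_props[OF leftmost(1)] by blast
qed

text \<open>The mirror image: left of the rightmost chain \<open>WR rightmost d = HR d = 0\<close>.
  No shift by one occurs, since \<open>HR\<close> is the value on the left side of a chain.\<close>

lemma inR_rightmost_faces: "inR rightmost \<in> faces"
proof -
  have "d \<notin> inR rightmost" if d: "d \<in> hasse" for d
  proof (cases "d \<in> graph rightmost")
    case False
    note r = hasse_rightmost[OF d False]
    have "WR rightmost d = 0" using WR_left[OF rightmost(1) r(1) hasse_interior(2)[OF d r(2,3)]] H_near(4)[OF d r(2,3)] by simp
    then show ?thesis using inR_iff[OF rightmost(1) hasse_interior(2)[OF d r(2,3)] False] by simp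
  qed (use inR_props(5)[OF rightmost(1)] in blast)
  moreover have "inR rightmost \<inter> path_image L = {}" using inR_inJ[OF rightmost(1)] J_props(8) by blast
  ultimately have "inR rightmost \<inter> drwg = {}" unfolding drwg_eq using inR_props(5)[OF rightmost(1)] by blast
  moreover have "frontier (inR rightmost) \<subseteq> drwg" unfolding inR_props(6)[OF rightmost(1)] drwg_eq using graph_hasse[OF rightmost(1)] by blast
  ultimately show ?thesis unfolding bfaces_def using component_of_open inR_props[OF rightmost(1)] by blast
qed

lemma arc_mid:
  assumes "arc c" shows "c (1/2) \<in> path_image c" "c (1/2) \<noteq> pathstart c" "c (1/2) \<noteq> pathfinish c"
  using assms inj_onD[of c "{0..1}" "1/2" 0] inj_onD[of c "{0..1}" "1/2" 1]
  by (auto simp: arc_def path_image_def pathstart_def pathfinish_def)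

lemma mid_LR:
  shows "L (1/2) \<in> path_image L" "L (1/2) \<notin> path_image Rt" "L (1/2) \<notin> hasse"
    "Rt (1/2) \<in> path_image Rt" "Rt (1/2) \<notin> path_image L" "Rt (1/2) \<notin> hasse"
proof -
  show L: "L (1/2) \<in> path_image L" and Rt: "Rt (1/2) \<in> path_image Rt" using arc_mid arc_LR by blast+
  have "L (1/2) \<noteq> pos Bot" "L (1/2) \<noteq> pos Top" "Rt (1/2) \<noteq> pos Bot" "Rt (1/2) \<noteq> pos Top"
    using arc_mid[OF arc_LR(1)] arc_mid[OF arc_LR(4)] arc_LR by metis+
  then show "L (1/2) \<notin> path_image Rt" "L (1/2) \<notin> hasse" "Rt (1/2) \<notin> path_image L" "Rt (1/2) \<notin> hasse"
    using L Rt hasse_L hasse_Rt L_Rt by blast+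
qed

text \<open>Any other face lies in \<open>inR leftmost\<close>, whose closure adds only the right
  edge and the leftmost chain and so misses the midpoint of the left edge.\<close>

lemma FL_eq: "FL P R pos crv = inL leftmost"
  unfolding FL_def
proof (rule the_equality)
  show "inL leftmost \<in> faces \<and> L (1/2) \<in> frontier (inL leftmost)"
    using inL_leftmost_faces mid_LR(1) inL_props(6)[OF leftmost(1)] by blast
next
  fix F assume F: "F \<in> faces \<and> L (1/2) \<in> frontier F"
  show "F = inL leftmost"
  proof (rule ccontr)
    assume "F \<noteq> inL leftmost"
    then have "F \<inter> inL leftmost = {}" using faces_disjoint F inL_leftmost_faces by blast
    moreover have "F \<inter> graph leftmost = {}" using faces_props(3) F graph_hasse[OF leftmost(1)] unfolding drwg_eq by blast
    ultimately have "F \<subseteq> inR leftmost" using faces_inJ F chain_split(2)[OF leftmost(1)] by blast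
    then have "closure F \<subseteq> inR leftmost \<union> (path_image Rt \<union> graph leftmost)"
      using closure_mono closure_Un_frontier[of "inR leftmost"] inR_props(6)[OF leftmost(1)] by metis
    then have "L (1/2) \<in> inR leftmost \<union> (path_image Rt \<union> graph leftmost)" using F unfolding frontier_def by blast
    then have "L (1/2) \<in> inJ" using mid_LR graph_hasse[OF leftmost(1)] inR_inJ[OF leftmost(1)] by blast
    then show False using mid_LR(1) J_props(8) by blast
  qed
qed

lemma FR_eq: "FR P R pos crv = inR rightmost"
  unfolding FR_def
proof (rule the_equality)
  show "inR rightmost \<in> faces \<and> Rt (1/2) \<in> frontier (inR rightmost)"
    using inR_rightmost_faces mid_LR(4) inR_props(6)[OF rightmost(1)] by blast
next
  fix F assume F: "F \<in> faces \<and> Rt (1/2) \<in> frontier F"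
  show "F = inR rightmost"
  proof (rule ccontr)
    assume "F \<noteq> inR rightmost"
    then have "F \<inter> inR rightmost = {}" using faces_disjoint F inR_rightmost_faces by blast
    moreover have "F \<inter> graph rightmost = {}" using faces_props(3) F graph_hasse[OF rightmost(1)] unfolding drwg_eq by blast
    ultimately have "F \<subseteq> inL rightmost" using faces_inJ F chain_split(2)[OF rightmost(1)] by blast
    then have "closure F \<subseteq> inL rightmost \<union> (path_image L \<union> graph rightmost)"
      using closure_mono closure_Un_frontier[of "inL rightmost"] inL_props(6)[OF rightmost(1)] by metis
    then have "Rt (1/2) \<in> inL rightmost \<union> (path_image L \<union> graph rightmost)" using F unfolding frontier_def by blast
    then have "Rt (1/2) \<in> inJ" using mid_LR graph_hasse[OF rightmost(1)] inL_inJ[OF rightmost(1)] by blast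
    then show False using mid_LR(4) J_props(8) by blast
  qed
qed

section \<open>The faces adjacent to an edge\<close>

text \<open>\<open>\<sigma> = 1\<close> looks to the right of an edge and \<open>\<sigma> = -1\<close> to the left.\<close>

definition side :: "real \<Rightarrow> complex set \<Rightarrow> 'p ext \<times> 'p ext \<Rightarrow> bool" where
  "side \<sigma> F e \<longleftrightarrow> (\<exists>t\<in>{0<..<1}. \<exists>\<epsilon>>0. \<forall>\<delta>. 0 < \<delta> \<and> \<delta> < \<epsilon> \<longrightarrow>
     crv (HE (fst e) (snd e)) t + of_real (\<sigma> * \<delta>) \<in> F)"

text \<open>The same condition at a prescribed parameter. That the parameter is immaterial for faces
  is shown in the lemma \<open>side_at\<close>; afterwards the parameter 1/2 is used
  throughout.\<close>

definition side_at :: "real \<Rightarrow> complex set \<Rightarrow> 'p ext \<times> 'p ext \<Rightarrow> real \<Rightarrow> bool" where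
  "side_at \<sigma> F e t \<longleftrightarrow> (\<forall>\<^sub>F \<delta> in at_right 0. crv (HE (fst e) (snd e)) t + of_real (\<sigma> * \<delta>) \<in> F)"

lemma side_iff: "side \<sigma> F e \<longleftrightarrow> (\<exists>t\<in>{0<..<1}. side_at \<sigma> F e t)"
  by (simp add: side_def side_at_def eventually_at_right_field imp_conjL)

text \<open>The Hasse edges of the left boundary of \<open>F\<close>. Their right side is the one
  facing \<open>F\<close>, hence the sign 1; for \<open>Rs\<close> it is the reverse.\<close>

definition Ls :: "complex set \<Rightarrow> ('p ext \<times> 'p ext) set" where
  "Ls F = {e \<in> E. side 1 F e}"

definition Rs :: "complex set \<Rightarrow> ('p ext \<times> 'p ext) set" where
  "Rs F = {e \<in> E. side (-1) F e}"

lemma onL_HE: "onL P R pos crv F (HE p q) \<longleftrightarrow> side 1 F (p, q)"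
  and onR_HE: "onR P R pos crv F (HE p q) \<longleftrightarrow> side (-1) F (p, q)"
  by (simp_all add: side_def)

lemma edge_point:
  assumes "(p, q) \<in> E" "t \<in> {0<..<1}"
  defines "d \<equiv> crv (HE p q) t"
  shows "d \<in> hasse" "y0 < Im d" "Im d < y1" "Im d \<in> {Y p<..<Y q}" "Re d = edge_x (p, q) (Im d)" "d \<in> img (p, q)"
proof -
  show i: "d \<in> img (p, q)" using assms by (auto simp: img_def path_image_def)
  then show "d \<in> hasse" using img_hasse assms(1) by blast
  show I: "Im d \<in> {Y p<..<Y q}" using Im_crv_strict assms by blast
  then show "y0 < Im d" "Im d < y1" using Y_bounds[OF E_V(1)[OF assms(1)]] Y_bounds[OF E_V(2)[OF assms(1)]] by auto
  show "Re d = edge_x (p, q) (Im d)" using edge_x_crv[OF assms(1), of t] assms(2) by (simp add: d_def)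
qed

text \<open>A compact piece of the open edge has positive distance from the rest of the drawing, so
  small horizontal translates miss that rest. They miss the edge itself because it has only one
  point at each height.\<close>

lemma strip_avoids:
  assumes e: "(p, q) \<in> E" and t: "0 < t1" "t1 \<le> t2" "t2 < 1" and \<sigma>: "\<sigma> = 1 \<or> \<sigma> = (-1 :: real)"
  obtains \<epsilon> where "\<epsilon> > 0" "\<And>\<delta> t. 0 < \<delta> \<Longrightarrow> \<delta> < \<epsilon> \<Longrightarrow> t \<in> {t1..t2} \<Longrightarrow> crv (HE p q) t + of_real (\<sigma> * \<delta>) \<notin> drwg"
proof -
  let ?K = "(\<Union>e\<in>E - {(p, q)}. img e) \<union> path_image L \<union> path_image Rt"
  let ?S = "crv (HE p q) ` {t1..t2}"
  have "compact (\<Union>e\<in>E - {(p, q)}. img e)" by (rule compact_UN) (auto simp: compact_img)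
  then have K: "closed ?K" using path_LR by (intro closed_Un compact_imp_closed compact_path_image) auto
  have "continuous_on {t1..t2} (crv (HE p q))"
    using arc_HE(1)[OF e] t by (auto simp: arc_def path_def intro: continuous_on_subset)
  then have S: "compact ?S" by (intro compact_continuous_image) auto
  have "?S \<inter> ?K = {}"
  proof -
    have "crv (HE p q) s \<notin> ?K" if s: "s \<in> {t1..t2}" for s
    proof -
      have s': "s \<in> {0<..<1}" using s t by auto
      note d = edge_point[OF e s']
      have eq: "Complex (edge_x (p, q) (Im (crv (HE p q) s))) (Im (crv (HE p q) s)) = crv (HE p q) s"
        using d(5) by (simp add: complex_eq_iff)
      have "crv (HE p q) s \<notin> img e'" if "e' \<in> E - {(p, q)}" for e'
        using edge_interior_unique[OF e d(4), of e'] that unfolding eq by blast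
      then show ?thesis using hasse_interior(1,2)[OF d(1-3)] by blast
    qed
    then show ?thesis by blast
  qed
  then obtain \<epsilon> where \<epsilon>: "\<epsilon> > 0" "\<And>x y. x \<in> ?S \<Longrightarrow> y \<in> ?K \<Longrightarrow> \<epsilon> \<le> dist x y"
    using separate_compact_closed[OF S K] by blast
  show ?thesis
  proof (rule that[OF \<epsilon>(1)])
    fix \<delta> s assume \<delta>: "0 < \<delta>" "\<delta> < \<epsilon>" and s: "s \<in> {t1..t2}"
    let ?z = "crv (HE p q) s + of_real (\<sigma> * \<delta>)"
    have s': "s \<in> {0<..<1}" using s t by auto
    have "dist (crv (HE p q) s) ?z = \<delta>" using \<sigma> \<delta> by (auto simp: dist_norm)
    then have "?z \<notin> ?K" using \<epsilon>(2)[of "crv (HE p q) s" ?z] \<delta> s by auto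
    moreover have "?z \<notin> img (p, q)"
      using edge_point(5)[OF e s'] \<sigma> \<delta> by (auto simp: img_eq[OF e] complex_eq_iff)
    ultimately show "?z \<notin> drwg" unfolding drwg_eq hasse_def by blast
  qed
qed

text \<open>The two faces may be witnessed at different parameters \<open>t\<close> and
  \<open>t'\<close>. A small translate of the piece of the edge between them is connected, avoids
  the drawing and meets both faces.\<close>

lemma side_unique:
  assumes e: "e \<in> E" and \<sigma>: "\<sigma> = 1 \<or> \<sigma> = (-1 :: real)" and F: "F \<in> faces" "F' \<in> faces" "side \<sigma> F e" "side \<sigma> F' e"
  shows "F = F'"
proof -
  obtain p q where pq: "e = (p, q)" by (cases e)
  have E: "(p, q) \<in> E" using e pq by simp
  obtain t \<eta> where t: "t \<in> {0<..<1}" "\<eta> > 0" "\<And>\<delta>. 0 < \<delta> \<Longrightarrow> \<delta> < \<eta> \<Longrightarrow> crv (HE p q) t + of_real (\<sigma> * \<delta>) \<in> F"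
    using F(3) unfolding side_def pq fst_conv snd_conv by blast
  obtain t' \<eta>' where t': "t' \<in> {0<..<1}" "\<eta>' > 0" "\<And>\<delta>. 0 < \<delta> \<Longrightarrow> \<delta> < \<eta>' \<Longrightarrow> crv (HE p q) t' + of_real (\<sigma> * \<delta>) \<in> F'"
    using F(4) unfolding side_def pq fst_conv snd_conv by blast
  have tt: "0 < min t t'" "min t t' \<le> max t t'" "max t t' < 1" using t(1) t'(1) by (auto simp: min_def max_def)
  obtain \<epsilon> where \<epsilon>: "\<epsilon> > 0" "\<And>\<delta> s. 0 < \<delta> \<Longrightarrow> \<delta> < \<epsilon> \<Longrightarrow> s \<in> {min t t'..max t t'} \<Longrightarrow>
      crv (HE p q) s + of_real (\<sigma> * \<delta>) \<notin> drwg"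
    using strip_avoids[OF E tt \<sigma>] by blast
  define \<delta> where "\<delta> = min \<epsilon> (min \<eta> \<eta>') / 2"
  have \<delta>: "0 < \<delta>" "\<delta> < \<epsilon>" "\<delta> < \<eta>" "\<delta> < \<eta>'" using \<epsilon>(1) t(2) t'(2) by (auto simp: \<delta>_def)
  let ?T = "(\<lambda>s. crv (HE p q) s + of_real (\<sigma> * \<delta>)) ` {min t t'..max t t'}"
  have "{min t t'..max t t'} \<subseteq> {0..1}" using tt unfolding atLeastatMost_subset_iff by linarith
  then have "continuous_on {min t t'..max t t'} (crv (HE p q))"
    using arc_HE(1)[OF E] continuous_on_subset unfolding arc_def path_def by blast
  then have T: "connected ?T" by (intro connected_continuous_image continuous_intros) auto
  have Td: "?T \<inter> drwg = {}" using \<epsilon>(2)[OF \<delta>(1,2)] by blast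
  have "t \<in> {min t t'..max t t'}" "t' \<in> {min t t'..max t t'}" by auto
  then have "F \<inter> ?T \<noteq> {}" "F' \<inter> ?T \<noteq> {}" using t(3)[OF \<delta>(1,3)] t'(3)[OF \<delta>(1,4)] by blast+
  then show ?thesis using faces_absorb[OF F(1) T Td] faces_absorb[OF F(2) T Td] faces_disjoint[OF F(1,2)] by blast
qed

text \<open>A short horizontal segment issuing from the edge avoids the drawing and stays inside the
  outer curve. Its component cannot cross that curve, so it is bounded and is a face.\<close>

lemma side_exists:
  assumes e: "e \<in> E" and \<sigma>: "\<sigma> = 1 \<or> \<sigma> = (-1 :: real)" and t: "t \<in> {0<..<1}"
  shows "\<exists>F\<in>faces. side_at \<sigma> F e t"
proof -
  obtain p q where pq: "e = (p, q)" by (cases e)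
  have E: "(p, q) \<in> E" using e pq by simp
  let ?d = "crv (HE p q) t"
  have "?d \<in> inJ" using hasse_inJ edge_point[OF E t] by blast
  then obtain \<eta> where \<eta>: "\<eta> > 0" "ball ?d \<eta> \<subseteq> inJ" using J_props(2) openE by blast
  obtain \<epsilon> where \<epsilon>: "\<epsilon> > 0" "\<And>\<delta> s. 0 < \<delta> \<Longrightarrow> \<delta> < \<epsilon> \<Longrightarrow> s \<in> {t..t} \<Longrightarrow> crv (HE p q) s + of_real (\<sigma> * \<delta>) \<notin> drwg"
    using strip_avoids[OF E _ _ _ \<sigma>, of t t] t by auto
  define r where "r = min \<epsilon> \<eta>"
  have r: "0 < r" using \<epsilon> \<eta> by (simp add: r_def)
  let ?T = "(\<lambda>\<delta>. ?d + of_real (\<sigma> * \<delta>)) ` {0<..<r}"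
  have T: "connected ?T" by (intro connected_continuous_image continuous_intros) auto
  have Td: "?T \<subseteq> - drwg" using \<epsilon>(2)[of _ "t"] by (auto simp: r_def)
  have TJ: "?T \<subseteq> inJ"
  proof -
    have "?d + of_real (\<sigma> * \<delta>) \<in> ball ?d \<eta>" if "\<delta> \<in> {0<..<r}" for \<delta>
      using that \<sigma> by (auto simp: dist_norm r_def)
    then show ?thesis using \<eta>(2) by blast
  qed
  have Tne: "?T \<noteq> {}" using r by auto
  then have "- drwg \<noteq> {}" using Td by blast
  then obtain F where F: "F \<in> components (- drwg)" "?T \<subseteq> F" using exists_component_superset[OF Td _ T] by blast
  have "F \<inter> outJ = {}"
  proof (rule ccontr)
    assume "F \<inter> outJ \<noteq> {}"
    moreover have "F \<inter> inJ \<noteq> {}" using TJ F(2) Tne by blast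
    moreover have "F \<subseteq> inJ \<union> outJ" using F(1) in_components_subset unfolding J_props(8) drwg_eq by blast
    ultimately show False
      using connectedD[OF in_components_connected[OF F(1)] J_props(2) J_props(5)] J_props(7) by blast
  qed
  then have "F \<subseteq> inJ" using F(1) in_components_subset J_props(8) unfolding drwg_eq by blast
  then have "bounded F" using J_props(3) bounded_subset by blast
  then have "F \<in> faces" using F(1) by (simp add: bfaces_def)
  moreover have "side_at \<sigma> F e t"
    unfolding side_at_def pq fst_conv snd_conv eventually_at_right_field
  proof (intro exI[of _ r] conjI allI impI)
    show "?d + of_real (\<sigma> * \<delta>) \<in> F" if "0 < \<delta>" "\<delta> < r" for \<delta>
      using F(2) that by (metis greaterThanLessThan_iff image_subset_iff)
  qed (rule r)
  ultimately show ?thesis by blast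
qed

text \<open>Some face lies on the given side at the prescribed \<open>t\<close>; by uniqueness it is
  \<open>F\<close>.\<close>

lemma side_at:
  assumes "e \<in> E" "\<sigma> = 1 \<or> \<sigma> = (-1 :: real)" "t \<in> {0<..<1}" "F \<in> faces"
  shows "side \<sigma> F e \<longleftrightarrow> side_at \<sigma> F e t"
proof
  assume "side \<sigma> F e"
  then show "side_at \<sigma> F e t"
    using side_exists[OF assms(1-3)] side_unique[OF assms(1,2,4)] assms(3) side_iff by metis
qed (use assms(3) side_iff in blast)

lemma half: "(1/2 :: real) \<in> {0<..<1}"
  by simp

lemma Rface: assumes "e \<in> E"
  shows "Rface P R pos crv (HE (fst e) (snd e)) \<in> faces"
    and "F \<in> faces \<Longrightarrow> Rface P R pos crv (HE (fst e) (snd e)) = F \<longleftrightarrow> e \<in> Ls F"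
proof -
  have "\<exists>!F. F \<in> faces \<and> onL P R pos crv F (HE (fst e) (snd e))"
    unfolding onL_HE prod.collapse using side_exists[OF assms, of 1 "1/2"] side_iff side_unique[OF assms, of 1] half by blast
  from theI'[OF this, folded Rface_def] have *: "Rface P R pos crv (HE (fst e) (snd e)) \<in> faces"
    "side 1 (Rface P R pos crv (HE (fst e) (snd e))) e"
    unfolding onL_HE prod.collapse by auto
  then show "Rface P R pos crv (HE (fst e) (snd e)) \<in> faces" by simp
  show "Rface P R pos crv (HE (fst e) (snd e)) = F \<longleftrightarrow> e \<in> Ls F" if "F \<in> faces"
    using * that side_unique[OF assms, of 1] assms by (auto simp: Ls_def)
qed

lemma Lface: assumes "e \<in> E"
  shows "Lface P R pos crv (HE (fst e) (snd e)) \<in> faces"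
    and "F \<in> faces \<Longrightarrow> Lface P R pos crv (HE (fst e) (snd e)) = F \<longleftrightarrow> e \<in> Rs F"
proof -
  have "\<exists>!F. F \<in> faces \<and> onR P R pos crv F (HE (fst e) (snd e))"
    unfolding onR_HE prod.collapse using side_exists[OF assms, of "-1" "1/2"] side_iff side_unique[OF assms, of "-1"] half by blast
  from theI'[OF this, folded Lface_def] have *: "Lface P R pos crv (HE (fst e) (snd e)) \<in> faces"
    "side (-1) (Lface P R pos crv (HE (fst e) (snd e))) e"
    unfolding onR_HE prod.collapse by auto
  then show "Lface P R pos crv (HE (fst e) (snd e)) \<in> faces" by simp
  show "Lface P R pos crv (HE (fst e) (snd e)) = F \<longleftrightarrow> e \<in> Rs F" if "F \<in> faces"
    using * that side_unique[OF assms, of "-1"] assms by (auto simp: Rs_def)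
qed

end

section \<open>Inner faces as cells between two chains\<close>

text \<open>The supremum \<open>a\<close> of the points with \<open>u\<close> at most 0 has
  \<open>u a\<close> at most 0; a negative value would produce a zero further right by the
  intermediate value theorem. For \<open>u\<close> the gap between two chains, this finds their last
  meeting below a given height.\<close>

lemma last_zero:
  fixes u :: "real \<Rightarrow> real"
  assumes "continuous_on {c..x} u" "u c = 0" "u x > 0" "c \<le> x"
  obtains a where "c \<le> a" "a < x" "u a = 0" "\<And>y. a < y \<Longrightarrow> y \<le> x \<Longrightarrow> u y > 0"
proof -
  let ?S = "{y \<in> {c..x}. u y \<le> 0}"
  have cl: "closed ?S" using assms(1) by (intro continuous_on_closed_Collect_le continuous_intros) auto
  have bdd: "bdd_above ?S" by (rule bdd_aboveI[of _ x]) auto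
  have a: "Sup ?S \<in> ?S" by (rule closed_contains_Sup[OF _ bdd cl]) (use assms in auto)
  define a where "a = Sup ?S"
  have pos: "u y > 0" if "a < y" "y \<le> x" for y
    using cSup_upper[OF _ bdd, of y] that a unfolding a_def[symmetric] by force
  have ax: "c \<le> a" "a \<le> x" "u a \<le> 0" using a unfolding a_def[symmetric] by auto
  have "u a = 0"
  proof (rule ccontr)
    assume "u a \<noteq> 0"
    have "\<exists>y\<ge>a. y \<le> x \<and> u y = 0"
      using ax assms by (intro IVT') (auto intro: continuous_on_subset)
    then obtain y where "a \<le> y" "y \<le> x" "u y = 0" by blast
    then show False using pos[of y] \<open>u a \<noteq> 0\<close> by (cases "y = a") auto
  qed
  moreover have "a < x" using ax assms(3) by (cases "a = x") auto
  ultimately show ?thesis using that ax pos by blast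
qed

lemma first_zero:
  fixes u :: "real \<Rightarrow> real"
  assumes "continuous_on {x..c} u" "u c = 0" "u x > 0" "x \<le> c"
  obtains a where "a \<le> c" "x < a" "u a = 0" "\<And>y. x \<le> y \<Longrightarrow> y < a \<Longrightarrow> u y > 0"
proof -
  have "continuous_on {- c..- x} (\<lambda>y. u (- y))"
    by (rule continuous_on_compose2[OF assms(1)]) (auto intro!: continuous_intros)
  then obtain a where "- c \<le> a" "a < - x" "u (- a) = 0" "\<And>y. a < y \<Longrightarrow> y \<le> - x \<Longrightarrow> u (- y) > 0"
    using last_zero[of "- c" "- x" "\<lambda>y. u (- y)"] assms by auto
  then show ?thesis using that[of "- a"] by (metis minus_less_iff minus_minus neg_le_iff_le minus_le_iff)
qed

definition cell :: "(real \<Rightarrow> real) \<Rightarrow> (real \<Rightarrow> real) \<Rightarrow> real \<Rightarrow> real \<Rightarrow> complex set" where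
  "cell m M a b = {z. a < Im z \<and> Im z < b \<and> m (Im z) < Re z \<and> Re z < M (Im z)}"

text \<open>Connectedness comes from writing the cell as the continuous image of a rectangle,
  interpolating linearly between \<open>m\<close> and \<open>M\<close> at each height. The closure
  is bounded by the weak inequalities, and these force equality with \<open>m\<close> or
  \<open>M\<close> off the open cell.\<close>

lemma cell_props:
  assumes cont: "continuous_on {a..b} m" "continuous_on {a..b} M"
    and ab: "a < b" "m a = M a" "m b = M b" and lt: "\<And>y. a < y \<Longrightarrow> y < b \<Longrightarrow> m y < M y"
  shows "open (cell m M a b)" "connected (cell m M a b)"
    and "frontier (cell m M a b) \<subseteq> {z. a \<le> Im z \<and> Im z \<le> b \<and> (Re z = m (Im z) \<or> Re z = M (Im z))}"
    and "Complex (m a) a \<in> frontier (cell m M a b)" "Complex (m b) b \<in> frontier (cell m M a b)"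
proof -
  let ?K = "cell m M a b"
  have lb: "closed {z. Im z \<in> {a..b}}" "open {z. Im z \<in> {a<..<b}}"
    by (auto intro!: closed_Collect_conj open_Collect_conj closed_Collect_le open_Collect_less continuous_intros)
  have cu: "continuous_on {z. Im z \<in> {a..b}} (\<lambda>z. m (Im z))" "continuous_on {z. Im z \<in> {a..b}} (\<lambda>z. M (Im z))"
    by (rule continuous_on_compose2[OF cont(1)] continuous_on_compose2[OF cont(2)]; auto intro!: continuous_intros)+
  have co: "continuous_on {z. Im z \<in> {a<..<b}} (\<lambda>z. Re z - m (Im z))" "continuous_on {z. Im z \<in> {a<..<b}} (\<lambda>z. M (Im z) - Re z)"
    by (intro continuous_intros continuous_on_subset[OF cu(1)] continuous_on_subset[OF cu(2)]; auto)+
  have "open ({z. Im z \<in> {a<..<b}} \<inter> (\<lambda>z. Re z - m (Im z)) -` {0<..})"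
    "open ({z. Im z \<in> {a<..<b}} \<inter> (\<lambda>z. M (Im z) - Re z) -` {0<..})"
    by (rule continuous_open_preimage[OF co(1) lb(2)] continuous_open_preimage[OF co(2) lb(2)]; simp)+
  then have "open (({z. Im z \<in> {a<..<b}} \<inter> (\<lambda>z. Re z - m (Im z)) -` {0<..}) \<inter>
      ({z. Im z \<in> {a<..<b}} \<inter> (\<lambda>z. M (Im z) - Re z) -` {0<..}))" by (rule open_Int)
  also have "\<dots> = ?K" by (auto simp: cell_def)
  finally show op: "open ?K" .
  let ?\<phi> = "\<lambda>(y, s). Complex ((1 - s) * m y + s * M y) y"
  have "?K = ?\<phi> ` ({a<..<b} \<times> {0<..<1})"
  proof
    show "?K \<subseteq> ?\<phi> ` ({a<..<b} \<times> {0<..<1})"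
    proof
      fix z assume z: "z \<in> ?K"
      define s where "s = (Re z - m (Im z)) / (M (Im z) - m (Im z))"
      have d: "M (Im z) - m (Im z) > 0" using z by (auto simp: cell_def)
      have "s \<in> {0<..<1}" using z d by (auto simp: s_def cell_def field_simps)
      moreover have "s * (M (Im z) - m (Im z)) = Re z - m (Im z)" using d by (simp add: s_def)
      then have "z = ?\<phi> (Im z, s)" by (simp add: complex_eq_iff algebra_simps)
      moreover have "Im z \<in> {a<..<b}" using z by (auto simp: cell_def)
      ultimately show "z \<in> ?\<phi> ` ({a<..<b} \<times> {0<..<1})" by blast
    qed
    show "?\<phi> ` ({a<..<b} \<times> {0<..<1}) \<subseteq> ?K"
    proof clarify
      fix y s :: real assume ys: "y \<in> {a<..<b}" "s \<in> {0<..<1}"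
      then have d: "M y - m y > 0" using lt by auto
      have "(1 - s) * m y + s * M y = m y + s * (M y - m y)" "(1 - s) * m y + s * M y = M y - (1 - s) * (M y - m y)"
        by (simp_all add: algebra_simps)
      moreover have "s * (M y - m y) > 0" "(1 - s) * (M y - m y) > 0" using ys d by auto
      ultimately show "Complex ((1 - s) * m y + s * M y) y \<in> ?K" using ys by (simp add: cell_def)
    qed
  qed
  moreover have "connected (?\<phi> ` ({a<..<b} \<times> {0<..<1}))"
  proof (rule connected_continuous_image)
    have "continuous_on ({a<..<b} \<times> {0<..<1::real}) (\<lambda>p. m (fst p))" "continuous_on ({a<..<b} \<times> {0<..<1::real}) (\<lambda>p. M (fst p))"
      by (rule continuous_on_compose2[OF cont(1)] continuous_on_compose2[OF cont(2)]; auto intro!: continuous_intros)+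
    then show "continuous_on ({a<..<b} \<times> {0<..<1}) ?\<phi>"
      unfolding case_prod_beta complex_eq by (intro continuous_intros)
    show "connected ({a<..<b} \<times> {0<..<1::real})" by (intro connected_Times) auto
  qed
  ultimately show "connected ?K" by simp
  let ?C = "{z. Im z \<in> {a..b}} \<inter> {z. m (Im z) \<le> Re z \<and> Re z \<le> M (Im z)}"
  have "closed {z \<in> {z. Im z \<in> {a..b}}. m (Im z) \<le> Re z}" "closed {z \<in> {z. Im z \<in> {a..b}}. Re z \<le> M (Im z)}"
    by (intro continuous_on_closed_Collect_le cu lb continuous_intros)+
  then have "closed ({z \<in> {z. Im z \<in> {a..b}}. m (Im z) \<le> Re z} \<inter> {z \<in> {z. Im z \<in> {a..b}}. Re z \<le> M (Im z)})"
    by (rule closed_Int)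
  moreover have "?K \<subseteq> {z \<in> {z. Im z \<in> {a..b}}. m (Im z) \<le> Re z} \<inter> {z \<in> {z. Im z \<in> {a..b}}. Re z \<le> M (Im z)}"
    by (auto simp: cell_def)
  ultimately have cl: "closure ?K \<subseteq> {z \<in> {z. Im z \<in> {a..b}}. m (Im z) \<le> Re z} \<inter> {z \<in> {z. Im z \<in> {a..b}}. Re z \<le> M (Im z)}"
    by (rule closure_minimal[rotated])
  have fr: "frontier ?K = closure ?K - ?K" using op by (simp add: frontier_def interior_open)
  show "frontier ?K \<subseteq> {z. a \<le> Im z \<and> Im z \<le> b \<and> (Re z = m (Im z) \<or> Re z = M (Im z))}"
  proof
    fix z assume "z \<in> frontier ?K"
    then have z: "a \<le> Im z" "Im z \<le> b" "m (Im z) \<le> Re z" "Re z \<le> M (Im z)" "z \<notin> ?K" using cl fr by auto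
    consider "Im z = a" | "Im z = b" | "a < Im z" "Im z < b" using z by linarith
    then show "z \<in> {z. a \<le> Im z \<and> Im z \<le> b \<and> (Re z = m (Im z) \<or> Re z = M (Im z))}"
      by cases (use z ab in \<open>auto simp: cell_def\<close>)
  qed
  \<comment> \<open>The middle line stays in the cell at inner heights and runs into the two
    corners, where \<open>m\<close> and \<open>M\<close> agree.\<close>
  let ?\<psi> = "\<lambda>y. Complex ((m y + M y) / 2) y"
  have "continuous_on {a..b} ?\<psi>" unfolding complex_eq by (intro continuous_intros cont) auto
  then have "?\<psi> ` closure {a<..<b} \<subseteq> closure ?K"
    by (intro image_closure_subset) (use ab lt closure_subset in \<open>auto simp: cell_def intro!: subsetD[OF closure_subset]\<close>)
  then have sub: "?\<psi> ` {a..b} \<subseteq> closure ?K" using ab by simp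
  have "?\<psi> a \<in> closure ?K" by (rule subsetD[OF sub], rule imageI) (use ab in simp)
  moreover have "?\<psi> b \<in> closure ?K" by (rule subsetD[OF sub], rule imageI) (use ab in simp)
  moreover have "?\<psi> a = Complex (m a) a" "?\<psi> b = Complex (m b) b" using ab by auto
  ultimately show "Complex (m a) a \<in> frontier ?K" "Complex (m b) b \<in> frontier ?K"
    unfolding fr by (simp_all add: cell_def)
qed

context planar_poset
begin

text \<open>Outside both outer faces \<open>WL leftmost z = 0\<close> and
  \<open>WR rightmost z = 0\<close>, the latter meaning \<open>WL rightmost z = -1\<close>. So the
  two extreme chains have different winding numbers about \<open>z\<close>, which is impossible for
  a point on the same side of both.\<close>

lemma inner_face_point:
  assumes F: "F \<in> faces" "F \<noteq> inL leftmost" "F \<noteq> inR rightmost" and z: "z \<in> F"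
  shows "y0 < Im z" "Im z < y1" "leftmost (Im z) < Re z" "Re z < rightmost (Im z)"
proof -
  have zJ: "z \<in> inJ" using faces_inJ F z by blast
  then have zLR: "z \<notin> path_image L" "z \<notin> path_image Rt" using J_props(8) by blast+
  have zD: "z \<notin> hasse" using faces_props(3)[OF F(1)] z unfolding drwg_eq by blast
  then have zg: "z \<notin> graph leftmost" "z \<notin> graph rightmost" using graph_hasse leftmost(1) rightmost(1) by blast+
  have "z \<notin> inL leftmost" "z \<notin> inR rightmost" using faces_disjoint[OF F(1)] inL_leftmost_faces inR_rightmost_faces F z by blast+
  then have "WL leftmost z = 0" "WR rightmost z = 0" using inL_iff[OF leftmost(1) zLR(1) zg(1)] inR_iff[OF rightmost(1) zLR(2) zg(2)] by auto
  then have "WL leftmost z \<noteq> WL rightmost z" using WL_WR[OF rightmost(1) zJ zg(2)] by auto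
  then have ne: "winding_number (chain_path leftmost) z \<noteq> winding_number (chain_path rightmost) z"
    using WL_eq[OF leftmost(1) zLR(1) zg(1)] WL_eq[OF rightmost(1) zLR(1) zg(2)] by auto
  have nl: "\<not> (leftof leftmost z \<and> leftof rightmost z)" and nr: "\<not> (rightof leftmost z \<and> rightof rightmost z)"
    using ne winding_leftof leftmost(1) rightmost(1) winding_rightof by metis+
  have rng: "Im z \<in> {y0..y1}" using nl by (auto simp: leftof_def)
  have le: "leftmost (Im z) \<le> rightmost (Im z)" using leftmost(2) rightmost(1) by blast
  have c: "leftmost (Im z) \<noteq> Re z" "rightmost (Im z) \<noteq> Re z" using zg rng by (auto simp: graph_def)
  show s: "leftmost (Im z) < Re z" "Re z < rightmost (Im z)"
    using nl nr le c rng by (auto simp: leftof_def rightof_def)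
  have "Im z \<noteq> y0" using s chain_y0[OF leftmost(1)] chain_y0[OF rightmost(1)] by auto
  moreover have "Im z \<noteq> y1" using s chain_y1[OF leftmost(1)] chain_y1[OF rightmost(1)] by auto
  ultimately show "y0 < Im z" "Im z < y1" using rng by auto
qed

text \<open>If the meeting point were inside an edge, both chains would follow this edge and agree
  at all nearby heights.\<close>

lemma chains_meet_vertex:
  assumes m: "m \<in> chains" and M: "M \<in> chains" and y: "y \<in> {y0..y1}" "m y = M y"
    and ne: "\<And>e. e > 0 \<Longrightarrow> \<exists>y'. \<bar>y' - y\<bar> < e \<and> m y' \<noteq> M y'"
  obtains v where "v \<in> verts m" "v \<in> verts M" "Y v = y"
  using m y(1)
proof (cases rule: chain_cases)
  case (1 v)
  have "v \<in> V" "m y = Re (pos v)" using 1 by (simp_all add: verts_def)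
  then have "v \<in> verts M" unfolding verts_def mem_Collect_eq 1(2)[symmetric] y(2)[symmetric] by blast
  then show ?thesis using that 1 by blast
next
  case (2 p q)
  have e: "(p, q) \<in> E" using 2 edges_E by blast
  have "M y = edge_x (p, q) y" using 2 y(2) by (auto simp: edges_def)
  then have M2: "(p, q) \<in> edges M" using chain_follows_edge[OF M e] 2 by blast
  define r where "r = min (y - Y p) (Y q - y)"
  have r: "0 < r" "r \<le> y - Y p" "r \<le> Y q - y" using 2 by (auto simp: r_def)
  obtain y' where y': "\<bar>y' - y\<bar> < r" "m y' \<noteq> M y'" using ne[OF r(1)] by blast
  have "y' \<in> {Y p..Y q}" using y'(1) r(2,3) by (simp add: abs_less_iff)
  then have "m y' = edge_x (p, q) y'" "M y' = edge_x (p, q) y'" using 2(1) M2 unfolding edges_def by simp_all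
  then show ?thesis using y'(2) by simp
qed

lemma hasse_bound: obtains B where "\<And>d. d \<in> hasse \<Longrightarrow> norm d \<le> B"
  using compact_imp_bounded[OF compact_hasse] by (auto simp: bounded_iff)

text \<open>Only the lens shape is recorded: two chains with common vertices \<open>a\<close> and
  \<open>b\<close>, strictly ordered in between. That the enclosed region is a face is a separate
  statement.\<close>

definition face_cell :: "(real \<Rightarrow> real) \<Rightarrow> (real \<Rightarrow> real) \<Rightarrow> 'p ext \<Rightarrow> 'p ext \<Rightarrow> bool" where
  "face_cell m M a b \<longleftrightarrow> m \<in> chains \<and> M \<in> chains \<and> a \<in> verts m \<and> a \<in> verts M \<and> b \<in> verts m \<and> b \<in> verts M \<and>
     Y a < Y b \<and> (\<forall>y. Y a < y \<and> y < Y b \<longrightarrow> m y < M y)"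

lemma face_cell_props:
  assumes "face_cell m M a b"
  shows "open (cell m M (Y a) (Y b))" "connected (cell m M (Y a) (Y b))"
    and "frontier (cell m M (Y a) (Y b)) \<subseteq>
      {z. Y a \<le> Im z \<and> Im z \<le> Y b \<and> (Re z = m (Im z) \<or> Re z = M (Im z))}"
    and "frontier (cell m M (Y a) (Y b)) \<subseteq> graph m \<union> graph M"
    and "pos a \<in> frontier (cell m M (Y a) (Y b))" "pos b \<in> frontier (cell m M (Y a) (Y b))"
    and "bounded (cell m M (Y a) (Y b))"
proof -
  have m: "m \<in> chains" "M \<in> chains" and ab: "a \<in> verts m" "a \<in> verts M" "b \<in> verts m" "b \<in> verts M" "Y a < Y b"
    and lt: "\<And>y. Y a < y \<Longrightarrow> y < Y b \<Longrightarrow> m y < M y"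
    using assms by (auto simp: face_cell_def)
  have V: "a \<in> V" "b \<in> V" using ab by (auto simp: verts_def)
  have sub: "{Y a..Y b} \<subseteq> {y0..y1}" using Y_bounds[OF V(1)] Y_bounds[OF V(2)] by auto
  have eq: "m (Y a) = M (Y a)" "m (Y b) = M (Y b)" using ab by (auto simp: verts_def)
  note props = cell_props[OF continuous_on_subset[OF chain_cont[OF m(1)] sub]
      continuous_on_subset[OF chain_cont[OF m(2)] sub] ab(5) eq lt]
  show "open (cell m M (Y a) (Y b))" "connected (cell m M (Y a) (Y b))" using props(1,2) by blast+
  show fr: "frontier (cell m M (Y a) (Y b)) \<subseteq>
      {z. Y a \<le> Im z \<and> Im z \<le> Y b \<and> (Re z = m (Im z) \<or> Re z = M (Im z))}" using props(3) .
  then show "frontier (cell m M (Y a) (Y b)) \<subseteq> graph m \<union> graph M"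
    using Y_bounds[OF V(1)] Y_bounds[OF V(2)] by (force simp: graph_def)
  have "Complex (m (Y a)) (Y a) = pos a" "Complex (m (Y b)) (Y b) = pos b"
    using ab by (auto simp: verts_def complex_eq_iff)
  then show "pos a \<in> frontier (cell m M (Y a) (Y b))" "pos b \<in> frontier (cell m M (Y a) (Y b))"
    using props(4,5) by auto
  obtain B where B: "\<And>d. d \<in> hasse \<Longrightarrow> norm d \<le> B" using hasse_bound by blast
  \<comment> \<open>At the height of \<open>z\<close> the real part lies between those of two Hasse
    points, so real and imaginary part are both at most \<open>B\<close> in absolute value.\<close>
  have "norm z \<le> 2 * B" if "z \<in> cell m M (Y a) (Y b)" for z
  proof -
    have z: "Im z \<in> {y0..y1}" "m (Im z) < Re z" "Re z < M (Im z)"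
      using that sub by (auto simp: cell_def subset_iff)
    have "norm (Complex (m (Im z)) (Im z)) \<le> B" "norm (Complex (M (Im z)) (Im z)) \<le> B"
      using B chain_hasse m z(1) by blast+
    then have "\<bar>m (Im z)\<bar> \<le> B" "\<bar>M (Im z)\<bar> \<le> B" "\<bar>Im z\<bar> \<le> B"
      using abs_Re_le_cmod[of "Complex (m (Im z)) (Im z)"] abs_Re_le_cmod[of "Complex (M (Im z)) (Im z)"]
        abs_Im_le_cmod[of "Complex (m (Im z)) (Im z)"] by auto
    then show ?thesis using cmod_le[of z] z by linarith
  qed
  then show "bounded (cell m M (Y a) (Y b))" unfolding bounded_iff by blast
qed

text \<open>No chain passes between the greatest chain \<open>m\<close> to the left of a point of the face and the least
  chain \<open>M\<close> to its right, since it would have to pass that point on one of the two sides.\<close>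

lemma inner_face_cell:
  assumes F: "F \<in> faces" "F \<noteq> inL leftmost" "F \<noteq> inR rightmost"
  obtains m M a b where "face_cell m M a b" "F = cell m M (Y a) (Y b)"
proof -
  obtain z where z: "z \<in> F" using faces_props(4)[OF F(1)] by blast
  note zp = inner_face_point[OF F z]
  have zD: "z \<notin> hasse" using faces_props(3)[OF F(1)] z unfolding drwg_eq by blast
  obtain m where m: "m \<in> chains" "m (Im z) < Re z" "\<And>g y. g \<in> chains \<Longrightarrow> g (Im z) < Re z \<Longrightarrow> g y \<le> m y"
    using greatest_chain[of leftmost "\<lambda>g. g (Im z) < Re z"] leftmost(1) zp(3) by auto
  obtain M where M: "M \<in> chains" "Re z < M (Im z)" "\<And>g y. g \<in> chains \<Longrightarrow> Re z < g (Im z) \<Longrightarrow> M y \<le> g y"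
    using least_chain[of rightmost "\<lambda>g. Re z < g (Im z)"] rightmost(1) zp(4) by auto
  let ?u = "\<lambda>y. M y - m y"
  have cu: "continuous_on {y0..y1} ?u" by (intro continuous_intros chain_cont m M)
  have u0: "?u y0 = 0" "?u y1 = 0" using chain_y0[OF m(1)] chain_y0[OF M(1)] chain_y1[OF m(1)] chain_y1[OF M(1)] by auto
  obtain ya where ya: "y0 \<le> ya" "ya < Im z" "?u ya = 0" "\<And>y. ya < y \<Longrightarrow> y \<le> Im z \<Longrightarrow> ?u y > 0"
    using last_zero[of y0 "Im z" ?u] continuous_on_subset[OF cu, of "{y0..Im z}"] u0 m(2) M(2) zp by auto
  obtain yb where yb: "yb \<le> y1" "Im z < yb" "?u yb = 0" "\<And>y. Im z \<le> y \<Longrightarrow> y < yb \<Longrightarrow> ?u y > 0"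
    using first_zero[of "Im z" y1 ?u] continuous_on_subset[OF cu, of "{Im z..y1}"] u0 m(2) M(2) zp by auto
  have lt: "m y < M y" if "ya < y" "y < yb" for y
    using ya(4)[of y] yb(4)[of y] that by (cases "y \<le> Im z") auto
  \<comment> \<open>Arbitrarily close above \<open>ya\<close> the two chains differ, so they cannot
    share an edge through this height. The offset is capped by half of \<open>yb - ya\<close> to
    stay below \<open>yb\<close>.\<close>
  have nea: "\<exists>y'. \<bar>y' - ya\<bar> < e \<and> m y' \<noteq> M y'" if "e > 0" for e
    using lt[of "ya + min (e / 2) ((yb - ya) / 2)"] that ya(2) yb(2)
    by (intro exI[of _ "ya + min (e / 2) ((yb - ya) / 2)"]) (auto simp: min_def field_simps)
  have neb: "\<exists>y'. \<bar>y' - yb\<bar> < e \<and> m y' \<noteq> M y'" if "e > 0" for e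
    using lt[of "yb - min (e / 2) ((yb - ya) / 2)"] that ya(2) yb(2)
    by (intro exI[of _ "yb - min (e / 2) ((yb - ya) / 2)"]) (auto simp: min_def field_simps)
  obtain a where a: "a \<in> verts m" "a \<in> verts M" "Y a = ya"
    using chains_meet_vertex[OF m(1) M(1) _ _ nea] ya zp by auto
  obtain b where b: "b \<in> verts m" "b \<in> verts M" "Y b = yb"
    using chains_meet_vertex[OF m(1) M(1) _ _ neb] yb zp by auto
  let ?K = "cell m M (Y a) (Y b)"
  have fc: "face_cell m M a b" using m M a b lt ya yb by (auto simp: face_cell_def)
  note K = face_cell_props[OF fc]
  have zK: "z \<in> ?K" using m M a b ya yb by (auto simp: cell_def)
  have KD: "?K \<inter> hasse = {}"
  proof -
    have False if d: "d \<in> ?K" "d \<in> hasse" for d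
    proof -
      obtain g where g: "g \<in> chains" "g (Im d) = Re d" using chain_point[OF d(2)] by blast
      have "Complex (g (Im z)) (Im z) \<in> hasse" using chain_hasse[OF g(1)] zp by auto
      then have "g (Im z) \<noteq> Re z" using zD by (metis complex_surj)
      then consider "g (Im z) < Re z" | "Re z < g (Im z)" by linarith
      then show False
        by cases (use m(3)[OF g(1), of "Im d"] M(3)[OF g(1), of "Im d"] d(1) g(2) in \<open>auto simp: cell_def\<close>)
    qed
    then show ?thesis by blast
  qed
  have frD: "frontier ?K \<subseteq> hasse" using K(4) graph_hasse m(1) M(1) by blast
  \<comment> \<open>The outer curve is the frontier of \<open>outJ\<close>, so an open cell meeting
    it would meet \<open>outJ\<close>. Since \<open>outJ\<close> is connected and misses the
    frontier of the cell, it would lie in the cell, which is bounded.\<close>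
  have KJ: "?K \<inter> (path_image L \<union> path_image Rt) = {}"
  proof (rule ccontr)
    assume "?K \<inter> (path_image L \<union> path_image Rt) \<noteq> {}"
    then have "?K \<inter> closure outJ \<noteq> {}" using J_props(9) unfolding frontier_def by blast
    then have 1: "?K \<inter> outJ \<noteq> {}" using open_Int_closure_eq_empty[OF K(1)] by blast
    have "outJ \<inter> frontier ?K = {}" using frD outJ_drwg unfolding drwg_eq by blast
    then have "outJ \<subseteq> ?K" using connected_Int_frontier[OF J_props(4)] 1 by blast
    then show False using K(7) J_props(6) bounded_subset by blast
  qed
  have "?K \<inter> drwg = {}" using KD KJ unfolding drwg_eq by blast
  moreover have "frontier ?K \<subseteq> drwg" using frD unfolding drwg_eq by blast
  ultimately have "?K \<in> faces" unfolding bfaces_def using component_of_open[OF K(2)] zK K(7) by blast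
  then have "F = ?K" using faces_disjoint[OF F(1)] z zK by blast
  then show ?thesis using that fc by blast
qed

section \<open>Extremal vertices and boundary edges of a cell\<close>

lemma minF_eqI:
  assumes "a \<in> BV P R pos F" "\<And>w. w \<in> BV P R pos F \<Longrightarrow> leh R a w" shows "minF P R pos F = a"
  unfolding minF_def by (rule the_equality) (use assms leh_antisym in blast)+

lemma maxF_eqI:
  assumes "b \<in> BV P R pos F" "\<And>w. w \<in> BV P R pos F \<Longrightarrow> leh R w b" shows "maxF P R pos F = b"
  unfolding maxF_def by (rule the_equality) (use assms leh_antisym in blast)+

text \<open>Every vertex on the frontier lies on \<open>m\<close> or on \<open>M\<close>, at a
  height between those of \<open>a\<close> and \<open>b\<close>; on a chain, height decides
  comparability.\<close>

lemma cell_minmax: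
  assumes fc: "face_cell m M a b" and F: "F = cell m M (Y a) (Y b)"
  shows "minF P R pos F = a" "maxF P R pos F = b"
proof -
  have m: "m \<in> chains" "M \<in> chains" and ab: "a \<in> verts m" "a \<in> verts M" "b \<in> verts m" "b \<in> verts M" "Y a < Y b"
    using fc by (auto simp: face_cell_def)
  note K = face_cell_props[OF fc, folded F]
  have V: "a \<in> V" "b \<in> V" using ab by (auto simp: verts_def)
  have B: "a \<in> BV P R pos F" "b \<in> BV P R pos F" using K(5,6) V by (auto simp: BV_def)
  have le: "leh R a w \<and> leh R w b" if "w \<in> BV P R pos F" for w
  proof -
    have w: "w \<in> V" "pos w \<in> frontier F" using that by (auto simp: BV_def)
    then have *: "Y a \<le> Y w" "Y w \<le> Y b" "w \<in> verts m \<or> w \<in> verts M"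
      using K(3) by (auto simp: verts_def)
    then show ?thesis using verts_comparable[OF m(1)] verts_comparable[OF m(2)] ab by blast
  qed
  show "minF P R pos F = a" "maxF P R pos F = b" using minF_eqI maxF_eqI B le by blast+
qed

lemma Ls_half: "F \<in> faces \<Longrightarrow> e \<in> Ls F \<longleftrightarrow> e \<in> E \<and> (\<forall>\<^sub>F \<delta> in at_right 0. crv (HE (fst e) (snd e)) (1/2) + of_real \<delta> \<in> F)"
  using side_at[of e 1 "1/2" F] by (auto simp: Ls_def side_at_def)

lemma Rs_half: "F \<in> faces \<Longrightarrow> e \<in> Rs F \<longleftrightarrow> e \<in> E \<and> (\<forall>\<^sub>F \<delta> in at_right 0. crv (HE (fst e) (snd e)) (1/2) - of_real \<delta> \<in> F)"
  using side_at[of e "-1" "1/2" F] by (auto simp: Rs_def side_at_def)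

text \<open>A chain meeting the interior of an edge follows all of it, so the point at parameter 1/2
  decides.\<close>

lemma edges_half:
  assumes "g \<in> chains" "(p, q) \<in> E"
  shows "(p, q) \<in> edges g \<longleftrightarrow> g (Im (crv (HE p q) (1/2))) = Re (crv (HE p q) (1/2))"
  using edge_point[OF assms(2) half] chain_follows_edge[OF assms] by (auto simp: edges_def)

lemma small_shift: "\<forall>\<^sub>F \<delta> in at_right (0::real). 0 < \<delta> \<and> \<delta> < e" if "e > 0"
  using that unfolding eventually_at_right_field by (intro exI[of _ e]) auto

text \<open>If all points just right of the midpoint \<open>d\<close> of an edge lie in the cell,
  then \<open>d\<close> is not left of \<open>m\<close>; being itself outside the cell, it lies on
  \<open>m\<close>. Conversely, the positive gap between \<open>m\<close> and \<open>M\<close>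
  leaves room to the right of \<open>d\<close>.\<close>

lemma cell_Ls:
  assumes fc: "face_cell m M a b" and F: "F = cell m M (Y a) (Y b)" "F \<in> faces"
  shows "Ls F = between m a b"
proof -
  have m: "m \<in> chains" "M \<in> chains" and ab: "a \<in> verts m" "a \<in> verts M" "b \<in> verts m" "b \<in> verts M" "Y a < Y b"
    and lt: "\<And>y. Y a < y \<Longrightarrow> y < Y b \<Longrightarrow> m y < M y"
    using fc by (auto simp: face_cell_def)
  have "(p, q) \<in> Ls F \<longleftrightarrow> (p, q) \<in> between m a b" if e: "(p, q) \<in> E" for p q
  proof -
    define d where "d = crv (HE p q) (1/2)"
    note d = edge_point[OF e half, folded d_def]
    have "d \<notin> F" using d(1) faces_props(3)[OF F(2)] unfolding drwg_eq by blast
    show ?thesis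
    proof
      assume "(p, q) \<in> Ls F"
      then have ev: "\<forall>\<^sub>F \<delta> in at_right 0. d + of_real \<delta> \<in> F" using Ls_half[OF F(2)] by (simp add: d_def)
      then obtain \<epsilon> where \<epsilon>: "\<epsilon> > 0" "\<And>\<delta>. 0 < \<delta> \<Longrightarrow> \<delta> < \<epsilon> \<Longrightarrow> d + of_real \<delta> \<in> F"
        unfolding eventually_at_right_field by auto
      have "d + of_real (\<epsilon> / 2) \<in> F" by (rule \<epsilon>(2)) (use \<epsilon>(1) in auto)
      then have 1: "Y a < Im d" "Im d < Y b" "Re d < M (Im d)"
        using \<epsilon>(1) by (auto simp: F(1) cell_def)
      have "m (Im d) \<le> Re d"
      proof (rule ccontr)
        assume n: "\<not> m (Im d) \<le> Re d"
        \<comment> \<open>With this shift the point is still on \<open>m\<close> or to its left,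
          hence not in the cell.\<close>
        define \<delta> where "\<delta> = min (\<epsilon> / 2) (m (Im d) - Re d)"
        have "0 < \<delta>" "\<delta> < \<epsilon>" "\<delta> \<le> m (Im d) - Re d" using n \<epsilon>(1) by (auto simp: \<delta>_def)
        then show False using \<epsilon>(2)[of \<delta>] by (auto simp: F(1) cell_def)
      qed
      with \<open>d \<notin> F\<close> 1 have "m (Im d) = Re d" by (auto simp: F(1) cell_def)
      then have ed: "(p, q) \<in> edges m" using edges_half[OF m(1) e] by (simp add: d_def)
      have "Y a \<le> Y p" "Y q \<le> Y b"
        using no_vert_inside_edge[OF ed ab(1)] no_vert_inside_edge[OF ed ab(3)] 1 d(4) by auto
      then show "(p, q) \<in> between m a b" using ed by (simp add: between_def)
    next
      assume bt: "(p, q) \<in> between m a b"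
      then have md: "m (Im d) = Re d" using edges_half[OF m(1) e] by (simp add: d_def between_def)
      have I: "Y a < Im d" "Im d < Y b" using bt d(4) by (auto simp: between_def)
      have "\<forall>\<^sub>F \<delta> in at_right 0. 0 < \<delta> \<and> \<delta> < M (Im d) - Re d"
        using lt[OF I] md by (intro small_shift) auto
      then have "\<forall>\<^sub>F \<delta> in at_right 0. d + of_real \<delta> \<in> F"
        by eventually_elim (use I md in \<open>auto simp: F(1) cell_def\<close>)
      then show "(p, q) \<in> Ls F" using Ls_half[OF F(2)] e by (simp add: d_def)
    qed
  qed
  moreover have "Ls F \<subseteq> E" "between m a b \<subseteq> E" using edges_E by (auto simp: Ls_def between_def)
  ultimately show ?thesis by auto
qed

text \<open>Mirror image of \<open>cell_Ls\<close>, with \<open>M\<close> in place of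
  \<open>m\<close> and shifts to the left.\<close>

lemma cell_Rs:
  assumes fc: "face_cell m M a b" and F: "F = cell m M (Y a) (Y b)" "F \<in> faces"
  shows "Rs F = between M a b"
proof -
  have m: "m \<in> chains" "M \<in> chains" and ab: "a \<in> verts m" "a \<in> verts M" "b \<in> verts m" "b \<in> verts M" "Y a < Y b"
    and lt: "\<And>y. Y a < y \<Longrightarrow> y < Y b \<Longrightarrow> m y < M y"
    using fc by (auto simp: face_cell_def)
  have "(p, q) \<in> Rs F \<longleftrightarrow> (p, q) \<in> between M a b" if e: "(p, q) \<in> E" for p q
  proof -
    define d where "d = crv (HE p q) (1/2)"
    note d = edge_point[OF e half, folded d_def]
    have "d \<notin> F" using d(1) faces_props(3)[OF F(2)] unfolding drwg_eq by blast
    show ?thesis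
    proof
      assume "(p, q) \<in> Rs F"
      then have ev: "\<forall>\<^sub>F \<delta> in at_right 0. d - of_real \<delta> \<in> F" using Rs_half[OF F(2)] by (simp add: d_def)
      then obtain \<epsilon> where \<epsilon>: "\<epsilon> > 0" "\<And>\<delta>. 0 < \<delta> \<Longrightarrow> \<delta> < \<epsilon> \<Longrightarrow> d - of_real \<delta> \<in> F"
        unfolding eventually_at_right_field by auto
      have "d - of_real (\<epsilon> / 2) \<in> F" by (rule \<epsilon>(2)) (use \<epsilon>(1) in auto)
      then have 1: "Y a < Im d" "Im d < Y b" "m (Im d) < Re d"
        using \<epsilon>(1) by (auto simp: F(1) cell_def)
      have "Re d \<le> M (Im d)"
      proof (rule ccontr)
        assume n: "\<not> Re d \<le> M (Im d)"
        define \<delta> where "\<delta> = min (\<epsilon> / 2) (Re d - M (Im d))"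
        have "0 < \<delta>" "\<delta> < \<epsilon>" "\<delta> \<le> Re d - M (Im d)" using n \<epsilon>(1) by (auto simp: \<delta>_def)
        then show False using \<epsilon>(2)[of \<delta>] by (auto simp: F(1) cell_def)
      qed
      with \<open>d \<notin> F\<close> 1 have "M (Im d) = Re d" by (auto simp: F(1) cell_def)
      then have ed: "(p, q) \<in> edges M" using edges_half[OF m(2) e] by (simp add: d_def)
      have "Y a \<le> Y p" "Y q \<le> Y b"
        using no_vert_inside_edge[OF ed ab(2)] no_vert_inside_edge[OF ed ab(4)] 1 d(4) by auto
      then show "(p, q) \<in> between M a b" using ed by (simp add: between_def)
    next
      assume bt: "(p, q) \<in> between M a b"
      then have md: "M (Im d) = Re d" using edges_half[OF m(2) e] by (simp add: d_def between_def)
      have I: "Y a < Im d" "Im d < Y b" using bt d(4) by (auto simp: between_def)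
      have "\<forall>\<^sub>F \<delta> in at_right 0. 0 < \<delta> \<and> \<delta> < Re d - m (Im d)"
        using lt[OF I] md by (intro small_shift) auto
      then have "\<forall>\<^sub>F \<delta> in at_right 0. d - of_real \<delta> \<in> F"
        by eventually_elim (use I md in \<open>auto simp: F(1) cell_def\<close>)
      then show "(p, q) \<in> Rs F" using Rs_half[OF F(2)] e by (simp add: d_def)
    qed
  qed
  moreover have "Rs F \<subseteq> E" "between M a b \<subseteq> E" using edges_E by (auto simp: Rs_def between_def)
  ultimately show ?thesis by auto
qed

text \<open>Near \<open>d\<close> one has \<open>HL = -1\<close> and \<open>HR = 0\<close>. If the
  shifted point is left of \<open>g\<close>, then \<open>WL\<close> equals -1 there; if it is right
  of \<open>g\<close>, then \<open>WR\<close> equals \<open>HR - 1 = -1\<close>. A point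
  \<open>d\<close> on the chain itself is pushed to the left, hence the weak inequality.\<close>

lemma near_minus:
  assumes g: "g \<in> chains" and d: "d \<in> hasse" "y0 < Im d" "Im d < y1"
  shows "\<forall>\<^sub>F \<delta> in at_right 0. d - of_real \<delta> \<in> (if Re d \<le> g (Im d) then inL g else inR g)"
proof -
  note dn = hasse_interior(1,2)[OF d]
  have op: "open (- path_image L \<inter> - path_image Rt)"
    using path_LR by (intro open_Int open_Compl closed_path_image)
  have e1: "\<forall>\<^sub>F \<delta> in at_right 0. d - of_real \<delta> \<in> - path_image L \<inter> - path_image Rt"
    using shift_eventually(1)[OF op] dn by blast
  have "\<forall>\<^sub>F \<delta>::real in at_right 0. 0 < \<delta> \<and> \<delta> < (if Re d \<le> g (Im d) then 1 else Re d - g (Im d))"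
    by (rule small_shift) auto
  with e1 H_near(2)[OF d] H_near(5)[OF d] show ?thesis
  proof eventually_elim
    case (elim \<delta>)
    let ?z = "d - of_real \<delta>"
    show ?case
    proof (cases "Re d \<le> g (Im d)")
      case True
      then have l: "leftof g ?z" using elim by (auto simp: leftof_def)
      then have "WL g ?z = -1" using WL_left[OF g] elim by auto
      then show ?thesis using inL_iff[OF g, of ?z] leftof_notin[OF l] elim True by auto
    next
      case False
      then have l: "rightof g ?z" using elim by (auto simp: rightof_def)
      then have "WR g ?z = -1" using WR_right[OF g] elim d by auto
      then show ?thesis using inR_iff[OF g, of ?z] rightof_notin[OF l] elim False by auto
    qed
  qed
qed

text \<open>As in \<open>near_minus\<close>, but a point on the chain is now pushed to the right,
  hence the strict inequality.\<close>

lemma near_plus: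
  assumes g: "g \<in> chains" and d: "d \<in> hasse" "y0 < Im d" "Im d < y1"
  shows "\<forall>\<^sub>F \<delta> in at_right 0. d + of_real \<delta> \<in> (if Re d < g (Im d) then inL g else inR g)"
proof -
  note dn = hasse_interior(1,2)[OF d]
  have op: "open (- path_image L \<inter> - path_image Rt)"
    using path_LR by (intro open_Int open_Compl closed_path_image)
  have e1: "\<forall>\<^sub>F \<delta> in at_right 0. d + of_real \<delta> \<in> - path_image L \<inter> - path_image Rt"
    using shift_eventually(2)[OF op] dn by blast
  have "\<forall>\<^sub>F \<delta>::real in at_right 0. 0 < \<delta> \<and> \<delta> < (if Re d < g (Im d) then g (Im d) - Re d else 1)"
    by (rule small_shift) auto
  with e1 H_near(3)[OF d] H_near(6)[OF d] show ?thesis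
  proof eventually_elim
    case (elim \<delta>)
    let ?z = "d + of_real \<delta>"
    show ?case
    proof (cases "Re d < g (Im d)")
      case True
      then have l: "leftof g ?z" using elim by (auto simp: leftof_def)
      then have "WL g ?z = -1" using WL_left[OF g] elim by auto
      then show ?thesis using inL_iff[OF g, of ?z] leftof_notin[OF l] elim True by auto
    next
      case False
      then have l: "rightof g ?z" using elim by (auto simp: rightof_def)
      then have "WR g ?z = -1" using WR_right[OF g] elim d by auto
      then show ?thesis using inR_iff[OF g, of ?z] rightof_notin[OF l] elim False by auto
    qed
  qed
qed

end

section \<open>Boundaries of faces and potentials\<close>

lemma sorted_wrt_unique:
  assumes "asymp r" "sorted_wrt r xs" "sorted_wrt r ys" "set xs = set ys"
  shows "xs = ys"
  using assms(2-)
proof (induction xs arbitrary: ys)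
  case (Cons x xs)
  then obtain y ys' where ys: "ys = y # ys'" by (cases ys) auto
  have irr: "\<not> r u u" for u using assms(1) by (auto dest: asympD)
  have "x = y"
  proof (rule ccontr)
    assume "x \<noteq> y"
    then have "x \<in> set ys'" "y \<in> set xs" using Cons.prems ys by auto
    then have "r x y" "r y x" using Cons.prems ys by auto
    then show False using assms(1) by (auto dest: asympD)
  qed
  moreover have "x \<notin> set xs" "y \<notin> set ys'" using Cons.prems ys irr by auto
  then have "set xs = set ys'" using Cons.prems(3) \<open>x = y\<close> unfolding ys by auto
  then have "xs = ys'" using Cons.IH[of ys'] Cons.prems ys by auto
  ultimately show ?case using ys by simp
qed simp

lemma eventually_if_iff:
  assumes "\<forall>\<^sub>F x in F. f x \<in> (if c then A else B)" "A \<inter> B = {}" "F \<noteq> bot"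
  shows "(\<forall>\<^sub>F x in F. f x \<in> A) \<longleftrightarrow> c" "(\<forall>\<^sub>F x in F. f x \<in> B) \<longleftrightarrow> \<not> c"
proof -
  have *: "\<not> ((\<forall>\<^sub>F x in F. f x \<in> A) \<and> (\<forall>\<^sub>F x in F. f x \<in> B))"
  proof
    assume "(\<forall>\<^sub>F x in F. f x \<in> A) \<and> (\<forall>\<^sub>F x in F. f x \<in> B)"
    then have "\<forall>\<^sub>F x in F. f x \<in> A \<inter> B" by (simp add: eventually_conj_iff)
    then show False using assms(2,3) by simp
  qed
  show "(\<forall>\<^sub>F x in F. f x \<in> A) \<longleftrightarrow> c" "(\<forall>\<^sub>F x in F. f x \<in> B) \<longleftrightarrow> \<not> c"
    using * assms(1) by (cases c; simp)+
qed

context planar_poset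
begin

abbreviation "lface \<equiv> FL P R pos crv"
abbreviation "rface \<equiv> FR P R pos crv"

lemma lface_faces: "lface \<in> faces" and rface_faces: "rface \<in> faces"
  using FL_eq FR_eq inL_leftmost_faces inR_rightmost_faces by auto

lemma mid_side:
  assumes g: "g \<in> chains" and e: "(p, q) \<in> E"
  defines "d \<equiv> crv (HE p q) (1/2)"
  shows "(\<forall>\<^sub>F \<delta> in at_right 0. d - of_real \<delta> \<in> inL g) \<longleftrightarrow> Re d \<le> g (Im d)"
    "(\<forall>\<^sub>F \<delta> in at_right 0. d + of_real \<delta> \<in> inL g) \<longleftrightarrow> Re d < g (Im d)"
    "(\<forall>\<^sub>F \<delta> in at_right 0. d - of_real \<delta> \<in> inR g) \<longleftrightarrow> \<not> Re d \<le> g (Im d)"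
    "(\<forall>\<^sub>F \<delta> in at_right 0. d + of_real \<delta> \<in> inR g) \<longleftrightarrow> \<not> Re d < g (Im d)"
proof -
  note d = edge_point[OF e half, folded d_def]
  have nb: "at_right (0::real) \<noteq> bot" by simp
  show "(\<forall>\<^sub>F \<delta> in at_right 0. d - of_real \<delta> \<in> inL g) \<longleftrightarrow> Re d \<le> g (Im d)"
    "(\<forall>\<^sub>F \<delta> in at_right 0. d - of_real \<delta> \<in> inR g) \<longleftrightarrow> \<not> Re d \<le> g (Im d)"
    by (rule eventually_if_iff[OF near_minus[OF g d(1-3)] chain_split(1)[OF g] nb])+
  show "(\<forall>\<^sub>F \<delta> in at_right 0. d + of_real \<delta> \<in> inL g) \<longleftrightarrow> Re d < g (Im d)"
    "(\<forall>\<^sub>F \<delta> in at_right 0. d + of_real \<delta> \<in> inR g) \<longleftrightarrow> \<not> Re d < g (Im d)"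
    by (rule eventually_if_iff[OF near_plus[OF g d(1-3)] chain_split(1)[OF g] nb])+
qed

lemma mid_between:
  assumes e: "(p, q) \<in> E"
  defines "d \<equiv> crv (HE p q) (1/2)"
  shows "leftmost (Im d) \<le> Re d" "Re d \<le> rightmost (Im d)"
proof -
  obtain g where g: "g \<in> chains" "(p, q) \<in> edges g" using chain_through_edge[OF e] by blast
  then have "g (Im d) = Re d" using edges_half[OF g(1) e] by (simp add: d_def)
  then show "leftmost (Im d) \<le> Re d" "Re d \<le> rightmost (Im d)" using leftmost(2)[OF g(1)] rightmost(2)[OF g(1)] by metis+
qed

lemma between_all: "between g Bot Top = edges g"
proof -
  have "y0 \<le> Y (fst e) \<and> Y (snd e) \<le> y1" if "e \<in> edges g" for e
    using that edges_E[of g] E_V[of "fst e" "snd e"] Y_bounds by auto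
  then show ?thesis by (auto simp: between_def)
qed

text \<open>The left outer face is immediately left of an edge exactly if the midpoint is not to the
  right of the leftmost chain; since no Hasse point is to its left, the midpoint lies on the
  chain.\<close>

lemma Rs_lface: "Rs lface = edges leftmost"
proof -
  have "(p, q) \<in> Rs lface \<longleftrightarrow> (p, q) \<in> edges leftmost" if e: "(p, q) \<in> E" for p q
    using Rs_half[OF lface_faces, of "(p, q)"] mid_side(1)[OF leftmost(1) e] mid_between(1)[OF e] edges_half[OF leftmost(1) e] e
    by (auto simp: FL_eq)
  then show ?thesis using edges_E by (auto simp: Rs_def)
qed

text \<open>An edge with this face on its right would have a midpoint strictly left of the leftmost
  chain. The left boundary of the face is the additional edge alone.\<close>

lemma Ls_lface: "Ls lface = {}"
proof -
  have "(p, q) \<notin> Ls lface" if e: "(p, q) \<in> E" for p q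
    using Ls_half[OF lface_faces, of "(p, q)"] mid_side(2)[OF leftmost(1) e] mid_between(1)[OF e] e
    by (auto simp: FL_eq)
  then show ?thesis by (auto simp: Ls_def)
qed

lemma Ls_rface: "Ls rface = edges rightmost"
proof -
  have "(p, q) \<in> Ls rface \<longleftrightarrow> (p, q) \<in> edges rightmost" if e: "(p, q) \<in> E" for p q
    using Ls_half[OF rface_faces, of "(p, q)"] mid_side(4)[OF rightmost(1) e] mid_between(2)[OF e] edges_half[OF rightmost(1) e] e
    by (auto simp: FR_eq)
  then show ?thesis using edges_E by (auto simp: Ls_def)
qed

lemma edges_nonempty: assumes "g \<in> chains" shows "edges g \<noteq> {}"
  using vert_in_between[OF assms Bot_verts[OF assms] Top_verts[OF assms] y01 Bot_verts[OF assms]] y01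
  by (auto simp: between_all)

lemma lface_ne_rface: "lface \<noteq> rface"
  using Ls_lface Ls_rface edges_nonempty[OF rightmost(1)] by auto

lemma minmax_lface: "minF P R pos lface = Bot" "maxF P R pos lface = Top"
proof -
  have "Bot \<in> BV P R pos lface" "Top \<in> BV P R pos lface"
    using graph_ends[OF leftmost(1)] inL_props(6)[OF leftmost(1)] by (auto simp: BV_def FL_eq)
  then show "minF P R pos lface = Bot" "maxF P R pos lface = Top" by (auto intro: minF_eqI maxF_eqI)
qed

lemma minmax_rface: "minF P R pos rface = Bot" "maxF P R pos rface = Top"
proof -
  have "Bot \<in> BV P R pos rface" "Top \<in> BV P R pos rface"
    using graph_ends[OF rightmost(1)] inR_props(6)[OF rightmost(1)] by (auto simp: BV_def FR_eq)
  then show "minF P R pos rface = Bot" "maxF P R pos rface = Top" by (auto intro: minF_eqI maxF_eqI)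
qed

text \<open>A uniform description for inner cells and for the right outer face, whose left boundary
  is the whole rightmost chain.\<close>

lemma face_left:
  assumes F: "F \<in> faces" "F \<noteq> lface"
  obtains g where "g \<in> chains" "minF P R pos F \<in> verts g" "maxF P R pos F \<in> verts g"
    "Y (minF P R pos F) < Y (maxF P R pos F)" "Ls F = between g (minF P R pos F) (maxF P R pos F)"
proof (cases "F = rface")
  case True
  then show ?thesis using that[OF rightmost(1)] minmax_rface Ls_rface between_all Bot_verts Top_verts rightmost(1) y01 by auto
next
  case False
  obtain m M a b where mM: "face_cell m M a b" "F = cell m M (Y a) (Y b)"
    using inner_face_cell[OF F(1)] False F(2) unfolding FL_eq FR_eq by blast
  then show ?thesis
    using that[of m] cell_minmax[OF mM] cell_Ls[OF mM F(1)] by (simp add: face_cell_def)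
qed

lemma face_right:
  assumes F: "F \<in> faces" "F \<noteq> rface"
  obtains g where "g \<in> chains" "minF P R pos F \<in> verts g" "maxF P R pos F \<in> verts g"
    "Y (minF P R pos F) < Y (maxF P R pos F)" "Rs F = between g (minF P R pos F) (maxF P R pos F)"
proof (cases "F = lface")
  case True
  then show ?thesis using that[OF leftmost(1)] minmax_lface Rs_lface between_all Bot_verts Top_verts leftmost(1) y01 by auto
next
  case False
  obtain m M a b where mM: "face_cell m M a b" "F = cell m M (Y a) (Y b)"
    using inner_face_cell[OF F(1)] False F(2) unfolding FL_eq FR_eq by blast
  then show ?thesis
    using that[of M] cell_minmax[OF mM] cell_Rs[OF mM F(1)] by (simp add: face_cell_def)
qed

lemma LBv_eq: "LBv P R pos crv F = {v. \<exists>e\<in>Ls F. v = fst e \<or> v = snd e} \<union> (if F = lface then {Bot, Top} else {})"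
proof -
  have *: "EH P R = (\<lambda>e. HE (fst e) (snd e)) ` E \<union> {LeftE, RightE}"
    by (auto simp: EH_def Ecov_def image_iff)
  have A: "v \<in> LBv P R pos crv F \<longleftrightarrow> (\<exists>e\<in>E. side 1 F e \<and> (v = fst e \<or> v = snd e)) \<or> (F = lface \<and> (v = Bot \<or> v = Top))" for v
    unfolding LBv_def mem_Collect_eq * bex_Un bex_simps(7) onL_HE prod.collapse by simp
  show ?thesis
  proof (cases "F = lface")
    case True
    then show ?thesis unfolding if_P[OF True] Ls_def using A by blast
  next
    case False
    then show ?thesis unfolding if_not_P[OF False] Ls_def using A by blast
  qed
qed

lemma LBv_left:
  assumes "F \<noteq> lface" "g \<in> chains" "a \<in> verts g" "b \<in> verts g" "Y a < Y b" "Ls F = between g a b"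
  shows "LBv P R pos crv F = {v \<in> verts g. Y a \<le> Y v \<and> Y v \<le> Y b}"
proof -
  have "fst e \<in> verts g \<and> snd e \<in> verts g \<and> Y a \<le> Y (fst e) \<and> Y (fst e) \<le> Y b \<and> Y a \<le> Y (snd e) \<and> Y (snd e) \<le> Y b"
    if "e \<in> between g a b" for e
    using that edges_verts[of "fst e" "snd e" g] edges_E[of g] Y_E[of "fst e" "snd e"]
    by (auto simp: between_def)
  then have "v \<in> LBv P R pos crv F \<longleftrightarrow> v \<in> verts g \<and> Y a \<le> Y v \<and> Y v \<le> Y b" for v
    using vert_in_between[OF assms(2-5), of v] assms(1) unfolding LBv_eq assms(6) if_not_P[OF assms(1)] by blast
  then show ?thesis by blast
qed

section \<open>Faces on the two sides of a chain\<close>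

lemma chain_face_side:
  assumes g: "g \<in> chains" and F: "F \<in> faces"
  shows "F \<subseteq> inL g \<or> F \<subseteq> inR g"
proof -
  have "F \<inter> graph g = {}" using faces_props(3)[OF F] graph_hasse[OF g] unfolding drwg_eq by blast
  then have "F \<subseteq> inL g \<union> inR g" using faces_inJ[OF F] chain_split(2)[OF g] by blast
  then show ?thesis
    using connectedD[OF faces_props(2)[OF F] inL_props(2)[OF g] inR_props(2)[OF g]] chain_split(1)[OF g] by blast
qed

lemma face_side_eventually:
  assumes g: "g \<in> chains" and F: "F \<in> faces" and ev: "\<forall>\<^sub>F \<delta> in at_right (0::real). f \<delta> \<in> F"
  shows "F \<subseteq> inL g \<longleftrightarrow> (\<forall>\<^sub>F \<delta> in at_right 0. f \<delta> \<in> inL g)"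
proof
  assume "F \<subseteq> inL g"
  then show "\<forall>\<^sub>F \<delta> in at_right 0. f \<delta> \<in> inL g" using ev by (auto elim: eventually_mono)
next
  assume "\<forall>\<^sub>F \<delta> in at_right 0. f \<delta> \<in> inL g"
  with ev have "\<forall>\<^sub>F \<delta> in at_right 0. f \<delta> \<in> F \<inter> inL g" by eventually_elim simp
  then have "F \<inter> inL g \<noteq> {}" using eventually_happens[of _ "at_right (0::real)"] by fastforce
  then show "F \<subseteq> inL g" using chain_face_side[OF g F] chain_split(1)[OF g] by blast
qed

lemma Rs_inL:
  assumes g: "g \<in> chains" and F: "F \<in> faces" and e: "(p, q) \<in> Rs F"
  shows "F \<subseteq> inL g \<longleftrightarrow> Re (crv (HE p q) (1/2)) \<le> g (Im (crv (HE p q) (1/2)))"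
proof -
  have "(p, q) \<in> E" "\<forall>\<^sub>F \<delta> in at_right 0. crv (HE p q) (1/2) - of_real \<delta> \<in> F"
    using e Rs_half[OF F] by auto
  from face_side_eventually[OF g F this(2)] mid_side(1)[OF g this(1)] show ?thesis by (rule trans)
qed

text \<open>The inequality is strict here and weak in \<open>Rs_inL\<close>: an edge of
  \<open>g\<close> itself has its left face on the left of \<open>g\<close> but its right face on
  the right. This discrepancy singles out the edges of \<open>g\<close> in
  \<open>chain_total\<close>.\<close>

lemma Ls_inL:
  assumes g: "g \<in> chains" and F: "F \<in> faces" and e: "(p, q) \<in> Ls F"
  shows "F \<subseteq> inL g \<longleftrightarrow> Re (crv (HE p q) (1/2)) < g (Im (crv (HE p q) (1/2)))"
proof -
  have "(p, q) \<in> E" "\<forall>\<^sub>F \<delta> in at_right 0. crv (HE p q) (1/2) + of_real \<delta> \<in> F"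
    using e Ls_half[OF F] by auto
  from face_side_eventually[OF g F this(2)] mid_side(2)[OF g this(1)] show ?thesis by (rule trans)
qed

lemma lface_inL: assumes g: "g \<in> chains" shows "lface \<subseteq> inL g"
proof -
  obtain p q where e: "(p, q) \<in> edges leftmost" using edges_nonempty[OF leftmost(1)] by auto
  then have "(p, q) \<in> E" using edges_E by blast
  then show ?thesis
    using Rs_inL[OF g lface_faces, of p q] e edges_half[OF leftmost(1)] leftmost(2)[OF g] unfolding Rs_lface by metis
qed

lemma rface_not_inL: assumes g: "g \<in> chains" shows "\<not> rface \<subseteq> inL g"
proof -
  obtain p q where e: "(p, q) \<in> edges rightmost" using edges_nonempty[OF rightmost(1)] by auto
  then have "(p, q) \<in> E" using edges_E by blast
  then show ?thesis
    using Ls_inL[OF g rface_faces, of p q] e edges_half[OF rightmost(1)] rightmost(2)[OF g] unfolding Ls_rface by (metis not_le)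
qed

text \<open>Conservation at the faces to the left of a chain: the edges crossed by the chain carry the
  same total as those entering the leftmost face.\<close>

lemma chain_total:
  fixes f :: "'p ext \<times> 'p ext \<Rightarrow> real"
  assumes bal: "\<And>F. F \<in> faces \<Longrightarrow> F \<noteq> lface \<Longrightarrow> F \<noteq> rface \<Longrightarrow> sum f (Ls F) = sum f (Rs F)" and g: "g \<in> chains"
  shows "sum f (edges g) = sum f (Rs lface)"
proof -
  let ?Rf = "\<lambda>e. Rface P R pos crv (HE (fst e) (snd e))" and ?Lf = "\<lambda>e. Lface P R pos crv (HE (fst e) (snd e))"
  \<comment> \<open>Restricting to faces adjacent to a Hasse edge makes the set visibly finite, and
    only these faces contribute to the sums.\<close>
  define S where "S = {F \<in> ?Rf ` E \<union> ?Lf ` E. F \<subseteq> inL g}"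
  have fin: "finite S" by (simp add: S_def)
  have SbF: "S \<subseteq> faces" using Rface(1) Lface(1) by (auto simp: S_def)
  \<comment> \<open>An edge with its right face left of \<open>g\<close> also has its left face
    there. Hence \<open>ER\<close> is contained in \<open>EL\<close>, and the difference consists of
    the edges lying on \<open>g\<close>.\<close>
  define EL where "EL = {e \<in> E. ?Lf e \<in> S}"
  define ER where "ER = {e \<in> E. ?Rf e \<in> S}"
  have finE: "finite EL" "finite ER" by (simp_all add: EL_def ER_def)
  have EL: "(p, q) \<in> EL \<longleftrightarrow> Re (crv (HE p q) (1/2)) \<le> g (Im (crv (HE p q) (1/2)))" if e: "(p, q) \<in> E" for p q
    using Rs_inL[OF g Lface(1)[OF e]] Lface(2)[OF e Lface(1)[OF e]] e by (force simp: EL_def S_def)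
  have ER: "(p, q) \<in> ER \<longleftrightarrow> Re (crv (HE p q) (1/2)) < g (Im (crv (HE p q) (1/2)))" if e: "(p, q) \<in> E" for p q
    using Ls_inL[OF g Rface(1)[OF e]] Rface(2)[OF e Rface(1)[OF e]] e by (force simp: ER_def S_def)
  have sub: "EL \<subseteq> E" "ER \<subseteq> E" by (auto simp: EL_def ER_def)
  have "(p, q) \<in> ER \<Longrightarrow> (p, q) \<in> EL" for p q using EL ER sub by force
  then have ERL: "ER \<subseteq> EL" by auto
  have "(p, q) \<in> edges g \<longleftrightarrow> (p, q) \<in> EL - ER" for p q
    using EL[of p q] ER[of p q] edges_half[OF g, of p q] sub edges_E[of g] by force
  then have "edges g = EL - ER" by auto
  then have "sum f (edges g) = sum f EL - sum f ER" using sum_diff[OF finE(1) ERL, of f] by simp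
  also have "sum f EL = (\<Sum>F\<in>S. sum f {e \<in> EL. ?Lf e = F})"
    by (rule sum.group[symmetric]) (use fin finE in \<open>auto simp: EL_def\<close>)
  also have "sum f ER = (\<Sum>F\<in>S. sum f {e \<in> ER. ?Rf e = F})"
    by (rule sum.group[symmetric]) (use fin finE in \<open>auto simp: ER_def\<close>)
  also have "(\<Sum>F\<in>S. sum f {e \<in> EL. ?Lf e = F}) = (\<Sum>F\<in>S. sum f (Rs F))"
  proof (rule sum.cong[OF refl])
    fix F assume F: "F \<in> S"
    then have "{e \<in> EL. ?Lf e = F} = {e \<in> E. ?Lf e = F}" by (auto simp: EL_def)
    also have "\<dots> = Rs F" using Lface(2) F SbF by (auto simp: Rs_def)
    finally show "sum f {e \<in> EL. ?Lf e = F} = sum f (Rs F)" by simp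
  qed
  also have "(\<Sum>F\<in>S. sum f {e \<in> ER. ?Rf e = F}) = (\<Sum>F\<in>S. sum f (Ls F))"
  proof (rule sum.cong[OF refl])
    fix F assume F: "F \<in> S"
    then have "{e \<in> ER. ?Rf e = F} = {e \<in> E. ?Rf e = F}" by (auto simp: ER_def)
    also have "\<dots> = Ls F" using Rface(2) F SbF by (auto simp: Ls_def)
    finally show "sum f {e \<in> ER. ?Rf e = F} = sum f (Ls F)" by simp
  qed
  also have "(\<Sum>F\<in>S. sum f (Rs F)) - (\<Sum>F\<in>S. sum f (Ls F)) = (\<Sum>F\<in>S. sum f (Rs F) - sum f (Ls F))"
    by (simp add: sum_subtractf)
  \<comment> \<open>Balance cancels every face but \<open>lface\<close>; the other unbalanced face
    \<open>rface\<close> is never left of \<open>g\<close>.\<close>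
  also have "\<dots> = (\<Sum>F\<in>{lface}. sum f (Rs F) - sum f (Ls F))"
  proof (rule sum.mono_neutral_right[OF fin])
    obtain e where e: "e \<in> edges leftmost" using edges_nonempty[OF leftmost(1)] by auto
    then have "e \<in> E" using edges_E by blast
    moreover from this have "?Lf e = lface" using Lface(2)[OF _ lface_faces] e Rs_lface by blast
    ultimately show "{lface} \<subseteq> S" using lface_inL[OF g] by (auto simp: S_def)
    show "\<forall>F\<in>S - {lface}. sum f (Rs F) - sum f (Ls F) = 0"
    proof
      fix F assume F: "F \<in> S - {lface}"
      then have "F \<in> faces" "F \<noteq> lface" "F \<noteq> rface" using rface_not_inL[OF g] SbF unfolding S_def by blast+
      from bal[OF this] show "sum f (Rs F) - sum f (Ls F) = 0" by simp
    qed
  qed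
  also have "\<dots> = sum f (Rs lface)" by (simp add: Ls_lface)
  finally show ?thesis .
qed

text \<open>The potential at \<open>v\<close> is the sum of \<open>f\<close> along a chain from
  \<open>Bot\<close> up to \<open>v\<close>. For two chains \<open>g\<close> and \<open>h\<close>
  through \<open>v\<close>, the hybrid following \<open>g\<close> below \<open>v\<close> and
  \<open>h\<close> above has the same total as \<open>h\<close> and the same upper part, so the
  lower parts have equal sums and the choice of chain is immaterial.\<close>

lemma potential_exists:
  fixes f :: "'p ext \<times> 'p ext \<Rightarrow> real"
  assumes bal: "\<And>F. F \<in> faces \<Longrightarrow> F \<noteq> lface \<Longrightarrow> F \<noteq> rface \<Longrightarrow> sum f (Ls F) = sum f (Rs F)"
  obtains pot where "pot Bot = 0" "\<And>p q. (p, q) \<in> E \<Longrightarrow> pot q - pot p = f (p, q)"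
    "pot Top = sum f (Rs lface)"
proof -
  have indep: "sum f (between g Bot v) = sum f (between h Bot v)"
    if g: "g \<in> chains" and h: "h \<in> chains" and v: "v \<in> verts g" "v \<in> verts h" for g h v
  proof -
    let ?k = "\<lambda>y. if y \<le> Y v then g y else h y"
    have k: "?k \<in> chains" by (rule chains_glue[OF g h v])
    have vV: "v \<in> V" using v by (simp add: verts_def)
    have eq: "g (Y v) = h (Y v)" using v by (simp add: verts_def)
    have vk: "v \<in> verts ?k" using v by (simp add: verts_def)
    have "e \<in> edges ?k \<longleftrightarrow> e \<in> edges g" if "Y (snd e) \<le> Y v" for e
      using that by (auto simp: edges_def)
    then have lo: "between ?k Bot v = between g Bot v" by (auto simp: between_def)
    have "e \<in> edges ?k \<longleftrightarrow> e \<in> edges h" if "Y v \<le> Y (fst e)" for e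
    proof -
      have "?k y = h y" if "y \<in> {Y (fst e)..Y (snd e)}" for y
        using that \<open>Y v \<le> Y (fst e)\<close> eq by (cases "y = Y v") auto
      then show ?thesis unfolding edges_def by simp
    qed
    then have hi: "between ?k v Top = between h v Top" by (auto simp: between_def)
    have split: "sum f (edges c) = sum f (between c Bot v) + sum f (between c v Top)" if "v \<in> verts c" for c
      using between_split[OF that, of Bot Top] Y_bounds[OF vV] by (simp add: between_all sum.union_disjoint)
    have "sum f (edges ?k) = sum f (edges h)" using chain_total[OF bal] k h by simp
    then show ?thesis using split[OF vk] split[OF v(2)] lo hi by simp
  qed
  define pot where "pot v = sum f (between (SOME g. g \<in> chains \<and> v \<in> verts g) Bot v)" for v
  have pot: "pot v = sum f (between g Bot v)" if "g \<in> chains" "v \<in> verts g" for g v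
  proof -
    have "(SOME g. g \<in> chains \<and> v \<in> verts g) \<in> chains \<and> v \<in> verts (SOME g. g \<in> chains \<and> v \<in> verts g)"
      by (rule someI[of _ g]) (use that in simp)
    then show ?thesis unfolding pot_def using indep that by blast
  qed
  show ?thesis
  proof
    show "pot Bot = 0" using pot[OF leftmost(1) Bot_verts[OF leftmost(1)]] by (simp add: between_self)
    show "pot Top = sum f (Rs lface)" using pot[OF leftmost(1) Top_verts[OF leftmost(1)]] by (simp add: between_all Rs_lface)
    show "pot q - pot p = f (p, q)" if e: "(p, q) \<in> E" for p q
    proof -
      obtain g where g: "g \<in> chains" "(p, q) \<in> edges g" using chain_through_edge[OF e] by blast
      note v = edges_verts[OF g(2)]
      have "between g p q = {(p, q)}"
        by (rule between_step[OF g(1)]) (use v Y_E[OF e] no_vert_inside_edge[OF g(2)] in fastforce)+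
      then show ?thesis
        using between_split[of p g Bot q] v Y_bounds(1)[OF E_V(1)[OF e]] Y_E[OF e]
        by (simp add: pot[OF g(1)] sum.union_disjoint)
    qed
  qed
qed

end

section \<open>The marked order polytope and the flow polytope\<close>

lemma sorted_wrt_exists:
  fixes h :: "'a \<Rightarrow> 'b::linorder"
  assumes "finite S" "inj_on h S" "\<And>a b. a \<in> S \<Longrightarrow> b \<in> S \<Longrightarrow> h a < h b \<Longrightarrow> r b a"
  shows "\<exists>xs. set xs = S \<and> sorted_wrt r xs"
proof -
  let ?ys = "sorted_list_of_set (h ` S)" and ?k = "inv_into S h"
  have k: "?k y \<in> S \<and> h (?k y) = y" if "y \<in> h ` S" for y using that by (simp add: inv_into_into f_inv_into_f)
  have "sorted_wrt (\<lambda>y x. r (?k x) (?k y)) ?ys"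
  proof (rule sorted_wrt_mono_rel)
    show "sorted_wrt (<) ?ys" by simp
    show "r (?k x) (?k y)" if "y \<in> set ?ys" "x \<in> set ?ys" "y < x" for x y
      using that k[of x] k[of y] assms(1,3) by simp
  qed
  then have "sorted_wrt r (map ?k (rev ?ys))" by (simp add: sorted_wrt_map sorted_wrt_rev)
  moreover have "set (map ?k (rev ?ys)) = S" using assms(1,2) by simp
  ultimately show ?thesis by blast
qed

locale marked_embedding = planar_poset P R pos crv
  for P :: "'p set" and R :: "('p \<times> 'p) set"
    and pos :: "'p ext \<Rightarrow> complex" and crv :: "'p hedge \<Rightarrow> real \<Rightarrow> complex" +
  fixes A :: "'p set" and lam :: "'p \<Rightarrow> real"
  assumes mp: "marked_poset P R A lam"
    and marks: "\<And>F. F \<in> faces \<Longrightarrow> hasMarked P R A pos crv F \<Longrightarrow>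
      minF P R pos F \<in> Marked A \<and> maxF P R pos F \<in> Marked A"
begin

abbreviation "marked F \<equiv> hasMarked P R A pos crv F"
abbreviation "mn F \<equiv> minF P R pos F"
abbreviation "mx F \<equiv> maxF P R pos F"
abbreviation "rs F \<equiv> rlist P R A pos crv F"
abbreviation "lv \<equiv> lamh A lam"
abbreviation "tl_of \<equiv> tailG P R A pos crv"
abbreviation "hd_of \<equiv> headG P R pos crv"

lemma A_P: "A \<subseteq> P" and fin_A: "finite A"
  using mp by (auto simp: marked_poset_def intro: finite_subset)

lemma minimal_A: "p \<in> P \<Longrightarrow> (\<And>q. q \<in> P \<Longrightarrow> (q, p) \<in> R \<Longrightarrow> q = p) \<Longrightarrow> p \<in> A"
  and maximal_A: "p \<in> P \<Longrightarrow> (\<And>q. q \<in> P \<Longrightarrow> (p, q) \<in> R \<Longrightarrow> q = p) \<Longrightarrow> p \<in> A"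
  using mp unfolding marked_poset_def by blast+

section \<open>Marked elements on left boundaries\<close>

lemma marked_lface: "marked lface"
  by (auto simp: hasMarked_def LBv_eq Marked_def)

text \<open>Collects what is needed about the list of marks: \<open>g\<close> is a chain carrying
  the left boundary of \<open>F\<close>, and the list runs downward along it from the maximum to the
  minimum of \<open>F\<close>. Indices are zero-based, so the gap of \<open>SF F m\<close> lies
  between entries \<open>m\<close> and \<open>m - 1\<close>.\<close>

definition ranked :: "(real \<Rightarrow> real) \<Rightarrow> complex set \<Rightarrow> bool" where
  "ranked g F \<longleftrightarrow> g \<in> chains \<and> mn F \<in> verts g \<and> mx F \<in> verts g \<and> Y (mn F) < Y (mx F) \<and>
    Ls F = between g (mn F) (mx F) \<and>
    set (rs F) = {v \<in> verts g. Y (mn F) \<le> Y v \<and> Y v \<le> Y (mx F)} \<inter> Marked A \<and>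
    2 \<le> length (rs F) \<and> rs F ! 0 = mx F \<and> rs F ! (length (rs F) - 1) = mn F \<and>
    (\<forall>i j. i < j \<longrightarrow> j < length (rs F) \<longrightarrow> Y (rs F ! j) < Y (rs F ! i))"

lemma rankedD:
  assumes "ranked g F"
  shows "g \<in> chains" "mn F \<in> verts g" "mx F \<in> verts g" "Y (mn F) < Y (mx F)" "Ls F = between g (mn F) (mx F)"
    "set (rs F) = {v \<in> verts g. Y (mn F) \<le> Y v \<and> Y v \<le> Y (mx F)} \<inter> Marked A"
    "2 \<le> length (rs F)" "rs F ! 0 = mx F" "rs F ! (length (rs F) - 1) = mn F"
    "\<And>i j. i < j \<Longrightarrow> j < length (rs F) \<Longrightarrow> Y (rs F ! j) < Y (rs F ! i)"
  using assms unfolding ranked_def by blast+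

lemma ranked_nth:
  assumes "ranked g F" "k < length (rs F)"
  shows "rs F ! k \<in> verts g" "rs F ! k \<in> Marked A" "Y (mn F) \<le> Y (rs F ! k)" "Y (rs F ! k) \<le> Y (mx F)"
  using nth_mem[OF assms(2)] unfolding rankedD(6)[OF assms(1)] by blast+

text \<open>The left boundary is part of a chain, hence totally ordered by height, so the
  description defining \<open>rlist\<close> has exactly one solution. The marking condition on the
  embedding puts the minimum and the maximum of \<open>F\<close> into the list.\<close>

lemma ranked_exists:
  assumes F: "F \<in> faces" "F \<noteq> lface" and mk: "marked F"
  shows "\<exists>g. ranked g F"
proof -
  obtain g where g: "g \<in> chains" "mn F \<in> verts g" "mx F \<in> verts g" "Y (mn F) < Y (mx F)" "Ls F = between g (mn F) (mx F)"
    using face_left[OF F] by blast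
  let ?S = "{v \<in> verts g. Y (mn F) \<le> Y v \<and> Y v \<le> Y (mx F)} \<inter> Marked A"
  have S: "LBv P R pos crv F \<inter> Marked A = ?S" using LBv_left[OF F(2) g] by blast
  have SV: "?S \<subseteq> V" by (auto simp: verts_def)
  have lth_iff: "lth R v w" if "v \<in> ?S" "w \<in> ?S" "Y v < Y w" for v w
    using verts_comparable[OF g(1)] that by (auto simp: lth_def)
  have as: "asymp (\<lambda>a b. lth R b a)" by (rule asympI) (use lth_trans lth_irrefl in blast)
  have "\<exists>xs. set xs = ?S \<and> sorted_wrt (\<lambda>a b. lth R b a) xs"
  proof (rule sorted_wrt_exists[of _ Y])
    show "finite ?S" using SV finite_subset finite_V by blast
    show "inj_on Y ?S" using verts_Y_inj by (auto simp: inj_on_def)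
  qed (use lth_iff in blast)
  then have "\<exists>!xs. set xs = LBv P R pos crv F \<inter> Marked A \<and> sorted_wrt (\<lambda>a b. lth R b a) xs"
    unfolding S using sorted_wrt_unique[OF as] by metis
  from theI'[OF this, folded rlist_def]
  have r: "set (rs F) = ?S" "sorted_wrt (\<lambda>a b. lth R b a) (rs F)" unfolding S by blast+
  have dec: "Y (rs F ! j) < Y (rs F ! i)" if "i < j" "j < length (rs F)" for i j
  proof -
    have "lth R (rs F ! j) (rs F ! i)" using sorted_wrt_nth_less[OF r(2) that] .
    moreover have "rs F ! k \<in> V" if "k < length (rs F)" for k using nth_mem[OF that] SV r(1) by blast
    then have "rs F ! i \<in> V" "rs F ! j \<in> V" using that by simp_all
    ultimately show ?thesis using Y_lth by blast
  qed
  have ends: "mn F \<in> set (rs F)" "mx F \<in> set (rs F)" using marks[OF F(1) mk] g unfolding r(1) by auto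
  obtain i where i: "i < length (rs F)" "rs F ! i = mx F" using ends(2) by (meson in_set_conv_nth)
  obtain j where j: "j < length (rs F)" "rs F ! j = mn F" using ends(1) by (meson in_set_conv_nth)
  have rng: "Y (mn F) \<le> Y (rs F ! k) \<and> Y (rs F ! k) \<le> Y (mx F)" if "k < length (rs F)" for k
    using nth_mem[OF that] unfolding r(1) by blast
  have "i = 0"
  proof (rule ccontr)
    assume "i \<noteq> 0"
    then have "Y (rs F ! i) < Y (rs F ! 0)" using dec[of 0 i] i(1) by simp
    then show False using rng[of 0] i by (cases "rs F") auto
  qed
  moreover have "j = length (rs F) - 1"
  proof (rule ccontr)
    assume "j \<noteq> length (rs F) - 1"
    then have "Y (rs F ! (length (rs F) - 1)) < Y (rs F ! j)" using dec[of j "length (rs F) - 1"] j by auto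
    moreover have "length (rs F) - 1 < length (rs F)" using j(1) by linarith
    ultimately show False using rng[of "length (rs F) - 1"] j(2) by simp
  qed
  moreover have "2 \<le> length (rs F)"
  proof (rule ccontr)
    assume "\<not> 2 \<le> length (rs F)"
    then have "i = j" using i j by auto
    then show False using i j g(4) by auto
  qed
  ultimately have "ranked g F" unfolding ranked_def using g r(1) i j dec by simp
  then show ?thesis by blast
qed

section \<open>The flow network in terms of face boundaries\<close>

lemma tail_VF: assumes "F \<in> faces" shows "{e \<in> E. tl_of e = VF F} = (if marked F then {} else Ls F)"
proof -
  have "e \<in> E \<and> tl_of e = VF F \<longleftrightarrow> e \<in> (if marked F then {} else Ls F)" for e
  proof (cases "e \<in> E")
    case True
    then show ?thesis using Rface(2)[OF True assms] by (auto simp: tailG_def Let_def)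
  qed (auto simp: Ls_def)
  then show ?thesis by blast
qed

lemma head_VF: assumes "F \<in> faces" shows "{e \<in> E. hd_of e = VF F} = Rs F"
proof -
  have "e \<in> E \<and> hd_of e = VF F \<longleftrightarrow> e \<in> Rs F" for e
  proof (cases "e \<in> E")
    case True
    then show ?thesis using Lface(2)[OF True assms] by (auto simp: headG_def)
  qed (auto simp: Rs_def)
  then show ?thesis by blast
qed

lemma head_SF: "{e \<in> E. hd_of e = SF F m} = {}"
  by (simp add: headG_def)

text \<open>No mark sits strictly inside an edge, so every edge of the left boundary lies in exactly
  one gap between consecutive marks, and the definite description in \<open>tailG\<close> finds this
  gap.\<close>

lemma tail_SF:
  assumes F: "F \<in> faces" and mk: "marked F" and m: "1 \<le> m" "m < length (rs F)" and rk: "ranked g F"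
  shows "{e \<in> E. tl_of e = SF F m} = between g (rs F ! m) (rs F ! (m - 1))"
proof -
  note g = rankedD[OF rk] and rv = ranked_nth(1)[OF rk]
  have mono: "Y (rs F ! j) \<le> Y (rs F ! i)" if "i \<le> j" "j < length (rs F)" for i j
    using g(10)[of i j] that by (cases "i = j") auto
  have "(p, q) \<in> E \<and> tl_of (p, q) = SF F m \<longleftrightarrow> (p, q) \<in> between g (rs F ! m) (rs F ! (m - 1))" for p q
  proof (cases "(p, q) \<in> Ls F")
    case False
    have "Y (mn F) \<le> Y (rs F ! m)" "Y (rs F ! (m - 1)) \<le> Y (mx F)"
      using ranked_nth[OF rk] m by simp_all
    then have "(p, q) \<notin> between g (rs F ! m) (rs F ! (m - 1))"
      using False unfolding g(5) by (auto simp: between_def)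
    moreover have "\<not> ((p, q) \<in> E \<and> tl_of (p, q) = SF F m)"
      using Rface(2)[of "(p, q)" F] F False by (auto simp: tailG_def Let_def split: if_splits)
    ultimately show ?thesis by blast
  next
    case True
    then have e: "(p, q) \<in> E" and Rf: "Rface P R pos crv (HE p q) = F"
      using Rface(2)[of "(p, q)" F] F by (auto simp: Ls_def)
    have eg: "(p, q) \<in> edges g" "Y (mn F) \<le> Y p" "Y q \<le> Y (mx F)" using True unfolding g(5) by (auto simp: between_def)
    note pq = edges_verts[OF eg(1)] Y_E[OF e]
    let ?Q = "\<lambda>k. 1 \<le> k \<and> k < length (rs F) \<and> leh R (rs F ! k) p \<and> leh R q (rs F ! (k - 1))"
    have Q: "?Q k \<longleftrightarrow> 1 \<le> k \<and> k < length (rs F) \<and> Y (rs F ! k) \<le> Y p \<and> Y q \<le> Y (rs F ! (k - 1))" for k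
      using verts_leh_iff[OF g(1)] rv[of k] rv[of "k - 1"] pq by auto
    have uniq: "k = l" if "?Q k" "?Q l" for k l
    proof (rule ccontr)
      assume "k \<noteq> l"
      then consider "k < l" | "l < k" by linarith
      then show False
      proof cases
        case 1
        then have "Y (rs F ! (l - 1)) \<le> Y (rs F ! k)" using that unfolding Q by (intro mono) auto
        then show False using that pq(2) unfolding Q by auto
      next
        case 2
        then have "Y (rs F ! (k - 1)) \<le> Y (rs F ! l)" using that unfolding Q by (intro mono) auto
        then show False using that pq(2) unfolding Q by auto
      qed
    qed
    \<comment> \<open>The index of the highest mark not above \<open>p\<close>. It exists because
      the last mark is the minimum of \<open>F\<close>, and it is not 0 because the first mark is
      the maximum; the mark before it is above \<open>p\<close> and hence not below
      \<open>q\<close>.\<close>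
    define k where "k = (LEAST i. Y (rs F ! i) \<le> Y p)"
    have last: "Y (rs F ! (length (rs F) - 1)) \<le> Y p" using g(9) eg(2) by simp
    have k1: "Y (rs F ! k) \<le> Y p" unfolding k_def by (rule LeastI[of _ "length (rs F) - 1"]) (rule last)
    have k2: "k \<le> length (rs F) - 1" unfolding k_def by (rule Least_le) (rule last)
    have "k \<noteq> 0"
    proof
      assume "k = 0"
      then have "Y (mx F) \<le> Y p" using k1 g(8) by simp
      then show False using eg(3) pq(2) by simp
    qed
    then have "\<not> Y (rs F ! (k - 1)) \<le> Y p" using not_less_Least[of "k - 1" "\<lambda>i. Y (rs F ! i) \<le> Y p"] unfolding k_def[symmetric] by auto
    then have "Y q \<le> Y (rs F ! (k - 1))" using no_vert_inside_edge[OF eg(1) rv[of "k - 1"]] k2 m by auto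
    then have "?Q k" unfolding Q using k1 k2 \<open>k \<noteq> 0\<close> m by auto
    then have the_k: "(THE k. ?Q k) = k" using uniq by (intro the_equality) auto
    have "tl_of (p, q) = SF F k"
      unfolding tailG_def Let_def fst_conv snd_conv Rf using mk the_k by simp
    then have "tl_of (p, q) = SF F m \<longleftrightarrow> ?Q m" using \<open>?Q k\<close> uniq by auto
    also have "\<dots> \<longleftrightarrow> (p, q) \<in> between g (rs F ! m) (rs F ! (m - 1))"
      unfolding Q using m eg(1) by (auto simp: between_def)
    finally show ?thesis using e by blast
  qed
  then show ?thesis by auto
qed

lemma GV_iff: "v \<in> GV P R A pos crv \<longleftrightarrow> (\<exists>F\<in>faces. v = VF F \<and> F \<noteq> rface) \<or>
    (\<exists>F\<in>faces. \<exists>m. v = SF F m \<and> F \<noteq> lface \<and> marked F \<and> 1 \<le> m \<and> m < length (rs F))"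
  by (auto simp: GV_def)

text \<open>At the vertex \<open>VF F\<close> of a marked face nothing flows out, and at
  \<open>SF F m\<close> nothing flows in, so each of these conservation laws reduces to a single
  sum. The two sums of an unmarked face are those over its two boundaries.\<close>

lemma flow_iff:
  "f \<in> flow_polytope P R A lam pos crv \<longleftrightarrow> (\<forall>e. e \<notin> E \<longrightarrow> f e = 0) \<and> (\<forall>e\<in>E. 0 \<le> f e) \<and>
    (\<forall>F\<in>faces. F \<noteq> rface \<longrightarrow> (if marked F then sum f (Rs F) = lv (mx F) - lv (mn F) else sum f (Ls F) = sum f (Rs F))) \<and>
    (\<forall>F\<in>faces. F \<noteq> lface \<longrightarrow> marked F \<longrightarrow> (\<forall>m. 1 \<le> m \<and> m < length (rs F) \<longrightarrow>
      sum f {e \<in> E. tl_of e = SF F m} = lv (rs F ! (m - 1)) - lv (rs F ! m)))"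
proof -
  let ?C = "\<lambda>v. sum f {e \<in> E. tl_of e = v} - sum f {e \<in> E. hd_of e = v} = netflow P R A lam pos crv v"
  have "(\<forall>v\<in>GV P R A pos crv. ?C v) \<longleftrightarrow> (\<forall>F\<in>faces. F \<noteq> rface \<longrightarrow> ?C (VF F)) \<and>
     (\<forall>F\<in>faces. F \<noteq> lface \<longrightarrow> marked F \<longrightarrow> (\<forall>m. 1 \<le> m \<and> m < length (rs F) \<longrightarrow> ?C (SF F m)))"
    unfolding Ball_def[of "GV P R A pos crv"] GV_iff by blast
  moreover have "?C (VF F) \<longleftrightarrow> (if marked F then sum f (Rs F) = lv (mx F) - lv (mn F) else sum f (Ls F) = sum f (Rs F))"
    if "F \<in> faces" for F
    by (auto simp: tail_VF[OF that] head_VF[OF that])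
  moreover have "?C (SF F m) \<longleftrightarrow> sum f {e \<in> E. tl_of e = SF F m} = lv (rs F ! (m - 1)) - lv (rs F ! m)" for F m
    unfolding head_SF netflow.simps by simp
  ultimately show ?thesis unfolding flow_polytope_def by simp
qed

text \<open>\<open>Bot\<close> is covered by minimal elements of \<open>P\<close> and
  \<open>Top\<close> covers maximal ones, all of which are marked; an element of the nonempty
  \<open>P\<close> separates \<open>Bot\<close> from \<open>Top\<close>.\<close>

lemma E_cases:
  assumes "(p, q) \<in> E"
  obtains a where "p = Bot" "q = Elem a" "a \<in> A" | a where "p = Elem a" "q = Top" "a \<in> A"
  | a b where "p = Elem a" "q = Elem b" "a \<in> P" "b \<in> P" "(a, b) \<in> R" "a \<noteq> b"
proof -
  have c: "p \<in> V" "q \<in> V" "lth R p q" and no: "\<And>r. r \<in> V \<Longrightarrow> lth R p r \<Longrightarrow> lth R r q \<Longrightarrow> False"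
    using assms by (auto simp: E_iff covers_def)
  consider a where "p = Bot" "q = Elem a" | a where "p = Elem a" "q = Top" | "p = Bot" "q = Top"
    | a b where "p = Elem a" "q = Elem b"
    using c(3) by (cases p; cases q) (auto simp: lth_def)
  then show ?thesis
  proof cases
    case (1 a)
    then have "a \<in> P" using c by simp
    then have "a \<in> A" by (rule minimal_A) (use 1 no[of "Elem _"] in \<open>force simp: lth_def\<close>)
    then show ?thesis using that(1) 1 by blast
  next
    case (2 a)
    then have "a \<in> P" using c by simp
    then have "a \<in> A" by (rule maximal_A) (use 2 no[of "Elem _"] in \<open>force simp: lth_def\<close>)
    then show ?thesis using that(2) 2 by blast
  next
    case 3
    obtain r where "r \<in> P" using neP by blast
    then show ?thesis using no[of "Elem r"] 3 by (auto simp: lth_def)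
  next
    case (4 a b)
    then show ?thesis using that(3) c by (auto simp: lth_def)
  qed
qed

lemma A_nonempty: "A \<noteq> {}"
proof -
  have "(Bot, Top) \<in> E\<^sup>+" by (rule lth_E_trancl) (auto simp: lth_def)
  then obtain q where "(Bot, q) \<in> E" by (meson tranclD)
  then show ?thesis by (cases rule: E_cases) auto
qed

lemma lv_bounds: "a \<in> A \<Longrightarrow> lv Bot \<le> lam a" "a \<in> A \<Longrightarrow> lam a \<le> lv Top"
  using fin_A by auto

section \<open>From the marked order polytope to flows\<close>

lemma xh_marked: "x \<in> order_polytope P R A lam \<Longrightarrow> v \<in> Marked A \<Longrightarrow> xh A lam x v = lv v"
  by (auto simp: order_polytope_def Marked_def)

lemma xh_mono: assumes "x \<in> order_polytope P R A lam" "(p, q) \<in> E" shows "xh A lam x p \<le> xh A lam x q"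
  using assms(2)
proof (cases rule: E_cases)
  case (1 a)
  then show ?thesis using assms(1) lv_bounds(1) by (auto simp: order_polytope_def)
next
  case (2 a)
  then show ?thesis using assms(1) lv_bounds(2) by (auto simp: order_polytope_def)
next
  case (3 a b)
  then show ?thesis using assms(1) by (auto simp: order_polytope_def)
qed

lemma Gamma_sum: assumes "S \<subseteq> E" shows "sum (Gamma_map P R A lam x) S = (\<Sum>e\<in>S. xh A lam x (snd e) - xh A lam x (fst e))"
  by (rule sum.cong) (use assms in \<open>auto simp: Gamma_map_def\<close>)

lemma Gamma_between:
  assumes "g \<in> chains" "v \<in> verts g" "w \<in> verts g" "Y v \<le> Y w"
  shows "sum (Gamma_map P R A lam x) (between g v w) = xh A lam x w - xh A lam x v"
proof -
  have "between g v w \<subseteq> E" using edges_E by (auto simp: between_def)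
  then show ?thesis using sum_between[OF assms, of "xh A lam x"] by (simp add: Gamma_sum)
qed

lemma Gamma_flow:
  assumes x: "x \<in> order_polytope P R A lam"
  shows "Gamma_map P R A lam x \<in> flow_polytope P R A lam pos crv"
  unfolding flow_iff
proof (intro conjI ballI allI impI)
  let ?f = "Gamma_map P R A lam x"
  have R: "sum ?f (Rs F) = xh A lam x (mx F) - xh A lam x (mn F)" if F: "F \<in> faces" "F \<noteq> rface" for F
    using face_right[OF F] Gamma_between by (metis less_imp_le)
  have L: "sum ?f (Ls F) = xh A lam x (mx F) - xh A lam x (mn F)" if F: "F \<in> faces" "F \<noteq> lface" for F
    using face_left[OF F] Gamma_between by (metis less_imp_le)
  show "?f e = 0" if "e \<notin> E" for e using that by (simp add: Gamma_map_def)
  show "0 \<le> ?f e" if "e \<in> E" for e using that xh_mono[OF x, of "fst e" "snd e"] by (simp add: Gamma_map_def)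
  show "if marked F then sum ?f (Rs F) = lv (mx F) - lv (mn F) else sum ?f (Ls F) = sum ?f (Rs F)"
    if F: "F \<in> faces" "F \<noteq> rface" for F
  proof (cases "marked F")
    case True
    then show ?thesis using R[OF F] marks[OF F(1)] xh_marked[OF x] by simp
  next
    case False
    \<comment> \<open>The additional left edge carries the marked elements \<open>Bot\<close> and
      \<open>Top\<close>, so an unmarked face has a left boundary made of Hasse edges, along which
      differences telescope.\<close>
    then have "F \<noteq> lface" using marked_lface by blast
    then show ?thesis using R[OF F] L[OF F(1)] False by simp
  qed
  show "sum ?f {e \<in> E. tl_of e = SF F m} = lv (rs F ! (m - 1)) - lv (rs F ! m)"
    if F: "F \<in> faces" "F \<noteq> lface" "marked F" and m: "1 \<le> m \<and> m < length (rs F)" for F m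
  proof -
    obtain g where rk: "ranked g F" using ranked_exists[OF F] by blast
    note g = rankedD[OF rk]
    have "{e \<in> E. tl_of e = SF F m} = between g (rs F ! m) (rs F ! (m - 1))"
      by (rule tail_SF) (use F m rk in auto)
    moreover have "Y (rs F ! m) \<le> Y (rs F ! (m - 1))" using g(10)[of "m - 1" m] m by auto
    moreover have "m - 1 < length (rs F)" using m by linarith
    ultimately show ?thesis
      using Gamma_between[OF g(1), of "rs F ! m" "rs F ! (m - 1)" x] ranked_nth[OF rk, of m] ranked_nth[OF rk, of "m - 1"] xh_marked[OF x] m by simp
  qed
qed

section \<open>From flows to the marked order polytope\<close>

lemma mark_sums:
  assumes f: "f \<in> flow_polytope P R A lam pos crv" and F: "F \<in> faces" "F \<noteq> lface" "marked F"
    and rk: "ranked g F" and k: "k < length (rs F)"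
  shows "sum f (between g (rs F ! k) (mx F)) = lv (mx F) - lv (rs F ! k)"
  using k
proof (induction k)
  case 0
  then show ?case using rankedD(8)[OF rk] by (simp add: between_self)
next
  case (Suc k)
  then have k: "k < length (rs F)" by simp
  note v = ranked_nth[OF rk k]
  \<comment> \<open>Conservation at the split vertex \<open>SF F (Suc k)\<close> covers the gap just
    below mark \<open>k\<close> and extends the telescoping by one mark.\<close>
  have "\<forall>m. 1 \<le> m \<and> m < length (rs F) \<longrightarrow> sum f {e \<in> E. tl_of e = SF F m} = lv (rs F ! (m - 1)) - lv (rs F ! m)"
    using f F unfolding flow_iff by blast
  then have "sum f {e \<in> E. tl_of e = SF F (Suc k)} = lv (rs F ! k) - lv (rs F ! Suc k)"
    using Suc.prems by force
  moreover have "{e \<in> E. tl_of e = SF F (Suc k)} = between g (rs F ! Suc k) (rs F ! (Suc k - 1))"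
    by (rule tail_SF) (use F rk Suc.prems in auto)
  ultimately have "sum f (between g (rs F ! Suc k) (rs F ! k)) = lv (rs F ! k) - lv (rs F ! Suc k)" by simp
  moreover have "Y (rs F ! Suc k) \<le> Y (rs F ! k)" using rankedD(10)[OF rk, of k "Suc k"] Suc.prems by auto
  ultimately show ?case
    using Suc.IH[OF k] between_split[OF v(1) _ v(4), of "rs F ! Suc k"] by (simp add: sum.union_disjoint)
qed

lemma flow_potential:
  assumes f: "f \<in> flow_polytope P R A lam pos crv"
  obtains x where "x \<in> order_polytope P R A lam" "Gamma_map P R A lam x = f"
proof -
  have bal: "sum f (Ls F) = sum f (Rs F)" if F: "F \<in> faces" "F \<noteq> lface" "F \<noteq> rface" for F
  proof (cases "marked F")
    case False
    then show ?thesis using f F unfolding flow_iff by metis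
  next
    case True
    \<comment> \<open>For a marked face the split vertices replace the balance: added up over all
      gaps, they give the left boundary the same prescribed total that \<open>VF F\<close> demands
      of the right boundary.\<close>
    obtain g where rk: "ranked g F" using ranked_exists[OF F(1,2) True] by blast
    note g = rankedD[OF rk]
    have "length (rs F) - 1 < length (rs F)" using g(7) by auto
    from mark_sums[OF f F(1,2) True rk this] have "sum f (Ls F) = lv (mx F) - lv (mn F)"
      unfolding g(5,9) .
    then show ?thesis using f F True unfolding flow_iff by metis
  qed
  obtain pot0 where pot0: "pot0 Bot = 0" "\<And>p q. (p, q) \<in> E \<Longrightarrow> pot0 q - pot0 p = f (p, q)" "pot0 Top = sum f (Rs lface)"
    using potential_exists[of f] bal by blast
  \<comment> \<open>A potential is determined up to a constant; the constant is chosen to give the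
    prescribed value at \<open>Bot\<close>.\<close>
  define pot where "pot v = pot0 v + lv Bot" for v
  have pot: "pot Bot = lv Bot" "\<And>p q. (p, q) \<in> E \<Longrightarrow> pot q - pot p = f (p, q)" using pot0 by (auto simp: pot_def)
  \<comment> \<open>This is conservation at the left outer face, whose extremal vertices are
    \<open>Bot\<close> and \<open>Top\<close>; it fixes the value at \<open>Top\<close>.\<close>
  have "sum f (Rs lface) = lv Top - lv Bot"
    using f lface_faces lface_ne_rface marked_lface minmax_lface unfolding flow_iff by metis
  then have pot_Top: "pot Top = lv Top" using pot0 by (simp add: pot_def)
  have pot_between: "sum f (between g v w) = pot w - pot v" if "g \<in> chains" "v \<in> verts g" "w \<in> verts g" "Y v \<le> Y w" for g v w
  proof -
    have "sum f (between g v w) = (\<Sum>e\<in>between g v w. pot (snd e) - pot (fst e))"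
      by (rule sum.cong) (use pot(2) edges_E in \<open>force simp: between_def\<close>)+
    then show ?thesis using sum_between[OF that, of pot] by simp
  qed
  have mono: "pot p \<le> pot q" if "(p, q) \<in> E\<^sup>*" for p q
    using that
  proof (induction rule: rtrancl_induct)
    case (step q r)
    have "0 \<le> f (q, r)" using f step(2) unfolding flow_iff by blast
    then show ?case using step pot(2)[OF step(2)] by simp
  qed simp
  have pot_mark: "pot v = lv v" if "v \<in> V" "v \<in> Marked A" for v
    using that
  proof (induction "card {w \<in> V. Y w < Y v}" arbitrary: v rule: less_induct)
    case less
    show ?case
    proof (cases "v = Bot")
      case True
      then show ?thesis using pot by simp
    next
      case False
      then have "(Bot, v) \<in> E\<^sup>+" using less.prems by (intro lth_E_trancl) (auto simp: lth_def)
      then obtain p where e: "(p, v) \<in> E" by (meson tranclD2)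
      \<comment> \<open>The face right of an edge ending in \<open>v\<close> has \<open>v\<close> on
        its left boundary, hence is marked; its minimum is marked and strictly lower, so the
        induction hypothesis applies to it.\<close>
      define F where "F = Rface P R pos crv (HE p v)"
      have F: "F \<in> faces" "(p, v) \<in> Ls F" using Rface[OF e] by (auto simp: F_def)
      have FL: "F \<noteq> lface" using F(2) Ls_lface by blast
      have "v \<in> LBv P R pos crv F" using F(2) unfolding LBv_eq by force
      then have mk: "marked F" using less.prems by (auto simp: hasMarked_def)
      obtain g where rk: "ranked g F" using ranked_exists[OF F(1) FL mk] by blast
      note g = rankedD[OF rk]
      have eg: "(p, v) \<in> edges g" "Y (mn F) \<le> Y p" "Y v \<le> Y (mx F)" using F(2) unfolding g(5) by (auto simp: between_def)
      have vg: "v \<in> verts g" using edges_verts[OF eg(1)] by simp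
      have lt: "Y (mn F) < Y v" using Y_E[OF e] eg(2) by simp
      have "v \<in> set (rs F)" unfolding g(6) using vg lt eg(3) less.prems by simp
      then obtain k where k: "k < length (rs F)" "rs F ! k = v" by (meson in_set_conv_nth)
      have l: "length (rs F) - 1 < length (rs F)" using g(7) by auto
      note ms = mark_sums[OF f F(1) FL mk rk]
      \<comment> \<open>The potential at the maximum of \<open>F\<close> is not known yet, but it
        cancels between the two differences, leaving \<open>v\<close> compared with the
        minimum.\<close>
      have 1: "pot (mx F) - pot v = lv (mx F) - lv v"
        using ms[OF k(1)] pot_between[OF g(1) vg g(3) eg(3)] k(2) by simp
      have 2: "pot (mx F) - pot (mn F) = lv (mx F) - lv (mn F)"
        using ms[OF l] pot_between[OF g(1) g(2) g(3)] g(4,9) by simp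
      have mV: "mn F \<in> V" using g(2) by (simp add: verts_def)
      have "card {w \<in> V. Y w < Y (mn F)} < card {w \<in> V. Y w < Y v}"
      proof (rule psubset_card_mono)
        show "{w \<in> V. Y w < Y (mn F)} \<subset> {w \<in> V. Y w < Y v}" using lt mV by fastforce
      qed simp
      then have "pot (mn F) = lv (mn F)" using less.hyps mV marks[OF F(1) mk] by blast
      then show ?thesis using 1 2 by simp
    qed
  qed
  define x where "x p = (if p \<in> P then pot (Elem p) else 0)" for p
  have xh: "xh A lam x v = pot v" if "v \<in> V" for v
    using that pot(1) pot_Top by (cases v) (auto simp: x_def)
  have "x \<in> order_polytope P R A lam"
    unfolding order_polytope_def
  proof (intro CollectI conjI allI impI ballI)
    show "x p = 0" if "p \<notin> P" for p using that by (simp add: x_def)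
    show "x p \<le> x q" if "p \<in> P" "q \<in> P" "(p, q) \<in> R \<and> p \<noteq> q" for p q
      using mono[OF leh_E_rtrancl, of "Elem p" "Elem q"] that by (simp add: x_def)
    show "x a = lam a" if "a \<in> A" for a
      using pot_mark[of "Elem a"] A_P that by (auto simp: x_def Marked_def)
  qed
  moreover have "Gamma_map P R A lam x = f"
  proof
    fix e
    show "Gamma_map P R A lam x e = f e"
    proof (cases "e \<in> E")
      case True
      then show ?thesis using xh pot(2)[of "fst e" "snd e"] E_V[of "fst e" "snd e"] by (simp add: Gamma_map_def)
    next
      case False
      then have "f e = 0" using f unfolding flow_iff by blast
      then show ?thesis using False by (simp add: Gamma_map_def)
    qed
  qed
  ultimately show ?thesis using that by blast
qed

lemma Gamma_image: "Gamma_map P R A lam ` order_polytope P R A lam = flow_polytope P R A lam pos crv"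
proof
  show "flow_polytope P R A lam pos crv \<subseteq> Gamma_map P R A lam ` order_polytope P R A lam"
    by (rule subsetI, erule flow_potential) blast
qed (use Gamma_flow in blast)

section \<open>Injectivity, integrality and affine hulls\<close>

lemma Gamma_diff:
  assumes "(p, q) \<in> E"
  shows "xh A lam x q = xh A lam x p + Gamma_map P R A lam x (p, q)"
  using assms by (simp add: Gamma_map_def)

lemma Gamma_inj:
  assumes "\<And>p. p \<notin> P \<Longrightarrow> x p = 0" "\<And>p. p \<notin> P \<Longrightarrow> x' p = 0" "Gamma_map P R A lam x = Gamma_map P R A lam x'"
  shows "x = x'"
proof
  fix p
  have "xh A lam x v = xh A lam x' v" if "(Bot, v) \<in> E\<^sup>*" for v
    using that
  proof (induction rule: rtrancl_induct)
    case (step p q)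
    then show ?case using Gamma_diff[OF step(2)] assms(3) by metis
  qed simp
  then show "x p = x' p" using Bot_E_rtrancl[of "Elem p"] assms(1,2) by (cases "p \<in> P") force+
qed

text \<open>The values at \<open>Bot\<close> and \<open>Top\<close> are a minimum and a maximum of
  finitely many integers. Starting from \<open>Bot\<close>, integer edge values propagate
  integrality upward; the other direction takes differences.\<close>

lemma Gamma_Ints:
  assumes int: "\<forall>a\<in>A. lam a \<in> \<int>" and x: "\<And>p. p \<notin> P \<Longrightarrow> x p = 0"
  shows "Gamma_map P R A lam x \<in> int_points \<longleftrightarrow> x \<in> int_points"
proof
  have lvB: "lv Bot \<in> \<int>" "lv Top \<in> \<int>" 
  proof -
    have "Min (lam ` A) \<in> lam ` A" "Max (lam ` A) \<in> lam ` A"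
      using fin_A A_nonempty by (auto intro!: Min_in Max_in)
    then show "lv Bot \<in> \<int>" "lv Top \<in> \<int>" using int by force+
  qed
  {
    assume G: "Gamma_map P R A lam x \<in> int_points"
    have "xh A lam x v \<in> \<int>" if "(Bot, v) \<in> E\<^sup>*" for v
      using that
    proof (induction rule: rtrancl_induct)
      case base
      then show ?case using lvB by simp
    next
      case (step p q)
      then show ?case using Gamma_diff[OF step(2), of x] G by (simp add: int_points_def)
    qed
    then have "x p \<in> \<int>" for p using Bot_E_rtrancl[of "Elem p"] x by (cases "p \<in> P") force+
    then show "x \<in> int_points" by (simp add: int_points_def)
  }
  {
    assume "x \<in> int_points"
    then have "xh A lam x v \<in> \<int>" for v using lvB by (cases v) (auto simp: int_points_def)
    then show "Gamma_map P R A lam x \<in> int_points" by (simp add: int_points_def Gamma_map_def)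
  }
qed

text \<open>The values at \<open>Bot\<close> and \<open>Top\<close> do not depend on the point, so
  they survive a combination because its weights add up to 1.\<close>

lemma xh_affine:
  assumes "sum u T = (1::real)"
  shows "xh A lam (\<lambda>i. \<Sum>t\<in>T. u t * t i) v = (\<Sum>t\<in>T. u t * xh A lam t v)"
  using assms by (cases v) (simp_all add: sum_distrib_right[symmetric])

lemma Gamma_affine:
  assumes "sum u T = (1::real)"
  shows "Gamma_map P R A lam (\<lambda>i. \<Sum>t\<in>T. u t * t i) = (\<lambda>e. \<Sum>t\<in>T. u t * Gamma_map P R A lam t e)"
  by (rule ext) (simp add: Gamma_map_def xh_affine[OF assms] right_diff_distrib sum_subtractf)

lemma hull_zero:
  assumes "x \<in> fun_affine_hull (order_polytope P R A lam)" "p \<notin> P" shows "x p = 0"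
  using assms by (force simp: fun_affine_hull_def order_polytope_def intro!: sum.neutral)

text \<open>Stated on all functions vanishing off \<open>P\<close> rather than on the polytope, so
  that it also covers the affine hull.\<close>

lemma inj_Gamma: "inj_on (Gamma_map P R A lam) {x. \<forall>p. p \<notin> P \<longrightarrow> x p = 0}"
  by (rule inj_onI) (use Gamma_inj in auto)

lemma polytope_zero: "order_polytope P R A lam \<subseteq> {x. \<forall>p. p \<notin> P \<longrightarrow> x p = 0}"
  by (auto simp: order_polytope_def)

text \<open>Coefficients in \<open>fun_affine_hull\<close> are indexed by the points themselves, so
  transporting a combination along the map requires that points are not identified; injectivity on
  the polytope ensures this.\<close>

lemma Gamma_hull:
  "Gamma_map P R A lam ` fun_affine_hull (order_polytope P R A lam) = fun_affine_hull (flow_polytope P R A lam pos crv)"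
proof -
  let ?G = "Gamma_map P R A lam" and ?O = "order_polytope P R A lam"
  have inj: "inj_on ?G ?O" using inj_Gamma polytope_zero inj_on_subset by blast
  have *: "?G (\<lambda>i. \<Sum>t\<in>T. u t * t i) = (\<lambda>e. \<Sum>s\<in>?G ` T. u' s * s e)"
    if T: "T \<subseteq> ?O" "sum u T = 1" "\<And>t. t \<in> T \<Longrightarrow> u' (?G t) = u t" for T u u'
  proof -
    have "inj_on ?G T" using inj T inj_on_subset by blast
    then show ?thesis using T by (simp add: Gamma_affine sum.reindex)
  qed
  have "?G x \<in> fun_affine_hull (?G ` ?O)" if x: "x \<in> fun_affine_hull ?O" for x
  proof -
    obtain T u where T: "finite T" "T \<subseteq> ?O" "T \<noteq> {}" "sum u T = 1" "x = (\<lambda>i. \<Sum>t\<in>T. u t * t i)"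
      using x by (auto simp: fun_affine_hull_def)
    have injT: "inj_on ?G T" using inj T inj_on_subset by blast
    let ?u = "\<lambda>s. u (inv_into T ?G s)"
    have u: "?u (?G t) = u t" if "t \<in> T" for t using injT that by simp
    then have "sum ?u (?G ` T) = 1" using T(4) by (simp add: sum.reindex[OF injT])
    moreover have "?G x = (\<lambda>e. \<Sum>s\<in>?G ` T. ?u s * s e)" unfolding T(5) by (rule *) (use T u in auto)
    ultimately show ?thesis using T unfolding fun_affine_hull_def by blast
  qed
  moreover have "y \<in> ?G ` fun_affine_hull ?O" if y: "y \<in> fun_affine_hull (?G ` ?O)" for y
  proof -
    obtain T u where T: "finite T" "T \<subseteq> ?G ` ?O" "T \<noteq> {}" "sum u T = 1" "y = (\<lambda>i. \<Sum>t\<in>T. u t * t i)"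
      using y by (auto simp: fun_affine_hull_def)
    \<comment> \<open>One preimage is chosen for each point of \<open>T\<close>, so that the
      coefficients can be pulled back without repetition.\<close>
    obtain S where S: "S \<subseteq> ?O" "inj_on ?G S" "T = ?G ` S" using T(2) by (meson subset_image_inj)
    have "finite S" "S \<noteq> {}" using S T(1,3) finite_imageD by auto
    moreover have s1: "(\<Sum>s\<in>S. u (?G s)) = 1" using T(4) S by (simp add: sum.reindex)
    ultimately have "(\<lambda>i. \<Sum>s\<in>S. u (?G s) * s i) \<in> fun_affine_hull ?O"
      using S(1) unfolding fun_affine_hull_def by blast
    moreover have "?G (\<lambda>i. \<Sum>s\<in>S. u (?G s) * s i) = y" unfolding T(5) S(3) by (rule *) (use S s1 in auto)
    ultimately show ?thesis by blast
  qed
  ultimately show ?thesis unfolding Gamma_image by blast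
qed

lemma Gamma_equivalence:
  assumes int: "\<forall>a\<in>A. lam a \<in> \<int>"
  shows "integral_equivalence (Gamma_map P R A lam) (order_polytope P R A lam) (flow_polytope P R A lam pos crv)"
  unfolding integral_equivalence_def
proof
  let ?G = "Gamma_map P R A lam" and ?O = "order_polytope P R A lam"
  show "bij_betw ?G ?O (flow_polytope P R A lam pos crv)"
    unfolding bij_betw_def using Gamma_image inj_Gamma polytope_zero inj_on_subset by blast
  let ?H = "fun_affine_hull ?O"
  have z: "?H \<subseteq> {x. \<forall>p. p \<notin> P \<longrightarrow> x p = 0}" using hull_zero by blast
  have "?G x \<in> int_points \<longleftrightarrow> x \<in> int_points" if "x \<in> ?H" for x
    by (rule Gamma_Ints[OF int]) (rule hull_zero[OF that])
  then have "?G ` (int_points \<inter> ?H) = int_points \<inter> ?G ` ?H" by blast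
  moreover have "inj_on ?G (int_points \<inter> ?H)" using inj_Gamma z by (meson inf_le2 inj_on_subset order_trans)
  ultimately show "bij_betw ?G (int_points \<inter> ?H) (int_points \<inter> fun_affine_hull (flow_polytope P R A lam pos crv))"
    unfolding bij_betw_def Gamma_hull by blast
qed

end

theorem theorem1p2:
  fixes P :: "'p set" and R :: "('p \<times> 'p) set" and A :: "'p set" and lam :: "'p \<Rightarrow> real"
    and pos :: "'p ext \<Rightarrow> complex" and crv :: "'p hedge \<Rightarrow> real \<Rightarrow> complex"
  assumes "marked_poset P R A lam"
    and "P \<noteq> {}"
    and "\<forall>a\<in>A. lam a \<in> \<int>"
    and "bsp_embedding_of P R A pos crv"
  shows "integral_equivalence (Gamma_map P R A lam) (order_polytope P R A lam)
           (flow_polytope P R A lam pos crv)"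
proof -
  interpret marked_embedding P R pos crv A lam
    by unfold_locales (use assms in \<open>auto simp: marked_poset_def bsp_embedding_of_def\<close>)
  show ?thesis by (rule Gamma_equivalence) (rule assms)
qed

end
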